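(* Let $n\ge 3$. The map $\beta\mapsto f(\beta)$, which assigns to a pure braid on $n$ strands, represented by a good and stable braid $\beta$, the element of ${}'G_n^3$ given by the product, in order of increasing $t$, of the generators corresponding to the critical moments of $\beta$, is a (well-defined) homomorphism from the pure braid group $PB_n$ to the group ${}'G_n^3$.
   Context: Let $n\ge 3$. The group ${}'G_n^3$ is given by a presentation with $3\binom{n}{3}$ generators $a'_{ijk}$ indexed by ordered triples of pairwise distinct numbers $i,j,k\in\{1,\dots,n\}$ up to reversal of the order, i.e. $a'_{ijk}=a'_{kji}$ (so $a'_{123}=a'_{321}\ne a'_{132}$), and relations: (1) $(a'_{ijk})^2=1$ for all pairwise distinct $i,j,k$; (2) $a'_{ijk}a'_{pqr}=a'_{pqr}a'_{ijk}$ for all triples of pairwise distinct numbers $i,j,k$ and $p,q,r$ with $|\{i,j,k\}\cap\{p,q,r\}|<2$; (3) $(a'_{ijk}a'_{ijl}a'_{ikl}a'_{jkl})^2=1$ for every quadruple of pairwise distinct $i,j,k,l\in\{1,\dots,n\}$. Braids. Fix the base points $z_j=\exp(2\pi \sqrt{-1}\,j/n)$, $j=1,\dots,n$, uniformly distributed on the unit circle. A (pure) braid is a collection of smooth functions $\beta(t)=(z_1(t),\dots,z_n(t))$, $t\in[0,1]$, with values in $\mathbb{C}=\mathbb{R}^2$, such that $z_j(0)=z_j(1)=z_j$ for all $j$ and $z_1(t),\dots,z_n(t)$ are pairwise distinct for every $t$. The pure braid group $PB_n$ is the group of isotopy classes of such braids, the product being concatenation. A critical moment of $\beta$ is a value $t$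 for which there are three distinct indices $i,j,k$ such that $z_i(t),z_j(t),z_k(t)$ are collinear. A braid is good and stable if: (i) its set of critical moments is finite; (ii) for each critical moment $t$ there is exactly one triple of indices $\{i,j,k\}$ for which $z_i(t),z_j(t),z_k(t)$ are collinear; (iii) any small perturbation of the braid does not change the number of critical moments. Any braid can be made good and stable by a small perturbation, so every element of $PB_n$ has a good and stable representative. The map $f$. Let $\beta$ be a good and stable pure braid with critical moments $t_1<t_2<\dots<t_m$. With $t_l$ one associates the generator $a'_{i_lj_lk_l}$, where $z_{i_l}(t_l),z_{j_l}(t_l),z_{k_l}(t_l)$ are the three collinear points and $z_{j_l}(t_l)$ is the one lying between the other two. Then $f(\beta)=a'_{i_1j_1k_1}a'_{i_2j_2k_2}\cdots a'_{i_mj_mk_m}\in {}'G_n^3$. *)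

theory Defs
  imports "HOL-Analysis.Analysis" "HOL-Algebra.Group"
begin

text \<open>A word is a list of letters \<open>(g, True)\<close>, standing for the generator \<open>g\<close>, and \<open>(g, False)\<close>,
  standing for its inverse. A pair \<open>(u, v)\<close> in \<open>R\<close> is the defining relation \<open>u = v\<close>.\<close>

type_synonym 'g word = "('g \<times> bool) list"

definition words :: "'g set \<Rightarrow> 'g word set" where
  "words S = lists (S \<times> UNIV)"

inductive_set word_cong :: "'g set \<Rightarrow> ('g word \<times> 'g word) set \<Rightarrow> ('g word \<times> 'g word) set"
  for S :: "'g set" and R :: "('g word \<times> 'g word) set"
  where
    refl: "w \<in> words S \<Longrightarrow> (w, w) \<in> word_cong S R"
  | sym: "(u, v) \<in> word_cong S R \<Longrightarrow> (v, u) \<in> word_cong S R"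
  | trans: "(u, v) \<in> word_cong S R \<Longrightarrow> (v, w) \<in> word_cong S R \<Longrightarrow> (u, w) \<in> word_cong S R"
  | append: "(u, v) \<in> word_cong S R \<Longrightarrow> (u', v') \<in> word_cong S R \<Longrightarrow> (u @ u', v @ v') \<in> word_cong S R"
  | cancel: "g \<in> S \<Longrightarrow> ([(g, b), (g, \<not> b)], []) \<in> word_cong S R"
  | relation: "(u, v) \<in> R \<Longrightarrow> u \<in> words S \<Longrightarrow> v \<in> words S \<Longrightarrow> (u, v) \<in> word_cong S R"

definition presented_group :: "'g set \<Rightarrow> ('g word \<times> 'g word) set \<Rightarrow> 'g word set monoid" where
  "presented_group S R =
    \<lparr>carrier = words S // word_cong S R,
     mult = (\<lambda>A B. {w. \<exists>u\<in>A. \<exists>v\<in>B. (u @ v, w) \<in> word_cong S R}),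
     one = word_cong S R `` {[]}\<rparr>"

text \<open>A triple up to reversal is the set consisting of the triple and its reversal; the middle index
  is well-defined.\<close>

type_synonym generator = "(nat \<times> nat \<times> nat) set"

definition gen :: "nat \<Rightarrow> nat \<Rightarrow> nat \<Rightarrow> generator" where
  "gen i j k = {(i, j, k), (k, j, i)}"

definition generators :: "nat \<Rightarrow> generator set" where
  "generators n = {gen i j k | i j k. {i, j, k} \<subseteq> {1..n} \<and> distinct [i, j, k]}"

definition letter :: "nat \<Rightarrow> nat \<Rightarrow> nat \<Rightarrow> generator \<times> bool" where
  "letter i j k = (gen i j k, True)"

definition relations :: "nat \<Rightarrow> (generator word \<times> generator word) set" where
  "relations n =
    {([letter i j k, letter i j k], []) | i j k.
       {i, j, k} \<subseteq> {1..n} \<and> distinct [i, j, k]}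
  \<union> {([letter i j k, letter p q r], [letter p q r, letter i j k]) | i j k p q r.
       {i, j, k} \<subseteq> {1..n} \<and> distinct [i, j, k] \<and> {p, q, r} \<subseteq> {1..n} \<and> distinct [p, q, r] \<and>
       card ({i, j, k} \<inter> {p, q, r}) < 2}
  \<union> {([letter i j k, letter i j l, letter i k l, letter j k l,
       letter i j k, letter i j l, letter i k l, letter j k l], []) | i j k l.
       {i, j, k, l} \<subseteq> {1..n} \<and> distinct [i, j, k, l]}"

definition G3 :: "nat \<Rightarrow> generator word set monoid" where
  "G3 n = presented_group (generators n) (relations n)"

text \<open>The strand with index \<open>j\<close> is the \<open>j\<close>-th coordinate for \<open>j \<in> {1..n}\<close>; the other coordinates
  are kept at \<open>0\<close>.\<close>

definition conf :: "nat \<Rightarrow> (nat \<Rightarrow> complex) set" where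
  "conf n = {z. inj_on z {1..n} \<and> (\<forall>j. j \<notin> {1..n} \<longrightarrow> z j = 0)}"

definition base :: "nat \<Rightarrow> nat \<Rightarrow> complex" where
  "base n j = (if j \<in> {1..n} then exp (2 * of_real pi * \<i> * of_nat j / of_nat n) else 0)"

text \<open>Derivatives on \<open>[0,1]\<close>, one-sided at the end points.\<close>

definition deriv01 :: "nat \<Rightarrow> (real \<Rightarrow> complex) \<Rightarrow> real \<Rightarrow> complex" where
  "deriv01 k = (\<lambda>g t. vector_derivative g (at t within {0..1})) ^^ k"

definition smooth01 :: "(real \<Rightarrow> complex) \<Rightarrow> bool" where
  "smooth01 g \<longleftrightarrow> (\<forall>k. deriv01 k g differentiable_on {0..1})"

definition pure_braid :: "nat \<Rightarrow> (real \<Rightarrow> nat \<Rightarrow> complex) \<Rightarrow> bool" where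
  "pure_braid n \<beta> \<longleftrightarrow>
    (\<forall>t\<in>{0..1}. \<beta> t \<in> conf n) \<and> pathstart \<beta> = base n \<and> pathfinish \<beta> = base n \<and>
    (\<forall>j\<in>{1..n}. smooth01 (\<lambda>t. \<beta> t j))"

text \<open>An isotopy is a continuous deformation all of whose stages are pure braids.\<close>

definition isotopy :: "nat \<Rightarrow> ((real \<Rightarrow> nat \<Rightarrow> complex) \<times> (real \<Rightarrow> nat \<Rightarrow> complex)) set" where
  "isotopy n = {(\<alpha>, \<beta>). homotopic_with_canon (pure_braid n) {0..1} (conf n) \<alpha> \<beta>}"

text \<open>The concatenation \<open>\<alpha> +++ \<beta>\<close> of two smooth braids need not be smooth at \<open>t = 1/2\<close>. The product
  of two classes is the class of the concatenations, taken over those representatives for which the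
  concatenation is smooth (for instance, representatives that are constant near \<open>t = 0\<close> and \<open>t = 1\<close>).\<close>

definition PB :: "nat \<Rightarrow> (real \<Rightarrow> nat \<Rightarrow> complex) set monoid" where
  "PB n =
    \<lparr>carrier = Collect (pure_braid n) // isotopy n,
     mult = (\<lambda>A B. {\<gamma>. \<exists>\<alpha>\<in>A. \<exists>\<beta>\<in>B. pure_braid n (\<alpha> +++ \<beta>) \<and> (\<alpha> +++ \<beta>, \<gamma>) \<in> isotopy n}),
     one = isotopy n `` {\<lambda>t. base n}\<rparr>"

definition collinear_triple :: "nat \<Rightarrow> (nat \<Rightarrow> complex) \<Rightarrow> nat set \<Rightarrow> bool" where
  "collinear_triple n z T \<longleftrightarrow> T \<subseteq> {1..n} \<and> card T = 3 \<and> collinear (z ` T)"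

definition critical_moments :: "nat \<Rightarrow> (real \<Rightarrow> nat \<Rightarrow> complex) \<Rightarrow> real set" where
  "critical_moments n \<beta> = {t \<in> {0..1}. \<exists>T. collinear_triple n (\<beta> t) T}"

text \<open>Small perturbations are understood in the topology of uniform convergence of all derivatives:
  a neighbourhood of \<open>\<beta>\<close> bounds the difference of finitely many derivatives. The finiteness condition
  is needed because \<open>card\<close> is \<open>0\<close> on infinite sets.\<close>

definition close_braids ::
  "nat \<Rightarrow> nat \<Rightarrow> real \<Rightarrow> (real \<Rightarrow> nat \<Rightarrow> complex) \<Rightarrow> (real \<Rightarrow> nat \<Rightarrow> complex) \<Rightarrow> bool" where
  "close_braids n r \<epsilon> \<beta> \<gamma> \<longleftrightarrow>
    (\<forall>k\<le>r. \<forall>j\<in>{1..n}. \<forall>t\<in>{0..1}. dist (deriv01 k (\<lambda>t. \<beta> t j) t) (deriv01 k (\<lambda>t. \<gamma> t j) t) < \<epsilon>)"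

definition stable :: "nat \<Rightarrow> (real \<Rightarrow> nat \<Rightarrow> complex) \<Rightarrow> bool" where
  "stable n \<beta> \<longleftrightarrow>
    (\<exists>r. \<exists>\<epsilon>>0. \<forall>\<gamma>. pure_braid n \<gamma> \<and> close_braids n r \<epsilon> \<beta> \<gamma> \<longrightarrow>
       finite (critical_moments n \<gamma>) \<and>
       card (critical_moments n \<gamma>) = card (critical_moments n \<beta>))"

definition good_stable :: "nat \<Rightarrow> (real \<Rightarrow> nat \<Rightarrow> complex) \<Rightarrow> bool" where
  "good_stable n \<beta> \<longleftrightarrow>
    pure_braid n \<beta> \<and> finite (critical_moments n \<beta>) \<and>
    (\<forall>t\<in>critical_moments n \<beta>. \<exists>!T. collinear_triple n (\<beta> t) T) \<and>
    stable n \<beta>"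

definition critical_gen :: "nat \<Rightarrow> (nat \<Rightarrow> complex) \<Rightarrow> generator" where
  "critical_gen n z =
    (THE g. \<exists>i j k. {i, j, k} \<subseteq> {1..n} \<and> distinct [i, j, k] \<and> between (z i, z k) (z j) \<and> g = gen i j k)"

definition braid_word :: "nat \<Rightarrow> (real \<Rightarrow> nat \<Rightarrow> complex) \<Rightarrow> generator word" where
  "braid_word n \<beta> =
    map (\<lambda>t. (critical_gen n (\<beta> t), True)) (sorted_list_of_set (critical_moments n \<beta>))"

definition f_braid :: "nat \<Rightarrow> (real \<Rightarrow> nat \<Rightarrow> complex) \<Rightarrow> generator word set" where
  "f_braid n \<beta> = word_cong (generators n) (relations n) `` {braid_word n \<beta>}"

definition braid_map :: "nat \<Rightarrow> (real \<Rightarrow> nat \<Rightarrow> complex) set \<Rightarrow> generator word set" where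
  "braid_map n X = (THE g. \<exists>\<beta>\<in>X. good_stable n \<beta> \<and> g = f_braid n \<beta>)"

end

theory Submission
  imports Defs "HOL-Computational_Algebra.Polynomial"
begin

text \<open>
  At a critical moment a braid crosses a wall: the orientation of one triple of points changes its
  sign. Fix a direction \<open>u\<close> and consider the chart of all configurations whose points have distinct
  abscissas with respect to \<open>u\<close>. Inside a chart the word of a path depends, in the group \<open>G3 n\<close>,
  only on the end points. To see this, build up a configuration by bringing in its points from left
  to right, each of them descending vertically from far above to its place, and record the letters of
  the lines through two earlier points that it meets. The resulting word is called the potential of
  the configuration. When the wall of \<open>i, j, k\<close> is crossed, where \<open>k\<close> is the rightmost of the three,
  the potential is multiplied on the right by the letter of the triple
  (\<open>potential_wall_crossing\<close>): in the descent of \<open>k\<close> this letter is the last one, and a point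
  further to the right that meets the lines \<open>ij\<close>, \<open>ik\<close>, \<open>jk\<close> now meets them in the opposite order,
  for which the tetrahedron relation makes up; everything else commutes. Hence the word of a path
  in a chart is the quotient of the potentials of its end points (\<open>chart_potential_path\<close>).

  An isotopy is merely continuous and may pass through arbitrarily degenerate configurations, so it
  cannot be followed wall by wall. But each configuration lies in a chart and charts are open. Two
  regular paths close to the same loop, however degenerate that loop is, therefore stay in common
  charts during short intervals of time, and a comparison of potentials shows that their words
  agree (\<open>close_words_congruent\<close>). Moreover each loop can be approximated by regular braids that move
  one point at a time along a segment (\<open>polygon_approximation\<close>). These two facts and the compactness of
  the unit interval imply that homotopic regular loops have congruent words
  (\<open>homotopy_principle\<close>, \<open>homotopic_words_congruent\<close>). The same principle shows that braids
  are isotopic if and only if they are homotopic as loops (\<open>isotopy_iff_homotopic_paths\<close>), from which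
  the group laws of \<open>PB n\<close> follow.

  Finally, the braids that move one point at a time have simple crossings only and are therefore
  good and stable (\<open>transversal_stable\<close>), so good and stable representatives exist. Conversely, good
  and stable braids are regular, because a critical moment without a change of sign could be
  removed by a small perturbation (\<open>stable_crossing\<close>).
\<close>

section \<open>Presented groups\<close>

lemma word_cong_words: "(u, v) \<in> word_cong S R \<Longrightarrow> u \<in> words S \<and> v \<in> words S"
  by (induction rule: word_cong.induct) (auto simp: words_def)

lemma words_append [simp]: "u @ v \<in> words S \<longleftrightarrow> u \<in> words S \<and> v \<in> words S"
  and words_Nil [simp]: "[] \<in> words S"
  by (auto simp: words_def)

lemma words_Cons [simp]: "x # u \<in> words S \<longleftrightarrow> fst x \<in> S \<and> u \<in> words S"
  by (cases x) (auto simp: words_def)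

lemma equiv_word_cong: "equiv (words S) (word_cong S R)"
proof (rule equivI)
  show "word_cong S R \<subseteq> words S \<times> words S" using word_cong_words by fastforce
  show "refl_on (words S) (word_cong S R)"
    by (auto intro!: refl_onI word_cong.refl dest: word_cong_words)
  show "sym (word_cong S R)" by (auto intro!: symI word_cong.sym)
  show "trans (word_cong S R)" by (auto intro!: transI elim: word_cong.trans)
qed

lemma word_cong_left: "(u, v) \<in> word_cong S R \<Longrightarrow> w \<in> words S \<Longrightarrow> (w @ u, w @ v) \<in> word_cong S R"
  and word_cong_right: "(u, v) \<in> word_cong S R \<Longrightarrow> w \<in> words S \<Longrightarrow> (u @ w, v @ w) \<in> word_cong S R"
  by (auto intro: word_cong.append word_cong.refl)

definition winv :: "'g word \<Rightarrow> 'g word" where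
  "winv w = rev (map (\<lambda>(g, b). (g, \<not> b)) w)"

lemma winv_words [simp]: "winv w \<in> words S \<longleftrightarrow> w \<in> words S"
  by (induction w) (auto simp: winv_def)

lemma winv_right: "w \<in> words S \<Longrightarrow> (w @ winv w, []) \<in> word_cong S R"
proof (induction w)
  case Nil then show ?case by (auto simp: winv_def intro: word_cong.refl)
next
  case (Cons x w)
  obtain g b where x: "x = (g, b)" by (cases x)
  have w: "w \<in> words S" and g: "g \<in> S" using Cons.prems x by auto
  have "([x] @ (w @ winv w) @ [(g, \<not> b)], [x] @ [] @ [(g, \<not> b)]) \<in> word_cong S R"
    using Cons.IH w g x by (intro word_cong.append word_cong.refl) auto
  then have "(x # w @ winv (x # w), [x] @ [] @ [(g, \<not> b)]) \<in> word_cong S R"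
    by (simp add: winv_def x)
  then show ?case
    using word_cong.trans[OF _ word_cong.cancel[OF g]] by (simp add: x)
qed

lemma winv_left: "w \<in> words S \<Longrightarrow> (winv w @ w, []) \<in> word_cong S R"
proof -
  assume w: "w \<in> words S"
  have "winv (winv w) = w"
    unfolding winv_def by (induction w) auto
  then show ?thesis using winv_right[of "winv w" S R] w by simp
qed

lemma word_cong_cancel_left:
  assumes "(w @ u, w @ v) \<in> word_cong S R"
  shows "(u, v) \<in> word_cong S R"
proof -
  have W: "w \<in> words S" "u \<in> words S" "v \<in> words S"
    using word_cong_words[OF assms] by auto
  have 1: "(winv w @ w @ u, winv w @ w @ v) \<in> word_cong S R"
    using word_cong_left[OF assms, of "winv w"] W by simp
  have 2: "((winv w @ w) @ x, [] @ x) \<in> word_cong S R" if "x \<in> words S" for x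
    by (rule word_cong_right[OF winv_left[OF W(1)] that])
  show ?thesis using 1 2[OF W(2)] 2[OF W(3)]
    by (metis append_Nil append_assoc word_cong.sym word_cong.trans)
qed

lemma presented_group_mult:
  assumes "u \<in> words S" "v \<in> words S"
  shows "(word_cong S R `` {u}) \<otimes>\<^bsub>presented_group S R\<^esub> (word_cong S R `` {v}) = word_cong S R `` {u @ v}"
  using assms unfolding presented_group_def
  by (auto intro: word_cong.refl word_cong.append word_cong.trans)

lemma presented_group_carrier:
  "X \<in> carrier (presented_group S R) \<longleftrightarrow> (\<exists>w\<in>words S. X = word_cong S R `` {w})"
  by (auto simp: presented_group_def quotient_def)

lemma word_class_eq_iff:
  "u \<in> words S \<Longrightarrow> v \<in> words S \<Longrightarrow>
    word_cong S R `` {u} = word_cong S R `` {v} \<longleftrightarrow> (u, v) \<in> word_cong S R"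
  by (rule eq_equiv_class_iff[OF equiv_word_cong])

lemma presented_group_one: "\<one>\<^bsub>presented_group S R\<^esub> = word_cong S R `` {[]}"
  by (simp add: presented_group_def)

lemma group_presented_group: "group (presented_group S R)"
proof (rule groupI)
  let ?G = "presented_group S R"
  show "x \<otimes>\<^bsub>?G\<^esub> y \<in> carrier ?G" if "x \<in> carrier ?G" "y \<in> carrier ?G" for x y
    using that by (force simp: presented_group_carrier presented_group_mult)
  show "\<one>\<^bsub>?G\<^esub> \<in> carrier ?G"
    by (auto simp: presented_group_carrier presented_group_one intro!: bexI[of _ "[]"])
  show "x \<otimes>\<^bsub>?G\<^esub> y \<otimes>\<^bsub>?G\<^esub> z = x \<otimes>\<^bsub>?G\<^esub> (y \<otimes>\<^bsub>?G\<^esub> z)"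
    if "x \<in> carrier ?G" "y \<in> carrier ?G" "z \<in> carrier ?G" for x y z
    using that by (auto simp: presented_group_carrier presented_group_mult)
  show "\<one>\<^bsub>?G\<^esub> \<otimes>\<^bsub>?G\<^esub> x = x" if "x \<in> carrier ?G" for x
    using that by (auto simp: presented_group_carrier presented_group_mult presented_group_one)
  show "\<exists>y\<in>carrier ?G. y \<otimes>\<^bsub>?G\<^esub> x = \<one>\<^bsub>?G\<^esub>" if x: "x \<in> carrier ?G" for x
  proof -
    obtain w where w: "w \<in> words S" "x = word_cong S R `` {w}" using x by (auto simp: presented_group_carrier)
    show ?thesis
      using w winv_left[OF w(1)]
      by (intro bexI[of _ "word_cong S R `` {winv w}"])
        (auto simp: presented_group_mult presented_group_one word_class_eq_iff
          presented_group_carrier intro!: bexI[of _ "winv w"] word_cong.refl)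
  qed
qed

lemma commute_past:
  assumes "\<forall>x\<in>set xs. (a @ [f x], f x # a) \<in> word_cong S R" "a \<in> words S"
  shows "(a @ map f xs, map f xs @ a) \<in> word_cong S R"
  using assms
proof (induction xs)
  case Nil then show ?case by (simp add: word_cong.refl)
next
  case (Cons x xs)
  have IH: "(a @ map f xs, map f xs @ a) \<in> word_cong S R"
    and 1: "(a @ [f x], f x # a) \<in> word_cong S R" using Cons by auto
  have W: "f x # map f xs \<in> words S"
    using word_cong_words[OF IH] word_cong_words[OF 1] by auto
  have "((a @ [f x]) @ map f xs, (f x # a) @ map f xs) \<in> word_cong S R"
    using 1 W by (intro word_cong_right) auto
  moreover have "([f x] @ (a @ map f xs), [f x] @ (map f xs @ a)) \<in> word_cong S R"
    using IH W by (intro word_cong_left) auto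
  ultimately show ?case
    by (metis (no_types, lifting) Cons_eq_appendI append_Nil append_assoc list.simps(9) word_cong.trans)
qed

definition before :: "'a list \<Rightarrow> 'a \<Rightarrow> 'a \<Rightarrow> bool" where
  "before xs a b \<longleftrightarrow> (\<exists>us vs ws. xs = us @ a # vs @ b # ws)"

lemma before_Cons: "before (x # xs) a b \<longleftrightarrow> (x = a \<and> b \<in> set xs) \<or> before xs a b"
proof
  assume "before (x # xs) a b"
  then obtain us vs ws where "x # xs = us @ a # vs @ b # ws" by (auto simp: before_def)
  then show "(x = a \<and> b \<in> set xs) \<or> before xs a b"
    by (cases us) (auto simp: before_def)
next
  assume "(x = a \<and> b \<in> set xs) \<or> before xs a b"
  then show "before (x # xs) a b"
  proof
    assume *: "x = a \<and> b \<in> set xs"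
    then obtain vs ws where "xs = vs @ b # ws" by (meson split_list)
    with * have "x # xs = [] @ a # vs @ b # ws" by simp
    then show ?thesis unfolding before_def by blast
  next
    assume "before xs a b"
    then obtain us vs ws where "xs = us @ a # vs @ b # ws" by (auto simp: before_def)
    then have "x # xs = (x # us) @ a # vs @ b # ws" by simp
    then show ?thesis unfolding before_def by blast
  qed
qed

lemma before_Nil [simp]: "\<not> before [] a b" by (simp add: before_def)

lemma before_append: "before (xs @ ys) a b \<longleftrightarrow> before xs a b \<or> before ys a b \<or> (a \<in> set xs \<and> b \<in> set ys)"
  by (induction xs) (auto simp: before_Cons)

lemma before_in_set: "before xs a b \<Longrightarrow> a \<in> set xs \<and> b \<in> set xs"
  by (auto simp: before_def)

lemma before_neq: "distinct xs \<Longrightarrow> before xs a b \<Longrightarrow> a \<noteq> b"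
  by (auto simp: before_def)

text \<open>Two orderings of the same letters differ by transpositions of neighbours, and only those
  pairs have to be transposed whose order differs; so it suffices that these pairs commute.
  The first letter of the one list is moved to the front in the other.\<close>

lemma trace_cong:
  assumes "distinct xs" "distinct ys" "set xs = set ys" "\<forall>x\<in>set xs. [f x] \<in> words S"
    and "\<And>a b. a \<in> set xs \<Longrightarrow> b \<in> set xs \<Longrightarrow> before xs a b \<Longrightarrow> before ys b a \<Longrightarrow>
           ([f a, f b], [f b, f a]) \<in> word_cong S R"
  shows "(map f xs, map f ys) \<in> word_cong S R"
  using assms
proof (induction xs arbitrary: ys)
  case Nil then show ?case by (simp add: word_cong.refl)
next
  case (Cons x xs)
  obtain us vs where ys: "ys = us @ x # vs"
    using Cons.prems(3) by (metis list.set_intros(1) split_list)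
  have d: "x \<notin> set us" "x \<notin> set vs" "distinct (us @ vs)" "x \<notin> set xs" "distinct xs"
    using Cons.prems(1,2) ys by auto
  have s: "set xs = set (us @ vs)" using Cons.prems(3) d ys by auto
  have IH: "(map f xs, map f (us @ vs)) \<in> word_cong S R"
  proof (rule Cons.IH)
    show "([f a, f b], [f b, f a]) \<in> word_cong S R"
      if "a \<in> set xs" "b \<in> set xs" "before xs a b" "before (us @ vs) b a" for a b
      using that by (intro Cons.prems(5)) (auto simp: before_Cons ys before_append)
  qed (use d s Cons.prems in auto)
  have W: "f x # map f (us @ vs) \<in> words S"
    using Cons.prems(4) word_cong_words[OF IH] by auto
  have "([f x] @ map f us, map f us @ [f x]) \<in> word_cong S R"
  proof (rule commute_past)
    show "\<forall>y\<in>set us. ([f x] @ [f y], f y # [f x]) \<in> word_cong S R"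
    proof
      fix y assume y: "y \<in> set us"
      have "([f x, f y], [f y, f x]) \<in> word_cong S R"
        using y s by (intro Cons.prems(5)) (auto simp: before_Cons ys before_append)
      then show "([f x] @ [f y], f y # [f x]) \<in> word_cong S R" by simp
    qed
  qed (use W in auto)
  then have "(([f x] @ map f us) @ map f vs, (map f us @ [f x]) @ map f vs) \<in> word_cong S R"
    using W by (intro word_cong_right) auto
  moreover have "([f x] @ map f xs, [f x] @ map f (us @ vs)) \<in> word_cong S R"
    using IH W by (intro word_cong_left) auto
  ultimately show ?case using ys by (auto intro: word_cong.trans)
qed

section \<open>The potential of a configuration\<close>

abbreviation cong3 :: "nat \<Rightarrow> generator word \<Rightarrow> generator word \<Rightarrow> bool" where
  "cong3 n u v \<equiv> (u, v) \<in> word_cong (generators n) (relations n)"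

text \<open>Twice the signed area of the triangle; it vanishes exactly when the three points are
  collinear.\<close>

definition orient :: "(nat \<Rightarrow> complex) \<Rightarrow> nat \<Rightarrow> nat \<Rightarrow> nat \<Rightarrow> real" where
  "orient z i j k = Im (cnj (z j - z i) * (z k - z i))"

lemma orient_eq: "orient z i j k =
    (Re (z j) - Re (z i)) * (Im (z k) - Im (z i)) - (Im (z j) - Im (z i)) * (Re (z k) - Re (z i))"
  by (simp add: orient_def algebra_simps)

lemma orient_swap: "orient z j i k = - orient z i j k"
proof -
  have "(a - b) * (f - e) - (d - e) * (c - b) = - ((b - a) * (f - d) - (e - d) * (c - a))" for a b c d e f :: real
    by (simp add: algebra_simps)
  then show ?thesis by (simp add: orient_eq)
qed

lemma orient_rot: "orient z j k i = orient z i j k"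
  by (simp add: orient_eq algebra_simps)

declare word_cong.trans [trans]

lemma letter_in_generators:
  "{i, j, k} \<subseteq> {1..n} \<Longrightarrow> distinct [i, j, k] \<Longrightarrow> [letter i j k] \<in> words (generators n)"
  by (auto simp: letter_def generators_def)

lemma letter_involution:
  assumes "{i, j, k} \<subseteq> {1..n}" "distinct [i, j, k]"
  shows "cong3 n [letter i j k, letter i j k] []"
  using assms letter_in_generators[OF assms]
  by (intro word_cong.relation) (auto simp: relations_def)

lemma letters_commute:
  assumes "{i, j, k} \<subseteq> {1..n}" "distinct [i, j, k]" "{p, q, r} \<subseteq> {1..n}" "distinct [p, q, r]"
    "card ({i, j, k} \<inter> {p, q, r}) < 2"
  shows "cong3 n [letter i j k, letter p q r] [letter p q r, letter i j k]"
proof (rule word_cong.relation)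
  show "([letter i j k, letter p q r], [letter p q r, letter i j k]) \<in> relations n"
    using assms unfolding relations_def by blast
qed (use letter_in_generators[OF assms(1,2)] letter_in_generators[OF assms(3,4)] in auto)

text \<open>With involutive letters, the relation \<open>(A B C E)\<^sup>2 = 1\<close> says that the product \<open>A B C E\<close>
  equals its reversal; conjugation by \<open>A\<close> gives the second form. Which of the two is needed
  depends on the direction in which the wall of \<open>i, j, k\<close> is crossed.\<close>

lemma tetrahedron:
  assumes "{i, j, k, l} \<subseteq> {1..n}" "distinct [i, j, k, l]"
  defines "A \<equiv> letter i j k" and "B \<equiv> letter i j l" and "C \<equiv> letter i k l" and "E \<equiv> letter j k l"
  shows "cong3 n [A, B, C, E] [E, C, B, A]" and "cong3 n [A, E, C, B] [B, C, E, A]"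
proof -
  have W: "[A] \<in> words (generators n)" "[B] \<in> words (generators n)" "[C] \<in> words (generators n)" "[E] \<in> words (generators n)"
    using assms(1,2) unfolding A_def B_def C_def E_def by (auto intro!: letter_in_generators simp del: words_Cons)
  have inv: "cong3 n [A, A] []" "cong3 n [B, B] []" "cong3 n [C, C] []" "cong3 n [E, E] []"
    using assms(1,2) unfolding A_def B_def C_def E_def by (auto intro!: letter_involution)
  have inv_mid: "cong3 n (u @ [x, x] @ v) (u @ v)"
    if "cong3 n [x, x] []" "u \<in> words (generators n)" "v \<in> words (generators n)" for x u v
    using word_cong_left[OF word_cong_right[OF that(1) that(3)] that(2)] by simp
  \<comment> \<open>The defining relation; appending the reversed word cancels its second half.\<close>
  have rel: "cong3 n [A, B, C, E, A, B, C, E] []"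
  proof (rule word_cong.relation)
    show "([A, B, C, E, A, B, C, E], []) \<in> relations n"
      using assms(1,2) unfolding relations_def A_def B_def C_def E_def by blast
  qed (use W in auto)
  have "cong3 n [A, B, C, E, A, B, C, E, E, C, B, A] [A, B, C, E, A, B, C, C, B, A]"
    using inv_mid[OF inv(4), of "[A, B, C, E, A, B, C]" "[C, B, A]"] W by simp
  also have "cong3 n [A, B, C, E, A, B, C, C, B, A] [A, B, C, E, A, B, B, A]"
    using inv_mid[OF inv(3), of "[A, B, C, E, A, B]" "[B, A]"] W by simp
  also have "cong3 n [A, B, C, E, A, B, B, A] [A, B, C, E, A, A]"
    using inv_mid[OF inv(2), of "[A, B, C, E, A]" "[A]"] W by simp
  also have "cong3 n [A, B, C, E, A, A] [A, B, C, E]"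
    using inv_mid[OF inv(1), of "[A, B, C, E]" "[]"] W by simp
  finally have "cong3 n [A, B, C, E, A, B, C, E, E, C, B, A] [A, B, C, E]" .
  moreover have "cong3 n ([A, B, C, E, A, B, C, E] @ [E, C, B, A]) ([] @ [E, C, B, A])"
    using rel W by (intro word_cong_right) auto
  ultimately show 1: "cong3 n [A, B, C, E] [E, C, B, A]"
    by (metis append.simps word_cong.sym word_cong.trans)
  have "cong3 n [B, C, E, A] [A, A, B, C, E, A]"
    using inv_mid[OF inv(1), of "[]" "[B, C, E, A]"] W by (simp add: word_cong.sym)
  also have "cong3 n ([A] @ [A, B, C, E] @ [A]) ([A] @ [E, C, B, A] @ [A])"
    using 1 W by (intro word_cong_left word_cong_right) auto
  then have "cong3 n [A, A, B, C, E, A] [A, E, C, B, A, A]" by simp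
  also have "cong3 n [A, E, C, B, A, A] [A, E, C, B]"
    using inv_mid[OF inv(1), of "[A, E, C, B]" "[]"] W by simp
  finally show "cong3 n [A, E, C, B] [B, C, E, A]" by (rule word_cong.sym)
qed

text \<open>The ordinate, at the abscissa of \<open>z m\<close>, of the line through \<open>z i\<close> and \<open>z j\<close>.\<close>

definition height :: "(nat \<Rightarrow> complex) \<Rightarrow> nat \<Rightarrow> nat \<times> nat \<Rightarrow> real" where
  "height z m = (\<lambda>(i, j). Im (z i) + (Im (z j) - Im (z i)) / (Re (z j) - Re (z i)) * (Re (z m) - Re (z i)))"

lemma height_swap:
  assumes "Re (z i) \<noteq> Re (z j)"
  shows "height z m (j, i) = height z m (i, j)"
proof -
  have "Re (z i) - Re (z j) \<noteq> 0" "Re (z j) - Re (z i) \<noteq> 0" using assms by auto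
  then show ?thesis unfolding height_def by (simp add: field_simps)
qed

lemma height_minus:
  assumes "Re (z i) \<noteq> Re (z j)"
  shows "height z m (i, j) - Im (z m) = - orient z i j m / (Re (z j) - Re (z i))"
proof -
  have "Re (z j) - Re (z i) \<noteq> 0" using assms by auto
  then show ?thesis unfolding height_def orient_eq by (simp add: field_simps)
qed

lemma height_diff:
  assumes "Re (z a) \<noteq> Re (z c)" "Re (z b) \<noteq> Re (z c)"
  shows "height z m (c, a) - height z m (c, b) =
    - orient z c a b * (Re (z m) - Re (z c)) / ((Re (z a) - Re (z c)) * (Re (z b) - Re (z c)))"
proof -
  have *: "u / a * w - v / b * w = - (a * v - u * b) * w / (a * b)"
    if "a \<noteq> 0" "b \<noteq> 0" for a b u v w :: real
    using that by (simp add: field_simps)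
  show ?thesis using *[of "Re (z a) - Re (z c)" "Re (z b) - Re (z c)" "Im (z a) - Im (z c)" "Re (z m) - Re (z c)" "Im (z b) - Im (z c)"]
      assms unfolding height_def orient_eq by simp
qed

definition noncollinear :: "nat \<Rightarrow> (nat \<Rightarrow> complex) \<Rightarrow> bool" where
  "noncollinear n z \<longleftrightarrow> (\<forall>i\<in>{1..n}. \<forall>j\<in>{1..n}. \<forall>k\<in>{1..n}. distinct [i, j, k] \<longrightarrow> orient z i j k \<noteq> 0)"

text \<open>The line through the points \<open>i\<close> and \<open>j\<close>, both to the left of \<open>m\<close>, passes above \<open>m\<close>; by
  \<open>above_iff_height\<close> the sign of \<open>orient\<close> expresses this. Listing the pair with the left point
  first makes it unique.\<close>

definition line_above :: "(nat \<Rightarrow> complex) \<Rightarrow> nat \<Rightarrow> nat \<times> nat \<Rightarrow> bool" where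
  "line_above z m = (\<lambda>(i, j). Re (z i) < Re (z j) \<and> Re (z j) < Re (z m) \<and> orient z i j m < 0)"

text \<open>The lines met by a point that comes down vertically from far above to \<open>z m\<close>, in the order
  in which it meets them. Lines of equal height appear in an arbitrary order, which is
  harmless: they have no point in common, and their letters commute.\<close>

definition pairs_above :: "nat \<Rightarrow> (nat \<Rightarrow> complex) \<Rightarrow> nat \<Rightarrow> (nat \<times> nat) list" where
  "pairs_above n z m = sort_key (\<lambda>e. - height z m e)
     (filter (line_above z m) (List.product [1..<Suc n] [1..<Suc n]))"

abbreviation pair_letter :: "nat \<Rightarrow> nat \<times> nat \<Rightarrow> generator \<times> bool" where
  "pair_letter m e \<equiv> letter (fst e) (snd e) m"

definition sweep :: "nat \<Rightarrow> (nat \<Rightarrow> complex) \<Rightarrow> nat \<Rightarrow> generator word" where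
  "sweep n z m = map (pair_letter m) (pairs_above n z m)"

text \<open>The points are brought in from left to right; each of them contributes the letters of the
  lines that it meets on its way down. Up to congruence this word depends only on the
  orientations of the triples, and it plays the role of a primitive: the word of a path is the
  quotient of the potentials of its end points.\<close>

definition potential :: "nat \<Rightarrow> (nat \<Rightarrow> complex) \<Rightarrow> generator word" where
  "potential n z = concat (map (sweep n z) (sort_key (\<lambda>i. Re (z i)) [1..<Suc n]))"

definition pair_set :: "nat \<times> nat \<Rightarrow> nat set" where "pair_set e = {fst e, snd e}"

lemma set_pairs_above: "e \<in> set (pairs_above n z m) \<longleftrightarrow> pair_set e \<subseteq> {1..n} \<and> line_above z m e"
  by (cases e) (auto simp: pairs_above_def pair_set_def)

lemma distinct_pairs_above: "distinct (pairs_above n z m)"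
  by (auto simp: pairs_above_def distinct_product)

lemma pairs_above_sorted: "sorted_wrt (\<lambda>e e'. height z m e \<ge> height z m e') (pairs_above n z m)"
proof -
  have "sorted (map (\<lambda>e. - height z m e) (pairs_above n z m))"
    unfolding pairs_above_def by (rule sorted_sort_key)
  then show ?thesis by (simp add: sorted_wrt_map)
qed

lemma above_distinct: "line_above z m e \<Longrightarrow> distinct [fst e, snd e, m]"
  by (auto simp: line_above_def)

lemma sorted_wrt_before: "sorted_wrt P xs \<Longrightarrow> before xs a b \<Longrightarrow> P a b"
  by (auto simp: before_def sorted_wrt_append)

text \<open>Lines with a common point give letters that need not commute; all other pairs of letters in
  one sweep commute.\<close>

definition share :: "nat \<times> nat \<Rightarrow> nat \<times> nat \<Rightarrow> bool" where
  "share e e' \<longleftrightarrow> pair_set e \<inter> pair_set e' \<noteq> {}"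

lemma sweep_letter_in:
  assumes "m \<in> {1..n}" "pair_set e \<subseteq> {1..n}" "line_above z m e"
  shows "[pair_letter m e] \<in> words (generators n)"
  using assms above_distinct[OF assms(3)] by (intro letter_in_generators) (auto simp: pair_set_def)

lemma not_share_commute:
  assumes "m \<in> {1..n}" "pair_set e \<subseteq> {1..n}" "pair_set e' \<subseteq> {1..n}" "line_above z m e" "line_above z m e'" "\<not> share e e'"
  shows "cong3 n [pair_letter m e, pair_letter m e'] [pair_letter m e', pair_letter m e]"
proof (rule letters_commute)
  have "{fst e, snd e, m} \<inter> {fst e', snd e', m} = {m}"
    using assms(6) above_distinct[OF assms(4)] above_distinct[OF assms(5)]
    by (auto simp: share_def pair_set_def)
  then show "card ({fst e, snd e, m} \<inter> {fst e', snd e', m}) < 2" by simp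
qed (use assms above_distinct[OF assms(4)] above_distinct[OF assms(5)] in \<open>auto simp: pair_set_def\<close>)

lemma sweep_cong_trace:
  assumes "m \<in> {1..n}" "distinct xs" "distinct ys" "set xs = set ys"
    and el: "\<And>e. e \<in> set xs \<Longrightarrow> pair_set e \<subseteq> {1..n} \<and> line_above z m e"
    and ord: "\<And>e e'. before xs e e' \<Longrightarrow> before ys e' e \<Longrightarrow> \<not> share e e'"
  shows "cong3 n (map (pair_letter m) xs) (map (pair_letter m) ys)"
proof (rule trace_cong)
  show "\<forall>x\<in>set xs. [pair_letter m x] \<in> words (generators n)"
    using el sweep_letter_in[OF assms(1)] by blast
  show "cong3 n [pair_letter m a, pair_letter m b] [pair_letter m b, pair_letter m a]"
    if "a \<in> set xs" "b \<in> set xs" "before xs a b" "before ys b a" for a b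
    using not_share_commute[OF assms(1)] el[OF that(1)] el[OF that(2)] ord[OF that(3,4)] by blast
qed (use assms in auto)

definition re_inj :: "nat \<Rightarrow> (nat \<Rightarrow> complex) \<Rightarrow> bool" where
  "re_inj n z \<longleftrightarrow> inj_on (\<lambda>i. Re (z i)) {1..n}"

definition same_order :: "nat \<Rightarrow> (nat \<Rightarrow> complex) \<Rightarrow> (nat \<Rightarrow> complex) \<Rightarrow> bool" where
  "same_order n p q \<longleftrightarrow> (\<forall>i\<in>{1..n}. \<forall>j\<in>{1..n}. Re (p i) < Re (p j) \<longleftrightarrow> Re (q i) < Re (q j))"

definition same_orient :: "(nat \<Rightarrow> complex) \<Rightarrow> (nat \<Rightarrow> complex) \<Rightarrow> nat set \<Rightarrow> bool" where
  "same_orient p q S \<longleftrightarrow> (\<forall>i j k. S = {i, j, k} \<longrightarrow> (0 < orient p i j k \<longleftrightarrow> 0 < orient q i j k))"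

text \<open>The reason why potentials depend only on orientations: the relative height of two lines
  through a common point is decided by an orientation and the order of the abscissas.\<close>

lemma height_less_iff:
  assumes "Re (z a) \<noteq> Re (z c)" "Re (z b) \<noteq> Re (z c)" "Re (z c) < Re (z m)"
  shows "height z m (c, a) < height z m (c, b) \<longleftrightarrow>
    (0 < orient z c a b \<longleftrightarrow> (Re (z c) < Re (z a) \<longleftrightarrow> Re (z c) < Re (z b))) \<and> orient z c a b \<noteq> 0"
proof -
  have *: "- d * w / (a * b) < 0 \<longleftrightarrow> (0 < d \<longleftrightarrow> (0 < a \<longleftrightarrow> 0 < b)) \<and> d \<noteq> 0"
    if "a \<noteq> 0" "b \<noteq> 0" "0 < w" for a b d w :: real
    using that by (cases "0 < a"; cases "0 < b"; cases "0 < d")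
      (auto simp: divide_less_0_iff zero_less_divide_iff mult_less_0_iff zero_less_mult_iff)
  have "height z m (c, a) < height z m (c, b) \<longleftrightarrow> height z m (c, a) - height z m (c, b) < 0" by simp
  also have "\<dots> \<longleftrightarrow> (0 < orient z c a b \<longleftrightarrow> (0 < Re (z a) - Re (z c) \<longleftrightarrow> 0 < Re (z b) - Re (z c))) \<and> orient z c a b \<noteq> 0"
    unfolding height_diff[OF assms(1,2)] using assms by (intro *) auto
  finally show ?thesis by simp
qed

lemma share_obtain:
  assumes "share e e'" "e \<noteq> e'" "line_above z m e" "line_above z m e'" "pair_set e \<subseteq> {1..n}" "pair_set e' \<subseteq> {1..n}"
  obtains c a b where "pair_set e = {c, a}" "pair_set e' = {c, b}" "distinct [c, a, b]" "{c, a, b} \<subseteq> {1..n}"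
proof -
  obtain i j k l where [simp]: "e = (i, j)" "e' = (k, l)" by fastforce
  consider "i = k" | "i = l" | "j = k" | "j = l"
    using assms(1) by (auto simp: share_def pair_set_def)
  then show ?thesis
  proof cases
    case 1 show ?thesis by (rule that[of i j l]) (use 1 assms in \<open>auto simp: line_above_def pair_set_def\<close>)
  next
    case 2 show ?thesis by (rule that[of i j k]) (use 2 assms in \<open>auto simp: line_above_def pair_set_def\<close>)
  next
    case 3 show ?thesis by (rule that[of j i l]) (use 3 assms in \<open>auto simp: line_above_def pair_set_def\<close>)
  next
    case 4 show ?thesis by (rule that[of j i k]) (use 4 assms in \<open>auto simp: line_above_def pair_set_def\<close>)
  qed
qed

lemma height_pair_set:
  assumes "pair_set e = {c, a}" "line_above z m e"
  shows "height z m e = height z m (c, a)" "Re (z a) \<noteq> Re (z c)" "Re (z c) < Re (z m)"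
proof -
  obtain i j where [simp]: "e = (i, j)" by fastforce
  have "(c, a) = (i, j) \<or> (c, a) = (j, i)" using assms(1) by (auto simp: pair_set_def doubleton_eq_iff)
  then show "height z m e = height z m (c, a)" "Re (z a) \<noteq> Re (z c)" "Re (z c) < Re (z m)"
    using assms(2) by (auto simp: line_above_def height_swap)
qed

lemma height_compare:
  assumes "share e e'" "e \<noteq> e'" "line_above p m e" "line_above p m e'" "line_above q m e" "line_above q m e'"
    "pair_set e \<subseteq> {1..n}" "pair_set e' \<subseteq> {1..n}"
    and "noncollinear n p" "noncollinear n q" "same_order n p q" "same_orient p q (pair_set e \<union> pair_set e')"
  shows "height p m e < height p m e' \<longleftrightarrow> height q m e < height q m e'"
    and "height p m e \<noteq> height p m e'"
proof -
  obtain c a b where c: "pair_set e = {c, a}" "pair_set e' = {c, b}" "distinct [c, a, b]" "{c, a, b} \<subseteq> {1..n}"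
    using share_obtain[OF assms(1-4,7,8)] .
  note P = height_pair_set[OF c(1) assms(3)] height_pair_set[OF c(2) assms(4)]
  note Q = height_pair_set[OF c(1) assms(5)] height_pair_set[OF c(2) assms(6)]
  have g: "orient p c a b \<noteq> 0" "orient q c a b \<noteq> 0"
    using assms(9,10) c(3,4) unfolding noncollinear_def by auto
  have o: "0 < orient p c a b \<longleftrightarrow> 0 < orient q c a b"
    using assms(12) c(1,2) unfolding same_orient_def by auto
  have x: "Re (p c) < Re (p v) \<longleftrightarrow> Re (q c) < Re (q v)" if "v \<in> {a, b}" for v
    using assms(11) c(4) that unfolding same_order_def by auto
  show "height p m e < height p m e' \<longleftrightarrow> height q m e < height q m e'"
    unfolding P(1,4) Q(1,4) using P Q g o x by (simp add: height_less_iff)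
  show "height p m e \<noteq> height p m e'"
    using height_diff[of p a c b m] P g by auto
qed

lemma above_same_order:
  assumes "same_order n p q" "noncollinear n p" "noncollinear n q" "m \<in> {1..n}" "pair_set e \<subseteq> {1..n}" "line_above p m e"
    "same_orient p q (insert m (pair_set e))"
  shows "line_above q m e"
proof -
  obtain i j where e: "e = (i, j)" by fastforce
  have ij: "{i, j} \<subseteq> {1..n}" using assms(5) e by (auto simp: pair_set_def)
  have "distinct [i, j, m]" using above_distinct[OF assms(6)] e by simp
  then have "orient q i j m \<noteq> 0" using assms(3,4) ij by (auto simp: noncollinear_def)
  moreover have "0 < orient p i j m \<longleftrightarrow> 0 < orient q i j m"
    using assms(7) e unfolding same_orient_def pair_set_def by (metis fst_conv snd_conv insert_commute)
  ultimately show ?thesis using assms(1,4,6) ij unfolding e line_above_def same_order_def by auto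
qed

lemma same_orient_sym: "same_orient p q S \<Longrightarrow> same_orient q p S"
  by (auto simp: same_orient_def)

lemma same_order_sym: "same_order n p q \<Longrightarrow> same_order n q p"
  by (auto simp: same_order_def)

lemma above_iff_height:
  "line_above z m (i, j) \<longleftrightarrow> Re (z i) < Re (z j) \<and> Re (z j) < Re (z m) \<and> Im (z m) < height z m (i, j)"
proof (cases "Re (z i) < Re (z j)")
  case True
  have "Im (z m) < height z m (i, j) \<longleftrightarrow> 0 < height z m (i, j) - Im (z m)" by simp
  also have "\<dots> \<longleftrightarrow> 0 < - orient z i j m / (Re (z j) - Re (z i))"
    using True by (subst height_minus) auto
  also have "\<dots> \<longleftrightarrow> orient z i j m < 0" using True by (simp add: zero_less_divide_iff divide_less_0_iff)
  finally have "Im (z m) < height z m (i, j) \<longleftrightarrow> orient z i j m < 0" .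
  then show ?thesis using True by (simp add: line_above_def)
qed (simp add: line_above_def)

text \<open>The two ends of a path in a chart; orientations may differ between them.\<close>

locale config_pair =
  fixes n :: nat and p q :: "nat \<Rightarrow> complex"
  assumes ord: "same_order n p q" and gp: "noncollinear n p" and gq: "noncollinear n q"

begin

lemma set_pairs_eq:
  assumes "m \<in> {1..n}"
    and "\<And>e. pair_set e \<subseteq> {1..n} \<Longrightarrow> line_above p m e \<or> line_above q m e \<Longrightarrow> same_orient p q (insert m (pair_set e))"
  shows "set (pairs_above n p m) = set (pairs_above n q m)"
  using above_same_order[OF ord gp gq assms(1)] 
    above_same_order[OF same_order_sym[OF ord] gq gp assms(1)] assms(2) same_orient_sym
  by (auto simp: set_pairs_above)

lemma pairs_order_agree:
  assumes e: "e \<in> set (pairs_above n p m) \<inter> set (pairs_above n q m)"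
    and e': "e' \<in> set (pairs_above n p m) \<inter> set (pairs_above n q m)"
    and so: "same_orient p q (pair_set e \<union> pair_set e')"
    and h: "height p m e \<ge> height p m e'" "height q m e' \<ge> height q m e" and ne: "e \<noteq> e'"
  shows "\<not> share e e'"
  using height_compare[of e e' p m q n] height_compare[of e' e p m q n] e e' so h ne ord gp gq
  by (force simp: set_pairs_above share_def Un_commute)

text \<open>The sweep of \<open>m\<close> only involves triples of points that do not lie to the right of \<open>m\<close>, as
  heights are compared among lines through points on the left.\<close>

lemma sweep_same:
  assumes m: "m \<in> {1..n}" and so: "\<And>S. card S = 3 \<Longrightarrow> S \<subseteq> {1..n} \<Longrightarrow> (\<And>i. i \<in> S \<Longrightarrow> Re (p i) \<le> Re (p m)) \<Longrightarrow> same_orient p q S"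
  shows "cong3 n (sweep n p m) (sweep n q m)"
proof -
  have ord': "Re (q i) < Re (q m) \<longleftrightarrow> Re (p i) < Re (p m)" if "i \<in> {1..n}" for i
    using ord m that by (auto simp: same_order_def)
  have eq: "set (pairs_above n p m) = set (pairs_above n q m)"
  proof (rule set_pairs_eq[OF m])
    fix e assume e: "pair_set e \<subseteq> {1..n}" "line_above p m e \<or> line_above q m e"
    have d: "distinct [fst e, snd e, m]" using e(2) above_distinct by blast
    have "Re (p i) \<le> Re (p m)" if "i \<in> insert m (pair_set e)" for i
      using e that ord'[of i] by (auto simp: line_above_def pair_set_def less_imp_le split: prod.splits)
    then show "same_orient p q (insert m (pair_set e))"
      using e d m by (intro so) (auto simp: pair_set_def)
  qed
  show ?thesis unfolding sweep_def
  proof (rule sweep_cong_trace[OF m distinct_pairs_above distinct_pairs_above eq])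
    show "pair_set e \<subseteq> {1..n} \<and> line_above p m e" if "e \<in> set (pairs_above n p m)" for e
      using that by (auto simp: set_pairs_above)
    fix e e' assume b: "before (pairs_above n p m) e e'" "before (pairs_above n q m) e' e"
    have in_set: "e \<in> set (pairs_above n p m)" "e' \<in> set (pairs_above n p m)" using before_in_set[OF b(1)] by auto
    have ne: "e \<noteq> e'" by (rule before_neq[OF distinct_pairs_above b(1)])
    show "\<not> share e e'"
    proof
      assume sh: "share e e'"
      have A: "line_above p m e" "line_above p m e'" "pair_set e \<subseteq> {1..n}" "pair_set e' \<subseteq> {1..n}"
        using in_set by (auto simp: set_pairs_above)
      obtain c a b where c: "pair_set e = {c, a}" "pair_set e' = {c, b}" "distinct [c, a, b]" "{c, a, b} \<subseteq> {1..n}"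
        using share_obtain[OF sh ne A] .
      have "Re (p i) \<le> Re (p m)" if "i \<in> pair_set e \<union> pair_set e'" for i
        using A(1,2) that by (auto simp: line_above_def pair_set_def split: prod.splits)
      moreover have "pair_set e \<union> pair_set e' = {c, a, b}" using c by auto
      ultimately have "same_orient p q (pair_set e \<union> pair_set e')"
        using c(3,4) by (intro so) auto
      then show False
        using pairs_order_agree[of e m e'] sorted_wrt_before[OF pairs_above_sorted b(1)]
          sorted_wrt_before[OF pairs_above_sorted b(2)] in_set ne sh eq by blast
    qed
  qed
qed

text \<open>If the wall of \<open>i, j, k\<close> with \<open>k\<close> on the right is crossed, the line through \<open>i\<close> and \<open>j\<close>
  passes over \<open>k\<close>. Its letter can be taken as the last one of the sweep: a line through \<open>i\<close> or
  \<open>j\<close> that passes between it and \<open>k\<close> would remain lower after the crossing, when the line \<open>ij\<close>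
  is below \<open>k\<close>, and would have changed its own position with respect to \<open>k\<close>.\<close>

lemma sweep_top:
  assumes T: "{i, j, k} \<subseteq> {1..n}" "Re (p i) < Re (p j)" "Re (p j) < Re (p k)"
    and so: "\<And>S. card S = 3 \<Longrightarrow> S \<subseteq> {1..n} \<Longrightarrow> S \<noteq> {i, j, k} \<Longrightarrow> same_orient p q S"
    and neg: "orient p i j k < 0" and pos: "orient q i j k > 0"
  shows "cong3 n (sweep n p k) (sweep n q k @ [letter i j k])"
proof -
  have k: "k \<in> {1..n}" and d: "distinct [i, j, k]" using T by auto
  have so2: "same_orient p q (insert k (pair_set e))"
    if "pair_set e \<subseteq> {1..n}" "line_above p k e \<or> line_above q k e" "e \<noteq> (i, j)" for e
  proof -
    have dd: "distinct [fst e, snd e, k]" using that(2) above_distinct by blast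
    have "pair_set e \<noteq> {i, j}"
    proof
      assume "pair_set e = {i, j}"
      then have "e = (j, i)" using that(3) by (cases e) (auto simp: pair_set_def doubleton_eq_iff)
      moreover have "Re (q i) < Re (q j)" using ord T by (auto simp: same_order_def)
      ultimately show False using that(2) T(2) by (auto simp: line_above_def)
    qed
    moreover have "pair_set e = {i, j}" if "insert k (pair_set e) = {i, j, k}"
    proof -
      have "insert k (pair_set e) - {k} = {i, j, k} - {k}" using that by simp
      then show ?thesis using dd d by (auto simp: pair_set_def)
    qed
    ultimately show ?thesis
      using that dd k by (intro so) (auto simp: pair_set_def)
  qed
  have xq: "Re (q i) < Re (q j)" "Re (q j) < Re (q k)" using ord T by (auto simp: same_order_def)
  have ijp: "line_above p k (i, j)" and ijq: "\<not> line_above q k (i, j)"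
    using T neg pos xq by (auto simp: line_above_def)
  have eq: "set (pairs_above n p k) = set (pairs_above n q k @ [(i, j)])"
  proof (rule Set.set_eqI)
    fix e
    show "e \<in> set (pairs_above n p k) \<longleftrightarrow> e \<in> set (pairs_above n q k @ [(i, j)])"
    proof (cases "e = (i, j)")
      case True
      then show ?thesis using ijp T by (auto simp: set_pairs_above pair_set_def)
    next
      case False
      have "line_above p k e \<longleftrightarrow> line_above q k e" if e: "pair_set e \<subseteq> {1..n}"
        using above_same_order[OF ord gp gq k e] above_same_order[OF same_order_sym[OF ord] gq gp k e]
          so2[OF e _ False] same_orient_sym by blast
      then show ?thesis using False by (auto simp: set_pairs_above)
    qed
  qed
  have notin: "(i, j) \<notin> set (pairs_above n q k)" using ijq by (auto simp: set_pairs_above)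
  have "cong3 n (map (pair_letter k) (pairs_above n p k)) (map (pair_letter k) (pairs_above n q k @ [(i, j)]))"
  proof (rule sweep_cong_trace[OF k distinct_pairs_above _ eq])
    show "distinct (pairs_above n q k @ [(i, j)])"
      using notin distinct_pairs_above by simp
    show "pair_set e \<subseteq> {1..n} \<and> line_above p k e" if "e \<in> set (pairs_above n p k)" for e
      using that by (auto simp: set_pairs_above)
    fix e e' assume b: "before (pairs_above n p k) e e'" "before (pairs_above n q k @ [(i, j)]) e' e"
    have in_set: "e \<in> set (pairs_above n p k)" "e' \<in> set (pairs_above n p k)" using before_in_set[OF b(1)] by auto
    have ne: "e \<noteq> e'" by (rule before_neq[OF distinct_pairs_above b(1)])
    have A: "line_above p k e" "line_above p k e'" "pair_set e \<subseteq> {1..n}" "pair_set e' \<subseteq> {1..n}"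
      using in_set by (auto simp: set_pairs_above)
    have hp: "height p k e \<ge> height p k e'" using sorted_wrt_before[OF pairs_above_sorted b(1)] .
    show "\<not> share e e'"
    proof
      assume sh: "share e e'"
      obtain c a b where c: "pair_set e = {c, a}" "pair_set e' = {c, b}" "distinct [c, a, b]" "{c, a, b} \<subseteq> {1..n}"
        using share_obtain[OF sh ne A] .
      have "k \<notin> pair_set e" "k \<notin> pair_set e'"
        using above_distinct[OF A(1)] above_distinct[OF A(2)] by (auto simp: pair_set_def)
      then have "k \<notin> {c, a, b}" unfolding c(1,2) by simp
      moreover have U: "pair_set e \<union> pair_set e' = {c, a, b}" unfolding c(1,2) by auto
      ultimately have s: "same_orient p q (pair_set e \<union> pair_set e')"
        unfolding U using c(3,4) by (intro so) auto
      have e'q: "e' \<in> set (pairs_above n q k)" "e' \<noteq> (i, j)"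
        using b(2) notin by (auto simp: before_append before_Cons dest: before_in_set)
      show False
      proof (cases "e = (i, j)")
        case False
        then have "before (pairs_above n q k) e' e" using b(2) by (auto simp: before_append before_Cons)
        then have "height q k e' \<ge> height q k e" "e \<in> set (pairs_above n q k)"
          using sorted_wrt_before[OF pairs_above_sorted] before_in_set by fast+
        then show False using pairs_order_agree[of e k e'] in_set e'q s hp ne sh by blast
      next
        case True
        \<comment> \<open>Here the order of the heights in q contradicts their order in p.\<close>
        have e'a: "line_above q k e'" using e'q by (simp add: set_pairs_above)
        obtain l r where lr: "e' = (l, r)" by fastforce
        have "height q k e' > Im (q k)"
          using e'a lr by (simp add: above_iff_height)
        moreover have "height q k e < Im (q k)"
        proof -
          have "height q k (i, j) - Im (q k) < 0"
            using height_minus[of q i j k] xq pos by (simp add: divide_pos_pos)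
          then show ?thesis using True by simp
        qed
        ultimately have hq: "height q k e < height q k e'" by simp
        note C = height_pair_set[OF c(1) A(1)] height_pair_set[OF c(2) A(2)]
        have e_ij: "{c, a} = {i, j}" using c(1) True by (auto simp: pair_set_def)
        have ca: "Re (q a) \<noteq> Re (q c)" "Re (q c) < Re (q k)" "height q k e = height q k (c, a)"
          using e_ij xq True height_swap[of q i j k] by (auto simp: doubleton_eq_iff)
        note Q = height_pair_set[OF c(2) e'a]
        have cmp: "height p k e < height p k e' \<longleftrightarrow> height q k e < height q k e'"
        proof -
          have x: "Re (p c) < Re (p v) \<longleftrightarrow> Re (q c) < Re (q v)" if "v \<in> {a, b}" for v
            using ord c(4) that unfolding same_order_def by auto
          have g: "orient p c a b \<noteq> 0" "orient q c a b \<noteq> 0"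
            using gp gq c(3,4) unfolding noncollinear_def by auto
          have o: "0 < orient p c a b \<longleftrightarrow> 0 < orient q c a b"
            using s U unfolding same_orient_def by blast
          show ?thesis unfolding C(1,4) Q(1) ca(3) using C ca Q g o x by (simp add: height_less_iff)
        qed
        then show False using hq hp by simp
      qed
    qed
  qed
  then show ?thesis by (simp add: sweep_def)
qed

text \<open>To the right of a triangle, its three sides extended are met in the order \<open>ij, ik, jk\<close> or
  in the reverse order, according to the orientation.\<close>

lemma heights_of_triangle:
  assumes "Re (z i) < Re (z j)" "Re (z j) < Re (z k)" "Re (z k) < Re (z m)" "orient z i j k \<noteq> 0"
  shows "height z m (i, j) < height z m (i, k) \<longleftrightarrow> 0 < orient z i j k"
    "height z m (i, k) < height z m (i, j) \<longleftrightarrow> \<not> 0 < orient z i j k"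
    "height z m (i, k) < height z m (j, k) \<longleftrightarrow> 0 < orient z i j k"
    "height z m (j, k) < height z m (i, k) \<longleftrightarrow> \<not> 0 < orient z i j k"
proof -
  have o: "orient z k i j = orient z i j k" "orient z k j i = - orient z i j k" "orient z i k j = - orient z i j k"
    using orient_rot[of z i j k] orient_rot[of z j k i] orient_swap[of z j k i] orient_swap[of z k i j]
    by linarith+
  have s: "height z m (i, k) = height z m (k, i)" "height z m (j, k) = height z m (k, j)"
    using assms by (auto intro: height_swap)
  show "height z m (i, j) < height z m (i, k) \<longleftrightarrow> 0 < orient z i j k"
    "height z m (i, k) < height z m (i, j) \<longleftrightarrow> \<not> 0 < orient z i j k"
    using assms o by (auto simp: height_less_iff)
  show "height z m (i, k) < height z m (j, k) \<longleftrightarrow> 0 < orient z i j k"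
    "height z m (j, k) < height z m (i, k) \<longleftrightarrow> \<not> 0 < orient z i j k"
    unfolding s using assms o by (auto simp: height_less_iff)
qed

text \<open>For a point \<open>m\<close> to the right of the triangle, the three lines \<open>ij\<close>, \<open>ik\<close>, \<open>jk\<close> are either
  all met in the sweep or not at all. When the triangle is reversed, so is their order, and
  the tetrahedron relation for \<open>i, j, k, m\<close> compensates for this. The other lines commute with
  the letter of \<open>i, j, k\<close>, and they can be moved out from between the three lines: a line
  through a vertex of the triangle lies above both sides through that vertex or below both,
  since otherwise it would get into the wrong order on one side of the wall.\<close>

lemma sweep_past:
  assumes T: "{i, j, k} \<subseteq> {1..n}" "Re (p i) < Re (p j)" "Re (p j) < Re (p k)"
    and m: "m \<in> {1..n}" "Re (p k) < Re (p m)"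
    and so: "\<And>S. card S = 3 \<Longrightarrow> S \<subseteq> {1..n} \<Longrightarrow> S \<noteq> {i, j, k} \<Longrightarrow> same_orient p q S"
    and flip: "0 < orient p i j k \<longleftrightarrow> \<not> 0 < orient q i j k"
  shows "cong3 n ([letter i j k] @ sweep n q m) (sweep n p m @ [letter i j k])"
proof -
  have d: "distinct [i, j, k, m]" using T(2,3) m(2) by auto
  have xq: "Re (q i) < Re (q j)" "Re (q j) < Re (q k)" "Re (q k) < Re (q m)"
    using ord T m by (auto simp: same_order_def)
  \<comment> \<open>The three sides of the triangle.\<close>
  define th where "th = {(i, j), (i, k), (j, k)}"
  have in_th: "e \<in> th" if e: "pair_set e \<subseteq> {i, j, k}" "line_above p m e" for e
  proof -
    obtain u v where uv: "e = (u, v)" by fastforce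
    have "Re (p u) < Re (p v)" "u \<in> {i, j, k}" "v \<in> {i, j, k}"
      using e uv by (auto simp: line_above_def pair_set_def)
    then show ?thesis unfolding th_def uv using T(2,3) by (elim insertE emptyE) simp_all
  qed
  have eq: "set (pairs_above n p m) = set (pairs_above n q m)"
  proof (rule set_pairs_eq[OF m(1)])
    fix e assume e: "pair_set e \<subseteq> {1..n}" "line_above p m e \<or> line_above q m e"
    have dd: "distinct [fst e, snd e, m]" using e(2) above_distinct by blast
    have "insert m (pair_set e) \<noteq> {i, j, k}" using d by auto
    then show "same_orient p q (insert m (pair_set e))"
      using e dd m by (intro so) (auto simp: pair_set_def)
  qed
  define L where "L = pairs_above n p m"
  have L: "pair_set e \<subseteq> {1..n}" "line_above p m e" "line_above q m e" if "e \<in> set L" for e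
    using that eq by (auto simp: L_def set_pairs_above)
  have a_word: "[letter i j k] \<in> words (generators n)"
    using T d by (intro letter_in_generators) auto
  have a_comm: "cong3 n [letter i j k, pair_letter m e] [pair_letter m e, letter i j k]"
    if e: "e \<in> set L" "e \<notin> th" for e
  proof (rule letters_commute)
    have "\<not> pair_set e \<subseteq> {i, j, k}" using in_th L(2)[OF e(1)] e(2) by blast
    then have "{i, j, k} \<inter> {fst e, snd e, m} \<subseteq> {fst e} \<or> {i, j, k} \<inter> {fst e, snd e, m} \<subseteq> {snd e}"
      using d by (auto simp: pair_set_def)
    then have "card ({i, j, k} \<inter> {fst e, snd e, m}) \<le> 1"
      using card_mono[of "{fst e}"] card_mono[of "{snd e}"] by auto
    then show "card ({i, j, k} \<inter> {fst e, snd e, m}) < 2" by simp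
    show "{fst e, snd e, m} \<subseteq> {1..n}" using L(1)[OF e(1)] m(1) by (simp add: pair_set_def)
    show "distinct [i, j, k]" using d by auto
  qed (fact T(1) above_distinct[OF L(2)[OF e(1)]])+
  have cmp: "height p m e < height p m e' \<longleftrightarrow> height q m e < height q m e'"
    if A: "e \<in> set L" "e' \<in> set L" "share e e'" "e \<noteq> e'" "\<not> (e \<in> th \<and> e' \<in> th)" for e e'
  proof (rule height_compare(1)[OF A(3,4) _ _ _ _ _ _ gp gq ord])
    obtain c a b where c: "pair_set e = {c, a}" "pair_set e' = {c, b}" "distinct [c, a, b]" "{c, a, b} \<subseteq> {1..n}"
      using share_obtain[OF A(3,4) L(2)[OF A(1)] L(2)[OF A(2)] L(1)[OF A(1)] L(1)[OF A(2)]] .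
    have U: "pair_set e \<union> pair_set e' = {c, a, b}" unfolding c(1,2) by auto
    have "pair_set e \<union> pair_set e' \<noteq> {i, j, k}" using in_th L A by blast
    then show "same_orient p q (pair_set e \<union> pair_set e')"
      using c(3,4) unfolding U by (intro so) auto
  qed (use L A in auto)
  have neq: "height z m e \<noteq> height z m e'"
    if A: "e \<in> set L" "e' \<in> set L" "share e e'" "e \<noteq> e'" "z = p \<or> z = q" for e e' z
  proof -
    have z: "noncollinear n z" "line_above z m e" "line_above z m e'"
      using A(5) L(2,3)[OF A(1)] L(2,3)[OF A(2)] gp gq by blast+
    show ?thesis
      using height_compare(2)[OF A(3,4) z(2,3) z(2,3) _ _ z(1) z(1)] L(1)[OF A(1)] L(1)[OF A(2)]
      by (auto simp: same_order_def same_orient_def)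
  qed
  show ?thesis
  proof (cases "th \<inter> set L = {}")
    case True
    have "cong3 n (map (pair_letter m) L) (map (pair_letter m) (pairs_above n q m))"
    proof (rule sweep_cong_trace[OF m(1)])
      show "\<not> share e e'" if b: "before L e e'" "before (pairs_above n q m) e' e" for e e'
      proof
        assume sh: "share e e'"
        have in_set: "e \<in> set L" "e' \<in> set L" using before_in_set[OF b(1)] by auto
        have ne: "e \<noteq> e'" using before_neq[OF _ b(1)] distinct_pairs_above by (auto simp: L_def)
        have "height p m e \<ge> height p m e'" "height q m e' \<ge> height q m e"
          using sorted_wrt_before[OF pairs_above_sorted] b by (auto simp: L_def)
        then show False using cmp[OF in_set sh ne] neq[OF in_set sh ne] in_set True by force
      qed
    qed (use L eq distinct_pairs_above in \<open>auto simp: L_def\<close>)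
    then have 1: "cong3 n (sweep n p m) (sweep n q m)" by (simp add: sweep_def L_def)
    have "cong3 n ([letter i j k] @ map (pair_letter m) L) (map (pair_letter m) L @ [letter i j k])"
      using True a_comm a_word by (intro commute_past) auto
    then have 2: "cong3 n ([letter i j k] @ sweep n p m) (sweep n p m @ [letter i j k])" by (simp add: sweep_def L_def)
    show ?thesis
      using word_cong.trans[OF word_cong_left[OF word_cong.sym[OF 1] a_word] 2] .
  next
    case False
    note hp = heights_of_triangle[of p i j k m] and hq = heights_of_triangle[of q i j k m]
    have nz: "orient p i j k \<noteq> 0" "orient q i j k \<noteq> 0"
      using gp gq T d by (auto simp: noncollinear_def)
    \<comment> \<open>The lowest and the highest of the three lines before the crossing.\<close>
    obtain x w where xw: "{x, w} = {(i, j), (j, k)}" "x \<noteq> w" and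
        hp: "height p m x < height p m (i, k)" "height p m (i, k) < height p m w" and
        hq: "height q m w < height q m (i, k)" "height q m (i, k) < height q m x"
        and xw': "(x, w) = ((i, j), (j, k)) \<or> (x, w) = ((j, k), (i, j))"
    proof (cases "0 < orient p i j k")
      case True
      show ?thesis by (rule that[of "(i, j)" "(j, k)"]) (use True hp hq nz T m xq flip d in auto)
    next
      case False
      show ?thesis by (rule that[of "(j, k)" "(i, j)"]) (use False hp hq nz T m xq flip d in auto)
    qed
    define y where "y = (i, k)"
    note hp = hp[folded y_def] and hq = hq[folded y_def]
    have th: "th = {x, y, w}" and dxyw: "distinct [x, y, w]"
      using xw' d by (auto simp: th_def y_def)
    have ab: "line_above p m e \<longleftrightarrow> Im (p m) < height p m e" "line_above q m e \<longleftrightarrow> Im (q m) < height q m e"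
      if "e \<in> th" for e
      using that T m xq unfolding th_def by (auto simp: above_iff_height)
    have pst: "pair_set e \<subseteq> {1..n}" if "e \<in> th" for e using that T by (auto simp: th_def pair_set_def)
    have in_L: "e \<in> set L \<longleftrightarrow> Im (p m) < height p m e" "e \<in> set L \<longleftrightarrow> Im (q m) < height q m e"
      if "e \<in> th" for e
      using ab[OF that] pst[OF that] eq by (auto simp: L_def set_pairs_above)
    have thL: "th \<subseteq> set L"
      using False in_L[of x] in_L[of y] in_L[of w] hp hq unfolding th by auto
    have two: "(share e x \<and> share e y) \<or> (share e x \<and> share e w) \<or> (share e y \<and> share e w)"
      if "t \<in> th" "share e t" for e t
      using that xw' unfolding th by (auto simp: share_def pair_set_def y_def)
    \<comment> \<open>A line outside the triangle that does not commute with all of its sides passes through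
      a vertex; it passes above both sides through that vertex or below both, and a comparison
      with the middle line y decides which.\<close>
    have X: "if height p m e > height p m y then height p m e > height p m t \<and> height q m e > height q m t
       else height p m e < height p m t \<and> height q m e < height q m t"
      if e: "e \<in> set L" "e \<notin> th" and t: "t \<in> th" "share e t" for e t
    proof -
      have c: "height p m e < height p m t \<longleftrightarrow> height q m e < height q m t"
        "height p m e \<noteq> height p m t" "height q m e \<noteq> height q m t"
        if "share e t" "t \<in> th" for t
        using that cmp[of e t] neq[of e t p] neq[of e t q] e thL by blast+
      show ?thesis
        using two[OF t] t(1) c[of x] c[of y] c[of w] t(2) hp hq unfolding th by (smt (verit) insert_iff singletonD)
    qed
    \<comment> \<open>The threshold between the front and the rear part is the height of the middle line,
      which is enough to separate each remaining line from those of the three lines with which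
      it does not commute.\<close>
    define P where "P = filter (\<lambda>e. e \<notin> th \<and> height p m e > height p m y) L"
    define Q where "Q = filter (\<lambda>e. e \<notin> th \<and> \<not> height p m e > height p m y) L"
    have Ls: "sorted_wrt (\<lambda>e e'. height p m e \<ge> height p m e') L" "distinct L"
      unfolding L_def by (rule pairs_above_sorted distinct_pairs_above)+
    have PQ: "set P \<subseteq> set L - th" "set Q \<subseteq> set L - th" "distinct P" "distinct Q"
      "sorted_wrt (\<lambda>e e'. height p m e \<ge> height p m e') P" "sorted_wrt (\<lambda>e e'. height p m e \<ge> height p m e') Q"
      "\<And>e. e \<in> set P \<Longrightarrow> height p m e > height p m y" "\<And>e. e \<in> set Q \<Longrightarrow> \<not> height p m e > height p m y"
      "set P \<union> set Q = set L - th" "set P \<inter> set Q = {}"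
      using Ls by (auto simp: P_def Q_def intro: sorted_wrt_filter)
    have qs: "share e e' \<longrightarrow> height q m e \<ge> height q m e'"
      if "height p m e \<ge> height p m e'" "e \<in> set L - th" "e' \<in> set L - th" for e e'
    proof
      assume "share e e'"
      then show "height q m e \<ge> height q m e'"
        using that cmp[of e e'] neq[of e e' p] by (cases "e = e'") force+
    qed
    have share_sym: "share e e' \<longleftrightarrow> share e' e" for e e' by (auto simp: share_def)
    have sp: "sorted_wrt (\<lambda>e e'. share e e' \<longrightarrow> height p m e \<ge> height p m e') (P @ [w, y, x] @ Q)"
      unfolding sorted_wrt_append
    proof (intro conjI ballI)
      show "sorted_wrt (\<lambda>e e'. share e e' \<longrightarrow> height p m e \<ge> height p m e') P"
        "sorted_wrt (\<lambda>e e'. share e e' \<longrightarrow> height p m e \<ge> height p m e') Q"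
        using PQ(5,6) by (auto elim: sorted_wrt_mono_rel[rotated])
      show "sorted_wrt (\<lambda>e e'. share e e' \<longrightarrow> height p m e \<ge> height p m e') [w, y, x]" using hp by auto
      fix e e' assume e: "e \<in> set P" "e' \<in> set ([w, y, x] @ Q)"
      show "share e e' \<longrightarrow> height p m e \<ge> height p m e'"
      proof (cases "e' \<in> th")
        case True
        then show ?thesis using X[of e e'] PQ(7)[OF e(1)] PQ(1) e(1) by auto
      next
        case False
        then have "e' \<in> set Q" using e(2) by (auto simp: th)
        then show ?thesis using PQ(7)[OF e(1)] PQ(8)[of e'] by simp
      qed
    next
      fix e e' assume e: "e \<in> set [w, y, x]" "e' \<in> set Q"
      have "e \<in> th" using e unfolding th by auto
      then show "share e e' \<longrightarrow> height p m e \<ge> height p m e'"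
        using X[of e' e] PQ(8)[OF e(2)] PQ(2) e(2) share_sym[of e e'] by (auto split: if_splits)
    qed
    have sq: "sorted_wrt (\<lambda>e e'. share e e' \<longrightarrow> height q m e \<ge> height q m e') (P @ [x, y, w] @ Q)"
      unfolding sorted_wrt_append
    proof (intro conjI ballI)
      show "sorted_wrt (\<lambda>e e'. share e e' \<longrightarrow> height q m e \<ge> height q m e') P"
        using PQ(5) by (rule sorted_wrt_mono_rel[rotated]) (use PQ(1) qs in blast)
      show "sorted_wrt (\<lambda>e e'. share e e' \<longrightarrow> height q m e \<ge> height q m e') Q"
        using PQ(6) by (rule sorted_wrt_mono_rel[rotated]) (use PQ(2) qs in blast)
      show "sorted_wrt (\<lambda>e e'. share e e' \<longrightarrow> height q m e \<ge> height q m e') [x, y, w]" using hq by auto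
      fix e e' assume e: "e \<in> set P" "e' \<in> set ([x, y, w] @ Q)"
      show "share e e' \<longrightarrow> height q m e \<ge> height q m e'"
      proof (cases "e' \<in> th")
        case True
        then show ?thesis using X[of e e'] PQ(7)[OF e(1)] PQ(1) e(1) by auto
      next
        case False
        then have "e' \<in> set Q" using e(2) by (auto simp: th)
        then have "height p m e \<ge> height p m e'" using PQ(7)[OF e(1)] PQ(8)[of e'] by simp
        then show ?thesis using qs \<open>e' \<in> set Q\<close> e(1) PQ(1,2) by blast
      qed
    next
      fix e e' assume e: "e \<in> set [x, y, w]" "e' \<in> set Q"
      have "e \<in> th" using e unfolding th by auto
      then show "share e e' \<longrightarrow> height q m e \<ge> height q m e'"
        using X[of e' e] PQ(8)[OF e(2)] PQ(2) e(2) share_sym[of e e'] by (auto split: if_splits)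
    qed
    have dis: "distinct (P @ [w, y, x] @ Q)" "distinct (P @ [x, y, w] @ Q)"
      using PQ dxyw unfolding th by auto
    have sets: "set (P @ [w, y, x] @ Q) = set L" "set (P @ [x, y, w] @ Q) = set L"
      using PQ(9) thL unfolding th by auto
    let ?f = "map (pair_letter m)"
    have 1: "cong3 n (?f L) (?f (P @ [w, y, x] @ Q))"
    proof (rule sweep_cong_trace[OF m(1) Ls(2) dis(1)])
      show "\<not> share e e'" if b: "before L e e'" "before (P @ [w, y, x] @ Q) e' e" for e e'
        using sorted_wrt_before[OF Ls(1) b(1)] sorted_wrt_before[OF sp b(2)] neq[of e e' p]
          before_in_set[OF b(1)] before_neq[OF Ls(2) b(1)] share_sym[of e e'] by force
    qed (use L sets in auto)
    have 2: "cong3 n (?f (P @ [x, y, w] @ Q)) (?f (pairs_above n q m))"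
    proof (rule sweep_cong_trace[OF m(1) dis(2) distinct_pairs_above])
      show "\<not> share e e'" if b: "before (P @ [x, y, w] @ Q) e e'" "before (pairs_above n q m) e' e" for e e'
        using sorted_wrt_before[OF pairs_above_sorted b(2)] sorted_wrt_before[OF sq b(1)] neq[of e e' q]
          before_in_set[OF b(1)] before_neq[OF dis(2) b(1)] sets by force
      show "set (P @ [x, y, w] @ Q) = set (pairs_above n q m)" using sets eq L_def by simp
      show "pair_set e \<subseteq> {1..n} \<and> line_above p m e" if "e \<in> set (P @ [x, y, w] @ Q)" for e
        using that L sets by blast
    qed
    have "{i, j, k, m} \<subseteq> {1..n}" using T(1) m(1) by simp
    from tetrahedron[OF this d]
    have tet: "cong3 n ([letter i j k] @ ?f [x, y, w]) (?f [w, y, x] @ [letter i j k])"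
      using xw' unfolding y_def by (elim disjE) simp_all
    have W: "?f P \<in> words (generators n)" "?f Q \<in> words (generators n)" "?f [x, y, w] \<in> words (generators n)"
       "?f [w, y, x] \<in> words (generators n)"
    proof -
      have *: "?f l \<in> words (generators n)" if "set l \<subseteq> set L" for l
        using that by (induction l) (use sweep_letter_in[OF m(1) L(1) L(2)] in auto)
      have sub: "set P \<subseteq> set L" "set Q \<subseteq> set L" "set [x, y, w] \<subseteq> set L" "set [w, y, x] \<subseteq> set L"
        using PQ(1,2) thL unfolding th by auto
      show "?f P \<in> words (generators n)" "?f Q \<in> words (generators n)" "?f [x, y, w] \<in> words (generators n)"
        "?f [w, y, x] \<in> words (generators n)"
        by (rule *[OF sub(1)] *[OF sub(2)] *[OF sub(3)] *[OF sub(4)])+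
    qed
    have cP: "cong3 n ([letter i j k] @ ?f P) (?f P @ [letter i j k])"
      using PQ(1) a_comm a_word by (intro commute_past) auto
    have cQ: "cong3 n ([letter i j k] @ ?f Q) (?f Q @ [letter i j k])"
      using PQ(2) a_comm a_word by (intro commute_past) auto
    have "cong3 n ([letter i j k] @ ?f (pairs_above n q m)) ([letter i j k] @ ?f (P @ [x, y, w] @ Q))"
      using word_cong_left[OF word_cong.sym[OF 2] a_word] .
    also have "cong3 n (([letter i j k] @ ?f P) @ ?f [x, y, w] @ ?f Q) ((?f P @ [letter i j k]) @ ?f [x, y, w] @ ?f Q)"
      using W by (intro word_cong_right[OF cP]) (simp del: words_Cons list.map)
    then have "cong3 n ([letter i j k] @ ?f (P @ [x, y, w] @ Q)) (?f P @ ([letter i j k] @ ?f [x, y, w]) @ ?f Q)" by simp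
    also have "cong3 n (?f P @ ([letter i j k] @ ?f [x, y, w]) @ ?f Q) (?f P @ (?f [w, y, x] @ [letter i j k]) @ ?f Q)"
      by (rule word_cong_left[OF word_cong_right[OF tet W(2)] W(1)])
    also have "cong3 n ((?f P @ ?f [w, y, x]) @ ([letter i j k] @ ?f Q)) ((?f P @ ?f [w, y, x]) @ (?f Q @ [letter i j k]))"
      using W by (intro word_cong_left[OF cQ]) (simp del: words_Cons list.map)
    then have "cong3 n (?f P @ (?f [w, y, x] @ [letter i j k]) @ ?f Q) (?f (P @ [w, y, x] @ Q) @ [letter i j k])" by simp
    also have "cong3 n (?f (P @ [w, y, x] @ Q) @ [letter i j k]) (?f L @ [letter i j k])"
      using word_cong_right[OF word_cong.sym[OF 1] a_word] .
    finally show ?thesis by (simp add: sweep_def L_def)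
  qed
qed

lemma order_list_same:
  "sort_key (\<lambda>i. Re (p i)) [1..<Suc n] = sort_key (\<lambda>i. Re (q i)) [1..<Suc n]"
  if inj: "re_inj n p"
proof (rule sort_key_inj_key_eq)
  let ?l = "sort_key (\<lambda>i. Re (q i)) [1..<Suc n]"
  show "mset [1..<Suc n] = mset ?l" by simp
  show "inj_on (\<lambda>i. Re (p i)) (set [1..<Suc n])"
    using inj unfolding re_inj_def by (simp add: atLeastLessThanSuc_atLeastAtMost del: upt_Suc)
  have "sorted_wrt (\<lambda>i j. Re (q i) \<le> Re (q j)) ?l"
    using sorted_sort_key[of "\<lambda>i. Re (q i)" "[1..<Suc n]"] by (simp only: sorted_wrt_map)
  then have "sorted_wrt (\<lambda>i j. Re (p i) \<le> Re (p j)) ?l"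
  proof (rule sorted_wrt_mono_rel[rotated])
    fix i j assume "i \<in> set ?l" "j \<in> set ?l" and le: "Re (q i) \<le> Re (q j)"
    then have "i \<in> {1..n}" "j \<in> {1..n}" by (auto simp del: upt_Suc)
    then show "Re (p i) \<le> Re (p j)" using ord le unfolding same_order_def by (meson not_le)
  qed
  then show "sorted (map (\<lambda>i. Re (p i)) ?l)" by (simp only: sorted_wrt_map)
qed

lemma potential_same_chamber:
  assumes "re_inj n p" and so: "\<And>S. card S = 3 \<Longrightarrow> S \<subseteq> {1..n} \<Longrightarrow> same_orient p q S"
  shows "cong3 n (potential n p) (potential n q)"
proof -
  have "cong3 n (concat (map (sweep n p) ms)) (concat (map (sweep n q) ms))" if "set ms \<subseteq> {1..n}" for ms
    using that
  proof (induction ms)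
    case Nil show ?case by (simp add: word_cong.refl)
  next
    case (Cons m ms)
    have "cong3 n (sweep n p m) (sweep n q m)" using Cons.prems by (intro sweep_same so) auto
    then show ?case using Cons by (auto intro!: word_cong.append)
  qed
  moreover have "set (sort_key (\<lambda>i. Re (q i)) [1..<Suc n]) \<subseteq> {1..n}"
    by (auto simp del: upt_Suc)
  ultimately show ?thesis unfolding potential_def order_list_same[OF assms(1)] by blast
qed

text \<open>The sweeps of points to the left of \<open>k\<close> are not affected. The sweep of \<open>k\<close> gains or loses a
  final letter of \<open>i, j, k\<close>, which amounts to the same as the letters are involutions, and
  this letter moves to the end through the sweeps of the points to the right of \<open>k\<close>.\<close>

lemma potential_wall_crossing:
  assumes inj: "re_inj n p" and T: "{i, j, k} \<subseteq> {1..n}" "Re (p i) < Re (p j)" "Re (p j) < Re (p k)"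
    and so: "\<And>S. card S = 3 \<Longrightarrow> S \<subseteq> {1..n} \<Longrightarrow> S \<noteq> {i, j, k} \<Longrightarrow> same_orient p q S"
    and flip: "0 < orient p i j k \<longleftrightarrow> \<not> 0 < orient q i j k"
  shows "cong3 n (potential n p @ [letter i j k]) (potential n q)"
proof -
  let ?a = "[letter i j k]"
  have d: "distinct [i, j, k]" using T by auto
  have aW: "?a \<in> words (generators n)" using T d by (intro letter_in_generators) auto
  define ms where "ms = sort_key (\<lambda>i. Re (p i)) [1..<Suc n]"
  have ms: "set ms = {1..n}" "distinct ms"
    unfolding ms_def by (auto simp: atLeastLessThanSuc_atLeastAtMost simp del: upt_Suc)
  have msq: "ms = sort_key (\<lambda>i. Re (q i)) [1..<Suc n]" unfolding ms_def by (rule order_list_same[OF inj])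
  obtain as bs where ab: "ms = as @ k # bs" using T ms by (metis insert_subset split_list)
  have sorted: "sorted_wrt (\<lambda>i j. Re (p i) \<le> Re (p j)) ms"
    using sorted_sort_key[of "\<lambda>i. Re (p i)" "[1..<Suc n]"] unfolding ms_def by (simp only: sorted_wrt_map)
  have strict: "Re (p u) < Re (p v)" if "u \<in> {1..n}" "v \<in> {1..n}" "u \<noteq> v" "Re (p u) \<le> Re (p v)" for u v
    using that inj by (metis inj_onD order_le_less re_inj_def)
  have as: "Re (p m) < Re (p k)" if "m \<in> set as" for m
    using that sorted ms ab by (intro strict) (auto simp: sorted_wrt_append)
  have bs: "Re (p k) < Re (p m)" if "m \<in> set bs" for m
    using that sorted ms ab by (intro strict) (auto simp: sorted_wrt_append)
  have A: "cong3 n (concat (map (sweep n p) l)) (concat (map (sweep n q) l))" if "set l \<subseteq> set as" for l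
    using that
  proof (induction l)
    case Nil show ?case by (simp add: word_cong.refl)
  next
    case (Cons m l)
    have m: "m \<in> set as" using Cons.prems by simp
    have "cong3 n (sweep n p m) (sweep n q m)"
    proof (rule sweep_same)
      show "m \<in> {1..n}" using m ms ab by auto
      show "same_orient p q S" if S: "card S = 3" "S \<subseteq> {1..n}" "\<And>i. i \<in> S \<Longrightarrow> Re (p i) \<le> Re (p m)" for S
      proof (rule so[OF S(1,2)])
        show "S \<noteq> {i, j, k}" using S(3)[of k] as[OF m] by auto
      qed
    qed
    then show ?case using Cons by (auto intro!: word_cong.append)
  qed
  have B: "cong3 n (?a @ concat (map (sweep n q) l)) (concat (map (sweep n p) l) @ ?a)" if "set l \<subseteq> set bs" for l
    using that
  proof (induction l)
    case Nil show ?case using aW by (simp add: word_cong.refl)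
  next
    case (Cons m l)
    have m: "m \<in> set bs" using Cons.prems by simp
    have 1: "cong3 n (?a @ sweep n q m) (sweep n p m @ ?a)"
      using m ms ab by (intro sweep_past[OF T _ bs[OF m] so flip]) auto
    have 2: "cong3 n (?a @ concat (map (sweep n q) l)) (concat (map (sweep n p) l) @ ?a)"
      using Cons by auto
    have "cong3 n ((?a @ sweep n q m) @ concat (map (sweep n q) l)) ((sweep n p m @ ?a) @ concat (map (sweep n q) l))"
      using word_cong_words[OF 2] by (intro word_cong_right[OF 1]) auto
    also have "cong3 n (sweep n p m @ (?a @ concat (map (sweep n q) l))) (sweep n p m @ (concat (map (sweep n p) l) @ ?a))"
      using word_cong_words[OF 1] by (intro word_cong_left[OF 2]) auto
    then have "cong3 n ((sweep n p m @ ?a) @ concat (map (sweep n q) l)) (sweep n p m @ (concat (map (sweep n p) l) @ ?a))" by simp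
    finally show ?case by simp
  qed
  have C: "cong3 n (sweep n p k @ ?a) (sweep n q k)"
  proof (cases "0 < orient p i j k")
    case False
    then have "orient p i j k < 0" using gp T(1) d unfolding noncollinear_def by (force simp: not_less)
    then have 1: "cong3 n (sweep n p k) (sweep n q k @ ?a)"
      using flip by (intro sweep_top[OF T so]) auto
    have "cong3 n (sweep n p k @ ?a) ((sweep n q k @ ?a) @ ?a)" by (rule word_cong_right[OF 1 aW])
    also have "cong3 n (sweep n q k @ ([letter i j k, letter i j k])) (sweep n q k @ [])"
      using word_cong_words[OF 1] T d by (intro word_cong_left letter_involution) auto
    then have "cong3 n ((sweep n q k @ ?a) @ ?a) (sweep n q k)" by simp
    finally show ?thesis .
  next
    case True
    interpret r: config_pair n q p by unfold_locales (use ord gp gq same_order_sym in auto)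
    have "orient q i j k \<noteq> 0" using gq T(1) d unfolding noncollinear_def by force
    then have "orient q i j k < 0" using flip True by simp
    moreover have "Re (q i) < Re (q j)" "Re (q j) < Re (q k)"
      using ord T by (auto simp: same_order_def)
    ultimately show ?thesis
      using True so same_orient_sym by (intro word_cong.sym[OF r.sweep_top] T(1)) auto
  qed
  let ?P = "\<lambda>l. concat (map (sweep n p) l)" and ?Q = "\<lambda>l. concat (map (sweep n q) l)"
  note A = A[OF order.refl] and B = B[OF order.refl]
  have W: "?P as \<in> words (generators n)" "?Q as \<in> words (generators n)" "?Q bs \<in> words (generators n)"
    "sweep n p k \<in> words (generators n)"
    using word_cong_words[OF A] word_cong_words[OF B] word_cong_words[OF C] by auto
  have "cong3 n ((?P as @ sweep n p k) @ (?P bs @ ?a)) ((?P as @ sweep n p k) @ (?a @ ?Q bs))"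
    using W by (intro word_cong_left[OF word_cong.sym[OF B]]) auto
  also have "cong3 n (?P as @ ((sweep n p k @ ?a) @ ?Q bs)) (?P as @ (sweep n q k @ ?Q bs))"
    using W by (intro word_cong_left[OF word_cong_right[OF C]])
  then have "cong3 n ((?P as @ sweep n p k) @ (?a @ ?Q bs)) (?P as @ (sweep n q k @ ?Q bs))" by simp
  also have "cong3 n (?P as @ (sweep n q k @ ?Q bs)) (?Q as @ (sweep n q k @ ?Q bs))"
    using W word_cong_words[OF C] by (intro word_cong_right[OF A]) auto
  finally show ?thesis
    unfolding potential_def msq[symmetric] ms_def[symmetric] ab by simp
qed

end

section \<open>Words of paths inside a chart\<close>

lemma collinear_iff_orient: "collinear {z i, z j, z k} \<longleftrightarrow> orient z i j k = 0"
proof -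
  define x y where "x = z j - z i" and "y = z k - z i"
  have "collinear {z i, z j, z k} \<longleftrightarrow> collinear {0, x, y}"
    using collinear_3[of "z j" "z i" "z k"] unfolding x_def y_def by (simp add: insert_commute)
  also have "\<dots> \<longleftrightarrow> Im (cnj x * y) = 0"
  proof (cases "x = 0")
    case False
    have "(\<exists>c. y = c *\<^sub>R x) \<longleftrightarrow> Im (cnj x * y) = 0"
    proof
      assume "Im (cnj x * y) = 0"
      then have r: "cnj x * y = of_real (Re (cnj x * y))" by (simp add: complex_eq_iff)
      have "x * cnj x = of_real ((cmod x)\<^sup>2)" by (rule complex_norm_square[symmetric])
      then have "of_real ((cmod x)\<^sup>2) * y = x * (cnj x * y)" by (metis mult.assoc)
      also have "\<dots> = x * of_real (Re (cnj x * y))" using r by simp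
      finally have "y = of_real (Re (cnj x * y) / (cmod x)\<^sup>2) * x"
        using False by (simp add: field_simps)
      then have "y = (Re (cnj x * y) / (cmod x)\<^sup>2) *\<^sub>R x" by (simp add: scaleR_conv_of_real)
      then show "\<exists>c. y = c *\<^sub>R x" by blast
    qed (auto simp: algebra_simps)
    then show ?thesis using False by (auto simp: collinear_lemma)
  qed (auto simp: collinear_lemma)
  finally show ?thesis unfolding orient_def x_def y_def .
qed

lemma collinear_triple_iff:
  "collinear_triple n z T \<longleftrightarrow>
    (\<exists>i j k. T = {i, j, k} \<and> {i, j, k} \<subseteq> {1..n} \<and> distinct [i, j, k] \<and> orient z i j k = 0)"
proof
  assume T: "collinear_triple n z T"
  then obtain i j k where ijk: "T = {i, j, k}" "i \<noteq> j" "i \<noteq> k" "j \<noteq> k"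
    unfolding collinear_triple_def by (metis card_3_iff)
  have "orient z i j k = 0" using T ijk collinear_iff_orient[of z i j k]
    by (auto simp: collinear_triple_def)
  then show "\<exists>i j k. T = {i, j, k} \<and> {i, j, k} \<subseteq> {1..n} \<and> distinct [i, j, k] \<and> orient z i j k = 0"
    using T ijk unfolding collinear_triple_def by auto
next
  assume "\<exists>i j k. T = {i, j, k} \<and> {i, j, k} \<subseteq> {1..n} \<and> distinct [i, j, k] \<and> orient z i j k = 0"
  then show "collinear_triple n z T"
    unfolding collinear_triple_def using collinear_iff_orient[of z] by auto
qed

lemma collinear_tripleI:
  "{i, j, k} \<subseteq> {1..n} \<Longrightarrow> distinct [i, j, k] \<Longrightarrow> orient z i j k = 0 \<Longrightarrow> collinear_triple n z {i, j, k}"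
  unfolding collinear_triple_iff by blast

lemma orient_perms:
  "orient z j k i = orient z i j k" "orient z k i j = orient z i j k" "orient z j i k = - orient z i j k"
  "orient z i k j = - orient z i j k" "orient z k j i = - orient z i j k"
  using orient_rot[of z i j k] orient_rot[of z j k i] orient_swap[of z i j k] orient_swap[of z j k i]
    orient_swap[of z k i j] by linarith+

lemma noncollinear_iff: "noncollinear n z \<longleftrightarrow> (\<nexists>T. collinear_triple n z T)"
  unfolding noncollinear_def collinear_triple_iff by (auto; metis atLeastAtMost_iff One_nat_def)

definition crit_in :: "nat \<Rightarrow> (real \<Rightarrow> nat \<Rightarrow> complex) \<Rightarrow> real \<Rightarrow> real \<Rightarrow> real set" where
  "crit_in n \<gamma> a b = {t \<in> {a..b}. \<exists>T. collinear_triple n (\<gamma> t) T}"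

lemma crit_in_iff: "t \<in> crit_in n \<gamma> a b \<longleftrightarrow> t \<in> {a..b} \<and> \<not> noncollinear n (\<gamma> t)"
  by (auto simp: crit_in_def noncollinear_iff)

definition path_word :: "nat \<Rightarrow> (real \<Rightarrow> nat \<Rightarrow> complex) \<Rightarrow> real \<Rightarrow> real \<Rightarrow> generator word" where
  "path_word n \<gamma> a b = map (\<lambda>t. (critical_gen n (\<gamma> t), True)) (sorted_list_of_set (crit_in n \<gamma> a b))"

text \<open>The function changes sign at \<open>t\<close> and vanishes at no other point near \<open>t\<close>.\<close>

definition crosses :: "(real \<Rightarrow> real) \<Rightarrow> real \<Rightarrow> bool" where
  "crosses f t \<longleftrightarrow> (\<exists>d>0. \<forall>s s'. t - d < s \<and> s < t \<and> t < s' \<and> s' < t + d \<longrightarrow> f s * f s' < 0)"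

lemma crosses_same_set:
  assumes "{i, j, k} = {i0, j0, k0}" "crosses (\<lambda>s. orient (\<gamma> s) i0 j0 k0) t" "distinct [i, j, k]"
  shows "crosses (\<lambda>s. orient (\<gamma> s) i j k) t"
proof -
  have "i \<in> {i0, j0, k0}" "j \<in> {i0, j0, k0}" "k \<in> {i0, j0, k0}" using assms(1) by blast+
  then consider "(i, j, k) = (i0, j0, k0)" | "(i, j, k) = (i0, k0, j0)" | "(i, j, k) = (j0, i0, k0)"
    | "(i, j, k) = (j0, k0, i0)" | "(i, j, k) = (k0, i0, j0)" | "(i, j, k) = (k0, j0, i0)"
    using assms(3) by auto
  then have "(\<forall>z. orient z i j k = orient z i0 j0 k0) \<or> (\<forall>z. orient z i j k = - orient z i0 j0 k0)"
    by cases (simp_all only: prod.inject orient_perms[where i = i0 and j = j0 and k = k0] simp_thms)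
  then have "orient z i j k * orient z' i j k = orient z i0 j0 k0 * orient z' i0 j0 k0" for z z' by auto
  then show ?thesis using assms(2) unfolding crosses_def by simp
qed

text \<open>The property of good and stable braids that the comparison of words uses. It makes sense on
  arbitrary intervals and for paths that are merely continuous.\<close>

definition regular :: "nat \<Rightarrow> (real \<Rightarrow> nat \<Rightarrow> complex) \<Rightarrow> real \<Rightarrow> real \<Rightarrow> bool" where
  "regular n \<gamma> a b \<longleftrightarrow>
    (\<forall>i\<in>{1..n}. continuous_on {a..b} (\<lambda>t. \<gamma> t i)) \<and> finite (crit_in n \<gamma> a b) \<and>
    noncollinear n (\<gamma> a) \<and> noncollinear n (\<gamma> b) \<and>
    (\<forall>t\<in>crit_in n \<gamma> a b. \<exists>i j k. {i, j, k} \<subseteq> {1..n} \<and> distinct [i, j, k] \<and>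
       (\<forall>T. collinear_triple n (\<gamma> t) T \<longrightarrow> T = {i, j, k}) \<and> crosses (\<lambda>s. orient (\<gamma> s) i j k) t)"

lemma crit_in_subset: "a \<le> c \<Longrightarrow> d \<le> b \<Longrightarrow> crit_in n \<gamma> c d \<subseteq> crit_in n \<gamma> a b"
  by (auto simp: crit_in_def)

lemma regular_subinterval:
  assumes "regular n \<gamma> a b" "a \<le> c" "d \<le> b" "noncollinear n (\<gamma> c)" "noncollinear n (\<gamma> d)"
  shows "regular n \<gamma> c d"
proof -
  have "{c..d} \<subseteq> {a..b}" using assms by auto
  then show ?thesis
    using assms crit_in_subset[OF assms(2,3), of n \<gamma>] unfolding regular_def
    by (meson continuous_on_subset finite_subset subsetD)
qed

lemma path_word_append:
  assumes "finite (crit_in n \<gamma> a b)" "a \<le> c" "c \<le> b" "noncollinear n (\<gamma> c)"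
  shows "path_word n \<gamma> a b = path_word n \<gamma> a c @ path_word n \<gamma> c b"
proof -
  let ?A = "crit_in n \<gamma> a c" and ?B = "crit_in n \<gamma> c b"
  have fin: "finite ?A" "finite ?B"
    using assms crit_in_subset[of a a c b] crit_in_subset[of a c b b] finite_subset by (metis order.refl)+
  have un: "crit_in n \<gamma> a b = ?A \<union> ?B" using assms(2,3) by (auto simp: crit_in_def)
  have lt: "x < y" if "x \<in> ?A" "y \<in> ?B" for x y
  proof -
    have "x \<noteq> c" using that assms(4) by (auto simp: crit_in_iff)
    then show ?thesis using that by (auto simp: crit_in_iff)
  qed
  have "sorted_list_of_set (?A \<union> ?B) = sorted_list_of_set ?A @ sorted_list_of_set ?B"
  proof (rule sorted_distinct_set_unique)
    show "sorted (sorted_list_of_set ?A @ sorted_list_of_set ?B)"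
      using fin lt by (auto simp: sorted_append less_imp_le)
    show "distinct (sorted_list_of_set ?A @ sorted_list_of_set ?B)"
      using fin lt by fastforce
  qed (use fin in auto)
  then show ?thesis by (simp add: path_word_def un)
qed

lemma path_word_Nil: "crit_in n \<gamma> a b = {} \<Longrightarrow> path_word n \<gamma> a b = []"
  by (simp add: path_word_def)

text \<open>Configurations whose points have distinct abscissas in the direction given by \<open>u\<close>. The
  order of the abscissas is not part of the chart: along a path in a chart it cannot change.\<close>

definition in_chart :: "nat \<Rightarrow> complex \<Rightarrow> (nat \<Rightarrow> complex) \<Rightarrow> bool" where
  "in_chart n u z \<longleftrightarrow> re_inj n (\<lambda>i. u * z i)"

definition chart_potential :: "nat \<Rightarrow> complex \<Rightarrow> (nat \<Rightarrow> complex) \<Rightarrow> generator word" where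
  "chart_potential n u z = potential n (\<lambda>i. u * z i)"

lemma orient_scale: "orient (\<lambda>i. u * z i) i j k = (cmod u)\<^sup>2 * orient z i j k"
  unfolding orient_eq cmod_power2 times_complex.sel by algebra

lemma in_chart_nonzero: "in_chart n u z \<Longrightarrow> 2 \<le> n \<Longrightarrow> u \<noteq> 0"
  unfolding in_chart_def re_inj_def inj_on_def
  by (metis One_nat_def Suc_1 atLeastAtMost_iff le_numeral_extra(4) lessI mult_zero_left nat_less_le not_less_eq_eq order_trans)

lemma nonvanishing_same_sign:
  fixes f :: "real \<Rightarrow> real"
  assumes "continuous_on {a..b} f" "a \<le> b" "\<And>t. t \<in> {a..b} \<Longrightarrow> f t \<noteq> 0"
  shows "0 < f a \<longleftrightarrow> 0 < f b"
proof (rule ccontr)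
  assume ne: "\<not> ?thesis"
  have "f a \<noteq> 0" "f b \<noteq> 0" using assms by auto
  then have "(f a \<le> 0 \<and> 0 \<le> f b) \<or> (f b \<le> 0 \<and> 0 \<le> f a)" using ne by auto
  then have "\<exists>t\<in>{a..b}. f t = 0"
    using IVT'[of f a 0 b] IVT2'[of f b 0 a] assms(1,2) atLeastAtMost_iff by metis
  then show False using assms(3) by blast
qed

text \<open>The middle point of a collinear triple lies between the other two in every projection, in
  particular in that of the chart.\<close>

lemma critical_gen_eq:
  assumes ch: "in_chart n u z" and T: "{i, j, k} \<subseteq> {1..n}" "orient z i j k = 0"
    and uniq: "\<And>T. collinear_triple n z T \<Longrightarrow> T = {i, j, k}"
    and lt: "Re (u * z i) < Re (u * z j)" "Re (u * z j) < Re (u * z k)"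
  shows "critical_gen n z = gen i j k"
  unfolding critical_gen_def
proof (rule the_equality)
  have d: "distinct [i, j, k]" using lt by auto
  have "collinear {z i, z j, z k}" using T(2) collinear_iff_orient[of z i j k] by simp
  then have "collinear {z i, z k, z j}" by (simp add: insert_commute)
  moreover have "z k \<noteq> z i" using lt by auto
  ultimately obtain c where c: "z j - z i = c *\<^sub>R (z k - z i)"
  proof -
    have "collinear {0, z k - z i, z j - z i}"
      using \<open>collinear {z i, z k, z j}\<close> collinear_3[of "z k" "z i" "z j"] by (simp add: insert_commute)
    then show ?thesis using that \<open>z k \<noteq> z i\<close> by (auto simp: collinear_lemma)
  qed
  have "Re (u * z j) - Re (u * z i) = Re (u * (z j - z i))" by (simp add: algebra_simps)
  also have "\<dots> = c * (Re (u * z k) - Re (u * z i))" unfolding c by (simp add: algebra_simps)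
  finally have cc: "Re (u * z j) - Re (u * z i) = c * (Re (u * z k) - Re (u * z i))" .
  have "0 < c" using cc lt by (smt (verit) mult_nonpos_nonneg)
  moreover have "c < 1"
  proof (rule ccontr)
    assume "\<not> c < 1"
    then have "1 * (Re (u * z k) - Re (u * z i)) \<le> c * (Re (u * z k) - Re (u * z i))"
      using lt by (intro mult_right_mono) auto
    then show False using cc lt by simp
  qed
  moreover have "z j = (1 - c) *\<^sub>R z i + c *\<^sub>R z k" using c by (simp add: algebra_simps)
  ultimately have "z j \<in> closed_segment (z i) (z k)" unfolding closed_segment_def by (auto intro!: exI[of _ c])
  then show "\<exists>i' j' k'. {i', j', k'} \<subseteq> {1..n} \<and> distinct [i', j', k'] \<and> between (z i', z k') (z j') \<and> gen i j k = gen i' j' k'"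
    using T d unfolding between_mem_segment by blast
  fix g assume "\<exists>i' j' k'. {i', j', k'} \<subseteq> {1..n} \<and> distinct [i', j', k'] \<and> between (z i', z k') (z j') \<and> g = gen i' j' k'"
  then obtain i' j' k' where g: "{i', j', k'} \<subseteq> {1..n}" "distinct [i', j', k']" "between (z i', z k') (z j')" "g = gen i' j' k'"
    by blast
  have "collinear {z i', z j', z k'}"
    using between_imp_collinear[OF g(3)] by (simp add: insert_commute)
  then have "orient z i' j' k' = 0" by (simp add: collinear_iff_orient)
  then have eq: "{i', j', k'} = {i, j, k}" using uniq collinear_tripleI g by blast
  obtain v where v: "0 \<le> v" "v \<le> 1" "z j' = (1 - v) *\<^sub>R z i' + v *\<^sub>R z k'"
    using g(3) unfolding between_mem_segment closed_segment_def by auto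
  have re: "Re (u * z j') = (1 - v) * Re (u * z i') + v * Re (u * z k')"
    unfolding v(3) by (simp add: algebra_simps)
  have lower: "min (Re (u * z i')) (Re (u * z k')) \<le> Re (u * z j')"
    and upper: "Re (u * z j') \<le> max (Re (u * z i')) (Re (u * z k'))"
    unfolding re using v(1,2) convex_bound_le[of "Re (u * z i')" "max (Re (u * z i')) (Re (u * z k'))" "Re (u * z k')" "1 - v" v]
      convex_bound_le[of "- Re (u * z i')" "- min (Re (u * z i')) (Re (u * z k'))" "- Re (u * z k')" "1 - v" v]
    by (auto simp: algebra_simps)
  have "i' \<in> {i, j, k}" "j' \<in> {i, j, k}" "k' \<in> {i, j, k}" using eq by blast+
  then have "(i' = i \<and> j' = j \<and> k' = k) \<or> (i' = k \<and> j' = j \<and> k' = i)"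
    using lower upper lt g(2) by auto
  then show "g = gen i j k" using g(4) by (auto simp: gen_def)
qed

context
  fixes n :: nat and \<gamma> :: "real \<Rightarrow> nat \<Rightarrow> complex" and a b :: real and u :: complex
  assumes n: "3 \<le> n" and ab: "a \<le> b" and reg: "regular n \<gamma> a b"
    and chart: "\<And>t. t \<in> {a..b} \<Longrightarrow> in_chart n u (\<gamma> t)"
begin

lemma u_nonzero: "u \<noteq> 0" using in_chart_nonzero[OF chart[of a]] n ab by auto

lemma path_continuous: "i \<in> {1..n} \<Longrightarrow> continuous_on {a..b} (\<lambda>t. \<gamma> t i)"
  using reg by (auto simp: regular_def)

lemma path_same_order:
  assumes cd: "a \<le> c" "c \<le> d" "d \<le> b"
  shows "same_order n (\<lambda>i. u * \<gamma> c i) (\<lambda>i. u * \<gamma> d i)"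
  unfolding same_order_def
proof (intro ballI)
  fix i j assume ij: "i \<in> {1..n}" "j \<in> {1..n}"
  show "Re (u * \<gamma> c i) < Re (u * \<gamma> c j) \<longleftrightarrow> Re (u * \<gamma> d i) < Re (u * \<gamma> d j)"
  proof (cases "i = j")
    case False
    have cont: "continuous_on {c..d} (\<lambda>t. \<gamma> t i)" if "i \<in> {1..n}" for i
      using path_continuous[OF that] by (rule continuous_on_subset) (use cd in auto)
    have "0 < Re (u * \<gamma> c j) - Re (u * \<gamma> c i) \<longleftrightarrow> 0 < Re (u * \<gamma> d j) - Re (u * \<gamma> d i)"
    proof (rule nonvanishing_same_sign[where f = "\<lambda>t. Re (u * \<gamma> t j) - Re (u * \<gamma> t i)"])
      show "continuous_on {c..d} (\<lambda>t. Re (u * \<gamma> t j) - Re (u * \<gamma> t i))"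
        by (intro continuous_intros cont ij)
      show "Re (u * \<gamma> t j) - Re (u * \<gamma> t i) \<noteq> 0" if "t \<in> {c..d}" for t
      proof -
        have "in_chart n u (\<gamma> t)" using that cd by (intro chart) auto
        then show ?thesis using ij False unfolding in_chart_def re_inj_def inj_on_def by fastforce
      qed
    qed (use cd in auto)
    then show ?thesis by simp
  qed simp
qed

lemma orient_continuous:
  assumes "{i, j, k} \<subseteq> {1..n}"
  shows "continuous_on {a..b} (\<lambda>t. orient (\<gamma> t) i j k)"
  unfolding orient_def by (intro continuous_intros path_continuous) (use assms in auto)

lemma same_orient_if_not_critical:
  assumes cd: "a \<le> c" "c \<le> d" "d \<le> b" and S: "card S = 3" "S \<subseteq> {1..n}"
    and nc: "\<And>t. t \<in> {c..d} \<Longrightarrow> \<not> collinear_triple n (\<gamma> t) S"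
  shows "same_orient (\<lambda>i. u * \<gamma> c i) (\<lambda>i. u * \<gamma> d i) S"
  unfolding same_orient_def
proof (intro allI impI)
  fix i j k assume ijk: "S = {i, j, k}"
  then have d: "distinct [i, j, k]" using S(1) by (auto simp: card_insert_if split: if_splits)
  have "0 < orient (\<gamma> c) i j k \<longleftrightarrow> 0 < orient (\<gamma> d) i j k"
  proof (rule nonvanishing_same_sign[where f = "\<lambda>t. orient (\<gamma> t) i j k"])
    show "continuous_on {c..d} (\<lambda>t. orient (\<gamma> t) i j k)"
      by (rule continuous_on_subset[OF orient_continuous]) (use S(2) ijk cd in auto)
    show "orient (\<gamma> t) i j k \<noteq> 0" if "t \<in> {c..d}" for t
      using nc[OF that] S(2) ijk d collinear_tripleI by blast
  qed (use cd in auto)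
  then show "0 < orient (\<lambda>i. u * \<gamma> c i) i j k \<longleftrightarrow> 0 < orient (\<lambda>i. u * \<gamma> d i) i j k"
    using u_nonzero by (simp add: orient_scale zero_less_mult_iff)
qed

lemma noncollinear_scale: "noncollinear n z \<Longrightarrow> noncollinear n (\<lambda>i. u * z i)"
  using u_nonzero by (simp add: noncollinear_def orient_scale)

lemma potential_const:
  assumes cd: "a \<le> c" "c \<le> d" "d \<le> b" and nc: "crit_in n \<gamma> c d = {}"
  shows "cong3 n (chart_potential n u (\<gamma> c)) (chart_potential n u (\<gamma> d))"
proof -
  have nc': "noncollinear n (\<gamma> t)" if "t \<in> {c..d}" for t using nc that unfolding set_eq_iff crit_in_iff by blast
  interpret config_pair n "\<lambda>i. u * \<gamma> c i" "\<lambda>i. u * \<gamma> d i"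
    by unfold_locales (use path_same_order[OF cd] nc' noncollinear_scale cd in auto)
  show ?thesis unfolding chart_potential_def
    using chart[of c] cd nc'
    by (intro potential_same_chamber same_orient_if_not_critical) (auto simp: in_chart_def noncollinear_iff)
qed

lemma potential_cross:
  assumes cd: "a \<le> c" "c \<le> t" "t \<le> d" "d \<le> b" and nc: "crit_in n \<gamma> c d = {t}"
    and ends: "noncollinear n (\<gamma> c)" "noncollinear n (\<gamma> d)"
  shows "cong3 n (chart_potential n u (\<gamma> c) @ [(critical_gen n (\<gamma> t), True)]) (chart_potential n u (\<gamma> d))"
proof -
  have t: "t \<in> crit_in n \<gamma> a b" "\<not> noncollinear n (\<gamma> t)"
    using crit_in_subset[of a c d b n \<gamma>] nc cd by (auto simp: crit_in_iff)
  then have ctd: "c < t" "t < d" using cd ends by (auto simp: order.strict_iff_order)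
  obtain i0 j0 k0 where T0: "{i0, j0, k0} \<subseteq> {1..n}" "distinct [i0, j0, k0]"
      "\<And>T. collinear_triple n (\<gamma> t) T \<Longrightarrow> T = {i0, j0, k0}" "crosses (\<lambda>s. orient (\<gamma> s) i0 j0 k0) t"
    using reg t(1) unfolding regular_def by metis
  let ?x = "\<lambda>i. Re (u * \<gamma> t i)"
  have inj: "?x l \<noteq> ?x l'" if "l \<in> {1..n}" "l' \<in> {1..n}" "l \<noteq> l'" for l l'
  proof -
    have "inj_on ?x {1..n}" using chart[of t] cd(1-4) unfolding in_chart_def re_inj_def by simp
    then show ?thesis using that by (meson inj_onD)
  qed
  obtain i j k where ijk: "{i, j, k} = {i0, j0, k0}" "?x i < ?x j" "?x j < ?x k"
  proof -
    have ne: "?x i0 \<noteq> ?x j0" "?x i0 \<noteq> ?x k0" "?x j0 \<noteq> ?x k0"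
      using T0(1,2) by (intro inj; simp)+
    then consider "?x i0 < ?x j0" "?x j0 < ?x k0" | "?x i0 < ?x k0" "?x k0 < ?x j0" | "?x j0 < ?x i0" "?x i0 < ?x k0"
      | "?x j0 < ?x k0" "?x k0 < ?x i0" | "?x k0 < ?x i0" "?x i0 < ?x j0" | "?x k0 < ?x j0" "?x j0 < ?x i0" by linarith
    then show ?thesis
      by cases (rule that; (assumption | blast))+
  qed
  have d: "distinct [i, j, k]" using ijk(2,3) by auto
  have T: "{i, j, k} \<subseteq> {1..n}" using ijk(1) T0(1) by simp
  have cr: "crosses (\<lambda>s. orient (\<gamma> s) i j k) t" by (rule crosses_same_set[OF ijk(1) T0(4) d])
  have uniq: "T = {i, j, k}" if "collinear_triple n (\<gamma> t) T" for T using T0(3)[OF that] ijk(1) by simp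
  have zero: "orient (\<gamma> t) i j k = 0"
  proof -
    obtain T where T: "collinear_triple n (\<gamma> t) T" using t(2) by (auto simp: noncollinear_iff)
    then have "collinear (\<gamma> t ` {i, j, k})" using uniq by (auto simp: collinear_triple_def)
    then show ?thesis using collinear_iff_orient[of "\<gamma> t" i j k] by simp
  qed
  have gen: "critical_gen n (\<gamma> t) = gen i j k"
    by (rule critical_gen_eq[OF chart T zero uniq ijk(2,3)]) (use cd in auto)
  have ord_c: "same_order n (\<lambda>i. u * \<gamma> c i) (\<lambda>i. u * \<gamma> t i)" using path_same_order cd by auto
  have ord_cd: "same_order n (\<lambda>i. u * \<gamma> c i) (\<lambda>i. u * \<gamma> d i)" using path_same_order cd by auto
  have nz: "orient (\<gamma> s) i j k \<noteq> 0" if "s \<in> {c..d}" "s \<noteq> t" for s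
  proof -
    have "s \<notin> crit_in n \<gamma> c d" using nc that(2) by simp
    then have "noncollinear n (\<gamma> s)" using that(1) by (simp add: crit_in_iff)
    then show ?thesis using T d unfolding noncollinear_def by auto
  qed
  have cont: "continuous_on {c..d} (\<lambda>t. orient (\<gamma> t) i j k)"
    by (rule continuous_on_subset[OF orient_continuous[OF T]]) (use cd in auto)
  obtain e where e: "0 < e" "\<And>s s'. t - e < s \<and> s < t \<and> t < s' \<and> s' < t + e \<Longrightarrow> orient (\<gamma> s) i j k * orient (\<gamma> s') i j k < 0"
    using cr unfolding crosses_def by blast
  define s s' where "s = max c (t - e / 2)" and "s' = min d (t + e / 2)"
  have s: "c \<le> s" "s < t" "t - e < s" "t < s'" "s' \<le> d" "s' < t + e"
    using ctd e(1) by (auto simp: s_def s'_def)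
  have "0 < orient (\<gamma> c) i j k \<longleftrightarrow> 0 < orient (\<gamma> s) i j k"
    by (rule nonvanishing_same_sign[where f = "\<lambda>t. orient (\<gamma> t) i j k", OF continuous_on_subset[OF cont]])
      (use s nz in auto)
  moreover have "0 < orient (\<gamma> s') i j k \<longleftrightarrow> 0 < orient (\<gamma> d) i j k"
    by (rule nonvanishing_same_sign[where f = "\<lambda>t. orient (\<gamma> t) i j k", OF continuous_on_subset[OF cont]])
      (use s nz in auto)
  moreover have "orient (\<gamma> s) i j k * orient (\<gamma> s') i j k < 0" using e(2) s by auto
  ultimately have flip: "0 < orient (\<gamma> c) i j k \<longleftrightarrow> \<not> 0 < orient (\<gamma> d) i j k"
    by (auto simp: mult_less_0_iff)
  interpret config_pair n "\<lambda>i. u * \<gamma> c i" "\<lambda>i. u * \<gamma> d i"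
    by unfold_locales (use ord_cd ends noncollinear_scale in auto)
  have "cong3 n (potential n (\<lambda>i. u * \<gamma> c i) @ [letter i j k]) (potential n (\<lambda>i. u * \<gamma> d i))"
  proof (rule potential_wall_crossing)
    show "re_inj n (\<lambda>i. u * \<gamma> c i)" using chart[of c] cd by (auto simp: in_chart_def)
    show "Re (u * \<gamma> c i) < Re (u * \<gamma> c j)" "Re (u * \<gamma> c j) < Re (u * \<gamma> c k)"
      using ord_c ijk(2,3) T unfolding same_order_def by simp_all
    show "0 < orient (\<lambda>i. u * \<gamma> c i) i j k \<longleftrightarrow> \<not> 0 < orient (\<lambda>i. u * \<gamma> d i) i j k"
      using flip u_nonzero by (simp add: orient_scale zero_less_mult_iff)
    show "same_orient (\<lambda>i. u * \<gamma> c i) (\<lambda>i. u * \<gamma> d i) S"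
      if S: "card S = 3" "S \<subseteq> {1..n}" "S \<noteq> {i, j, k}" for S
    proof (rule same_orient_if_not_critical[OF _ _ _ S(1,2)])
      fix s assume "s \<in> {c..d}"
      show "\<not> collinear_triple n (\<gamma> s) S"
      proof
        assume ct: "collinear_triple n (\<gamma> s) S"
        then have "s \<in> crit_in n \<gamma> c d" using \<open>s \<in> {c..d}\<close> unfolding crit_in_def by blast
        then have "s = t" using nc by simp
        then show False using uniq[of S] ct S(3) by simp
      qed
    qed (use cd in auto)
  qed (use T in auto)
  then show ?thesis by (simp add: chart_potential_def letter_def gen)
qed

text \<open>Induction on the number of critical moments, with the last one cut off.\<close>

lemma chart_potential_path_aux:
  assumes "card (crit_in n \<gamma> a d) = N" "a \<le> d" "d \<le> b" "noncollinear n (\<gamma> d)"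
  shows "cong3 n (chart_potential n u (\<gamma> a) @ path_word n \<gamma> a d) (chart_potential n u (\<gamma> d))"
  using assms
proof (induction N arbitrary: d)
  have fin: "finite (crit_in n \<gamma> a d)" if "d \<le> b" for d
    using reg crit_in_subset[OF order.refl that] unfolding regular_def by (metis finite_subset)
  {
    case 0
    then have "crit_in n \<gamma> a d = {}" using fin by simp
    then show ?case using potential_const[of a d] 0 by (simp add: path_word_Nil)
  next
    case (Suc N)
    let ?C = "crit_in n \<gamma> a d"
    have C: "finite ?C" "?C \<noteq> {}" using Suc.prems fin by auto
    define t where "t = Max ?C"
    have tC: "t \<in> ?C" using C by (simp add: t_def)
    have na: "noncollinear n (\<gamma> a)" using reg by (simp add: regular_def)
    have ta: "a < t" "t < d" using tC na Suc.prems(4) by (auto simp: crit_in_iff order.strict_iff_order)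
    define m where "m = Max (insert a (?C - {t}))"
    have "m < t"
    proof -
      have "x < t" if "x \<in> insert a (?C - {t})" for x
        using that ta C Max_ge[of ?C x] by (auto simp: t_def order.strict_iff_order)
      then show ?thesis unfolding m_def using C by simp
    qed
    \<comment> \<open>A time between the last critical moment and the one before it.\<close>
    define c where "c = (m + t) / 2"
    have mc: "m < c" "c < t" using \<open>m < t\<close> by (auto simp: c_def)
    have am: "a \<le> m" unfolding m_def using C by simp
    have le_m: "x \<le> m" if "x \<in> ?C" "x \<noteq> t" for x unfolding m_def using that C by simp
    have nc: "noncollinear n (\<gamma> c)"
    proof (rule ccontr)
      assume "\<not> ?thesis"
      then have "c \<in> ?C" using mc am ta by (auto simp: crit_in_iff)
      then show False using le_m[of c] mc by auto
    qed
    have one: "crit_in n \<gamma> c d = {t}"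
    proof (intro Set.set_eqI iffI)
      fix x assume x: "x \<in> crit_in n \<gamma> c d"
      then have "x \<in> ?C" using mc am by (auto simp: crit_in_iff)
      then show "x \<in> {t}" using le_m[of x] x mc by (auto simp: crit_in_iff)
    qed (use tC mc ta in \<open>auto simp: crit_in_iff\<close>)
    have "?C = insert t (crit_in n \<gamma> a c)" "t \<notin> crit_in n \<gamma> a c"
    proof -
      show "?C = insert t (crit_in n \<gamma> a c)"
      proof (intro Set.set_eqI iffI)
        fix x assume x: "x \<in> ?C"
        show "x \<in> insert t (crit_in n \<gamma> a c)"
        proof (cases "x = t")
          case False
          then show ?thesis using le_m[OF x False] x mc by (auto simp: crit_in_iff)
        qed simp
      next
        fix x assume "x \<in> insert t (crit_in n \<gamma> a c)"
        then show "x \<in> ?C" using tC mc ta by (auto simp: crit_in_iff)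
      qed
    qed (use mc in \<open>auto simp: crit_in_iff\<close>)
    then have "card (crit_in n \<gamma> a c) = N" using Suc.prems(1) C(1) by auto
    then have IH: "cong3 n (chart_potential n u (\<gamma> a) @ path_word n \<gamma> a c) (chart_potential n u (\<gamma> c))"
      using mc am ta Suc.prems nc by (intro Suc.IH) auto
    have X: "cong3 n (chart_potential n u (\<gamma> c) @ [(critical_gen n (\<gamma> t), True)]) (chart_potential n u (\<gamma> d))"
      using mc am ta Suc.prems nc one by (intro potential_cross) auto
    have pw: "path_word n \<gamma> a d = path_word n \<gamma> a c @ path_word n \<gamma> c d"
      using C(1) mc am ta nc by (intro path_word_append) auto
    have "path_word n \<gamma> c d = [(critical_gen n (\<gamma> t), True)]" using one by (simp add: path_word_def)
    then have "cong3 n ((chart_potential n u (\<gamma> a) @ path_word n \<gamma> a c) @ path_word n \<gamma> c d)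
        (chart_potential n u (\<gamma> c) @ path_word n \<gamma> c d)"
      using word_cong_words[OF X] by (intro word_cong_right[OF IH]) auto
    also have "cong3 n (chart_potential n u (\<gamma> c) @ path_word n \<gamma> c d) (chart_potential n u (\<gamma> d))"
      using X \<open>path_word n \<gamma> c d = _\<close> by simp
    finally show ?case using pw by simp
  }
qed

text \<open>Between critical moments all orientations keep their signs, and at a critical moment
  exactly one of them changes, so the potential picks up the letters of the word one after the
  other.\<close>

lemma chart_potential_path:
  "cong3 n (chart_potential n u (\<gamma> a) @ path_word n \<gamma> a b) (chart_potential n u (\<gamma> b))"
  using chart_potential_path_aux[OF _ ab order.refl] reg by (auto simp: regular_def)

end

section \<open>Moving one point at a time\<close>

lemma continuous_nonzero_near:
  fixes f :: "real \<Rightarrow> real"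
  assumes "continuous_on {a..b} f" "x \<in> {a..b}" "f x \<noteq> 0"
  shows "\<exists>d>0. \<forall>s\<in>{a..b}. \<bar>s - x\<bar> < d \<longrightarrow> f s \<noteq> 0"
proof -
  obtain d where "0 < d" "\<forall>s\<in>{a..b}. dist s x < d \<longrightarrow> dist (f s) (f x) < \<bar>f x\<bar>"
    using assms unfolding continuous_on_iff by (metis zero_less_abs_iff)
  then show ?thesis by (intro exI[of _ d]) (auto simp: dist_real_def)
qed

lemma finite_triples: "finite {(i, j, k). {i, j, k} \<subseteq> {1..n::nat} \<and> distinct [i, j, k]}"
proof (rule finite_subset)
  show "{(i, j, k). {i, j, k} \<subseteq> {1..n} \<and> distinct [i, j, k]} \<subseteq> {1..n} \<times> {1..n} \<times> {1..n}" by auto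
qed simp

text \<open>Finitely many conditions that hold for all sufficiently small positive numbers hold for a
  common one.\<close>

lemma finite_common_radius:
  assumes "finite A" "\<And>x. x \<in> A \<Longrightarrow> \<exists>d>0::real. P x d" "\<And>x d d'. P x d \<Longrightarrow> 0 < d' \<Longrightarrow> d' \<le> d \<Longrightarrow> P x d'"
  shows "\<exists>d>0. \<forall>x\<in>A. P x d"
  using assms(1,2)
proof (induction A rule: finite_induct)
  case empty then show ?case by (auto intro: exI[of _ 1])
next
  case (insert x A)
  then obtain d d' where "0 < d" "\<forall>y\<in>A. P y d" "0 < d'" "P x d'" by (metis insertCI)
  then have "\<forall>y\<in>insert x A. P y (min d d')" "0 < min d d'"
    using assms(3)[of _ _ "min d d'"] by fastforce+
  then show ?case by blast
qed

lemma orient_continuous_on: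
  assumes "\<forall>i\<in>{1..n}. continuous_on S (\<lambda>t. \<gamma> t i)" "{i, j, k} \<subseteq> {1..n}"
  shows "continuous_on S (\<lambda>t. orient (\<gamma> t) i j k)"
  unfolding orient_def by (intro continuous_intros) (use assms in auto)

text \<open>Zeros are isolated, both by continuity and by the definition of a crossing. Finiteness of
  the number of zeros is additive over intervals and holds locally, so it holds on the whole
  interval.\<close>

lemma finite_zeros_if_cross:
  fixes f :: "real \<Rightarrow> real"
  assumes "continuous_on {a..b} f" "a \<le> b" "\<And>t. t \<in> {a..b} \<Longrightarrow> f t = 0 \<Longrightarrow> crosses f t"
  shows "finite {t \<in> {a..b}. f t = 0}"
proof -
  define Z where "Z = {t \<in> {a..b}. f t = 0}"
  have "finite (Z \<inter> {a..b})"
    using assms(2)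
  proof (induction rule: Bolzano)
    case (trans u v w)
    have "Z \<inter> {u..w} = (Z \<inter> {u..v}) \<union> (Z \<inter> {v..w})" using trans by auto
    then show ?case using trans by simp
  next
    case (local t)
    then have t: "t \<in> {a..b}" by simp
    have "\<exists>d>0. \<forall>s\<in>{a..b}. \<bar>s - t\<bar> < d \<and> s \<noteq> t \<longrightarrow> f s \<noteq> 0"
    proof (cases "f t = 0")
      case False
      then show ?thesis using continuous_nonzero_near[OF assms(1) t] by blast
    next
      case True
      obtain d where d: "0 < d" "\<And>s s'. t - d < s \<and> s < t \<and> t < s' \<and> s' < t + d \<Longrightarrow> f s * f s' < 0"
        using assms(3)[OF t True] unfolding crosses_def by blast
      have "f s \<noteq> 0" if "\<bar>s - t\<bar> < d" "s \<noteq> t" for s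
      proof (cases "s < t")
        case True then show ?thesis using d(2)[of s "t + d / 2"] that d(1) by auto
      next
        case False then show ?thesis using d(2)[of "t - d / 2" s] that d(1) by auto
      qed
      then show ?thesis using d(1) by blast
    qed
    then obtain d where d: "0 < d" "\<forall>s\<in>{a..b}. \<bar>s - t\<bar> < d \<and> s \<noteq> t \<longrightarrow> f s \<noteq> 0" by blast
    have "finite (Z \<inter> {u..v})" if uv: "u \<le> t \<and> t \<le> v \<and> v - u < d" for u v
    proof (rule finite_subset)
      show "Z \<inter> {u..v} \<subseteq> {t}"
      proof
        fix s assume s: "s \<in> Z \<inter> {u..v}"
        then have "\<bar>s - t\<bar> < d" using uv unfolding Int_iff atLeastAtMost_iff by linarith
        then show "s \<in> {t}" using d(2) s unfolding Z_def by blast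
      qed
    qed simp
    then show ?case using d(1) by blast
  qed
  moreover have "Z \<inter> {a..b} = Z" by (auto simp: Z_def)
  ultimately show ?thesis by (simp add: Z_def)
qed

lemma regularI:
  assumes cont: "\<forall>i\<in>{1..n}. continuous_on {a..b} (\<lambda>t. \<gamma> t i)" and ab: "a \<le> b"
    and ends: "noncollinear n (\<gamma> a)" "noncollinear n (\<gamma> b)"
    and crit: "\<And>t. t \<in> crit_in n \<gamma> a b \<Longrightarrow> \<exists>i j k. {i, j, k} \<subseteq> {1..n} \<and> distinct [i, j, k] \<and>
       (\<forall>T. collinear_triple n (\<gamma> t) T \<longrightarrow> T = {i, j, k}) \<and> crosses (\<lambda>s. orient (\<gamma> s) i j k) t"
  shows "regular n \<gamma> a b"
proof -
  let ?I = "{(i, j, k). {i, j, k} \<subseteq> {1..n} \<and> distinct [i, j, k]}"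
  let ?Z = "\<lambda>(i, j, k). {t \<in> {a..b}. orient (\<gamma> t) i j k = 0}"
  have "finite (\<Union>x\<in>?I. ?Z x)"
  proof (rule finite_UN_I[OF finite_triples])
    fix x assume "x \<in> ?I"
    then obtain i j k where x: "x = (i, j, k)" "{i, j, k} \<subseteq> {1..n}" "distinct [i, j, k]" by blast
    have "finite {t \<in> {a..b}. orient (\<gamma> t) i j k = 0}"
    proof (rule finite_zeros_if_cross[OF orient_continuous_on[OF cont x(2)] ab])
      fix t assume t: "t \<in> {a..b}" "orient (\<gamma> t) i j k = 0"
      have T: "collinear_triple n (\<gamma> t) {i, j, k}" by (rule collinear_tripleI[OF x(2,3) t(2)])
      then have "t \<in> crit_in n \<gamma> a b" using t(1) by (auto simp: crit_in_def)
      from crit[OF this] obtain i' j' k' where c: "\<forall>T. collinear_triple n (\<gamma> t) T \<longrightarrow> T = {i', j', k'}"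
        "crosses (\<lambda>s. orient (\<gamma> s) i' j' k') t" by (elim exE conjE) rule
      have "{i, j, k} = {i', j', k'}" using c(1) T by blast
      then show "crosses (\<lambda>s. orient (\<gamma> s) i j k) t" using c(2) x(3) by (rule crosses_same_set)
    qed
    then show "finite (?Z x)" by (simp add: x(1))
  qed
  moreover have "crit_in n \<gamma> a b \<subseteq> (\<Union>x\<in>?I. ?Z x)"
    unfolding crit_in_def collinear_triple_iff by fastforce
  ultimately have "finite (crit_in n \<gamma> a b)" by (rule finite_subset[rotated])
  then show ?thesis using cont ends crit unfolding regular_def by blast
qed

definition glide :: "(nat \<Rightarrow> complex) \<Rightarrow> (nat \<Rightarrow> complex) \<Rightarrow> real \<Rightarrow> nat \<Rightarrow> complex" where
  "glide p q \<tau> = (\<lambda>i. (1 - \<tau>) *\<^sub>R p i + \<tau> *\<^sub>R q i)"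

text \<open>A single point moves along a segment. Then the orientations are affine functions of time,
  so that each of them has at most one zero, at which it changes sign.\<close>

definition good_move :: "nat \<Rightarrow> (nat \<Rightarrow> complex) \<Rightarrow> (nat \<Rightarrow> complex) \<Rightarrow> bool" where
  "good_move n p q \<longleftrightarrow> noncollinear n p \<and> noncollinear n q \<and> (\<exists>i. \<forall>j. j \<noteq> i \<longrightarrow> p j = q j) \<and>
    (\<forall>\<tau>\<in>{0..1}. \<forall>T T'. collinear_triple n (glide p q \<tau>) T \<and> collinear_triple n (glide p q \<tau>) T' \<longrightarrow> T = T')"

lemma glide_0 [simp]: "glide p q 0 = p" and glide_1 [simp]: "glide p q 1 = q"
  by (auto simp: glide_def)

lemma glide_self [simp]: "glide p p \<tau> = p"
  by (auto simp: glide_def simp flip: scaleR_left_distrib)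

lemma glide_sym: "glide q p \<tau> = glide p q (1 - \<tau>)"
  by (auto simp: glide_def)

lemma good_move_sym: "good_move n p q \<Longrightarrow> good_move n q p"
proof -
  assume g: "good_move n p q"
  then have "\<exists>i. \<forall>j. j \<noteq> i \<longrightarrow> p j = q j" by (simp only: good_move_def simp_thms)
  then obtain i where i: "\<forall>j. j \<noteq> i \<longrightarrow> p j = q j" ..
  have "T = T'" if "\<tau> \<in> {0..1}" "collinear_triple n (glide q p \<tau>) T" "collinear_triple n (glide q p \<tau>) T'" for \<tau> T T'
  proof -
    have "1 - \<tau> \<in> {0..1}" using that(1) by simp
    then show ?thesis using g that(2,3) unfolding good_move_def glide_sym[of q p] by blast
  qed
  moreover have "\<exists>i. \<forall>j. j \<noteq> i \<longrightarrow> q j = p j" using i by metis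
  moreover have "noncollinear n p" "noncollinear n q" using g by (simp_all only: good_move_def)
  ultimately show ?thesis unfolding good_move_def by blast
qed

lemma orient_glide:
  assumes "\<forall>l. l \<noteq> m \<longrightarrow> p l = q l" "distinct [i, j, k]"
  shows "orient (glide p q \<tau>) i j k = (1 - \<tau>) * orient p i j k + \<tau> * orient q i j k"
proof -
  have *: "orient (glide p q \<tau>) i j k = (1 - \<tau>) * orient p i j k + \<tau> * orient q i j k"
    if "p j = q j" "p k = q k" for i j k
  proof -
    have 1: "glide p q \<tau> j = p j" "glide p q \<tau> k = p k"
      using that by (auto simp: glide_def simp flip: scaleR_left_distrib)
    have 2: "Re (glide p q \<tau> i) = (1 - \<tau>) * Re (p i) + \<tau> * Re (q i)"
      "Im (glide p q \<tau> i) = (1 - \<tau>) * Im (p i) + \<tau> * Im (q i)" by (simp_all add: glide_def)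
    show ?thesis unfolding orient_eq that[symmetric] 1 2 by algebra
  qed
  consider "p j = q j" "p k = q k" | "p i = q i" "p k = q k" | "p i = q i" "p j = q j"
    using assms by (cases "m = i"; cases "m = j") auto
  then show ?thesis
  proof cases
    case 1 then show ?thesis by (rule *)
  next
    case 2 then show ?thesis using *[where i = j and j = k and k = i] by (simp add: orient_perms(1)[where i = i and j = j and k = k])
  next
    case 3 then show ?thesis using *[where i = k and j = i and k = j] by (simp add: orient_perms(2)[where i = i and j = j and k = k])
  qed
qed

lemma crosses_affine:
  assumes "\<And>s. f s = (1 - s) * a + s * (b::real)" "f t = 0" "a \<noteq> 0"
  shows "crosses f t"
  unfolding crosses_def
proof (intro exI[of _ 1] conjI allI impI)
  fix s s' assume s: "t - 1 < s \<and> s < t \<and> t < s' \<and> s' < t + 1"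
  have "b - a \<noteq> 0" using assms(1)[of t] assms(2,3) by (auto simp: algebra_simps)
  have f: "f x = (x - t) * (b - a)" for x using assms(1)[of x] assms(1)[of t] assms(2) by (simp add: algebra_simps)
  have "f s * f s' = ((s - t) * (s' - t)) * (b - a)\<^sup>2" by (simp add: f power2_eq_square)
  moreover have "(s - t) * (s' - t) < 0" using s by (auto simp: mult_less_0_iff)
  ultimately show "f s * f s' < 0" using \<open>b - a \<noteq> 0\<close> by (auto simp: mult_less_0_iff)
qed simp

lemma regular_glide:
  assumes "good_move n p q"
  shows "regular n (glide p q) 0 1"
proof (rule regularI)
  obtain m where m: "\<forall>l. l \<noteq> m \<longrightarrow> p l = q l" using assms unfolding good_move_def by auto
  show "\<forall>i\<in>{1..n}. continuous_on {0..1} (\<lambda>t. glide p q t i)"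
    unfolding glide_def by (intro ballI continuous_intros)
  show "noncollinear n (glide p q 0)" "noncollinear n (glide p q 1)" using assms by (auto simp: good_move_def)
  fix t assume t: "t \<in> crit_in n (glide p q) 0 1"
  then obtain T where T: "collinear_triple n (glide p q t) T" by (auto simp: crit_in_def)
  obtain i j k where ijk: "T = {i, j, k}" "{i, j, k} \<subseteq> {1..n}" "distinct [i, j, k]" "orient (glide p q t) i j k = 0"
    using T unfolding collinear_triple_iff by blast
  have "orient p i j k \<noteq> 0" using assms ijk(2,3) unfolding good_move_def noncollinear_def by auto
  then have "crosses (\<lambda>s. orient (glide p q s) i j k) t"
    using orient_glide[OF m ijk(3)] ijk(4) by (intro crosses_affine)
  moreover have "T' = {i, j, k}" if "collinear_triple n (glide p q t) T'" for T'
    using assms t T that ijk(1) unfolding good_move_def crit_in_def by blast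
  ultimately show "\<exists>i j k. {i, j, k} \<subseteq> {1..n} \<and> distinct [i, j, k] \<and>
          (\<forall>T. collinear_triple n (glide p q t) T \<longrightarrow> T = {i, j, k}) \<and>
          crosses (\<lambda>s. orient (glide p q s) i j k) t"
    using ijk(2,3) by blast
qed simp

definition line :: "complex \<Rightarrow> complex \<Rightarrow> complex set" where
  "line a b = {w. Im (cnj (b - a) * (w - a)) = 0}"

lemma negligible_line:
  assumes "a \<noteq> b"
  shows "negligible (line a b)"
proof -
  have "line a b = {w. (\<i> * (b - a)) \<bullet> w = (\<i> * (b - a)) \<bullet> a}"
    unfolding line_def inner_complex_def by (auto simp: algebra_simps)
  moreover have "\<i> * (b - a) \<noteq> 0" using assms by simp
  ultimately show ?thesis using negligible_hyperplane by metis
qed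

lemma orient_upd: "i \<noteq> j \<Longrightarrow> i \<noteq> k \<Longrightarrow> orient (p(i := w)) i j k = 0 \<longleftrightarrow> w \<in> line (p j) (p k)"
  using orient_rot[of "p(i := w)" j k i] by (simp add: line_def orient_def)

lemma noncollinear_distinct:
  assumes "noncollinear n p" "{i, j, k} \<subseteq> {1..n}" "distinct [i, j, k]"
  shows "p j \<noteq> p k"
proof
  assume "p j = p k"
  then have "orient p i j k = 0" by (simp add: orient_eq)
  then show False using assms unfolding noncollinear_def by auto
qed

lemma line_collinear: "w \<in> line a b \<longleftrightarrow> collinear {a, b, w}"
  using collinear_iff_orient[of "\<lambda>i. if i = 0 then a else if i = 1 then b else w" 0 1 "2::nat"]
  by (simp add: line_def orient_def)

lemma lines_meet_once:
  assumes "noncollinear n p" "{i, j, k, l, m} \<subseteq> {1..n}" "distinct [j, k]" "distinct [l, m]" "{j, k} \<noteq> {l, m}"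
    and "p j \<noteq> p k" "p l \<noteq> p m"
    and X: "X \<in> line (p j) (p k) \<inter> line (p l) (p m)" and Y: "Y \<in> line (p j) (p k) \<inter> line (p l) (p m)"
  shows "X = Y"
proof (rule ccontr)
  assume ne: "X \<noteq> Y"
  have 1: "collinear {p j, p k, X, Y}"
    using X Y collinear_triples[OF assms(6), of "{X, Y}"] by (auto simp: line_collinear)
  have 2: "collinear {p l, p m, X, Y}"
    using X Y collinear_triples[OF assms(7), of "{X, Y}"] by (auto simp: line_collinear)
  have "collinear {X, Y, v}" if "v \<in> {p j, p k, p l, p m}" for v
    using that by (elim insertE emptyE) (auto intro: collinear_subset[OF 1] collinear_subset[OF 2])
  then have all: "collinear (insert X (insert Y {p j, p k, p l, p m}))"
    using collinear_triples[OF ne, of "{p j, p k, p l, p m}"] by blast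
  obtain v where v: "v \<in> {l, m}" "v \<notin> {j, k}" using assms(3-5) by auto
  have "{p j, p k, p v} \<subseteq> insert X (insert Y {p j, p k, p l, p m})" using v(1) by auto
  then have "collinear {p j, p k, p v}" using all collinear_subset by blast
  then have "orient p j k v = 0" by (simp add: collinear_iff_orient)
  moreover have "distinct [j, k, v]" "{j, k, v} \<subseteq> {1..n}" using v assms(2,3) by auto
  ultimately show False using assms(1) unfolding noncollinear_def by auto
qed

text \<open>The target \<open>w\<close> of a good move of the point \<open>i\<close> has to avoid the lines through two other
  points, and the segment must not meet two of these lines at once. Two different lines meet
  in at most one point \<open>X\<close>, so the latter condition only excludes the points \<open>w\<close> of the line
  through \<open>p i\<close> and \<open>X\<close>. The bad targets lie on finitely many lines.\<close>

lemma negligible_bad_moves: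
  assumes p: "noncollinear n p" and i: "i \<in> {1..n}"
  shows "negligible {w. \<not> good_move n p (p(i := w))}"
proof -
  define J where "J = {(j, k). {j, k} \<subseteq> {1..n} \<and> distinct [i, j, k]}"
  define K where "K = {(j, k, l, m). {j, k, l, m} \<subseteq> {1..n} \<and> distinct [i, j, k] \<and> distinct [i, l, m] \<and> {j, k} \<noteq> {l, m}}"
  define M where "M = (\<lambda>(j, k, l, m). line (p j) (p k) \<inter> line (p l) (p m))"
  have J: "{j, k} \<subseteq> {1..n}" "distinct [i, j, k]" if "(j, k) \<in> J" for j k
    using that unfolding J_def by simp_all
  have K: "{j, k, l, m} \<subseteq> {1..n}" "distinct [i, j, k]" "distinct [i, l, m]" "{j, k} \<noteq> {l, m}"
    if "(j, k, l, m) \<in> K" for j k l m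
    using that unfolding K_def by simp_all
  have fJ: "finite J"
    by (rule finite_subset[of _ "{1..n} \<times> {1..n}"]) (use J in \<open>force+\<close>)
  have fK: "finite K"
  proof (rule finite_subset[of _ "{1..n} \<times> {1..n} \<times> {1..n} \<times> {1..n}"])
    show "K \<subseteq> {1..n} \<times> {1..n} \<times> {1..n} \<times> {1..n}"
    proof
      fix x assume x: "x \<in> K"
      obtain j k l m where x': "x = (j, k, l, m)" by (cases x)
      show "x \<in> {1..n} \<times> {1..n} \<times> {1..n} \<times> {1..n}" using K(1)[of j k l m] x x' by simp
    qed
  qed simp
  have ne: "p j \<noteq> p k" if "{j, k} \<subseteq> {1..n}" "distinct [i, j, k]" for j k
    using noncollinear_distinct[OF p _ that(2)] that(1) i by simp
  have pi: "p i \<notin> line (p j) (p k)" if "{j, k} \<subseteq> {1..n}" "distinct [i, j, k]" for j k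
  proof -
    have "orient p i j k \<noteq> 0" using p i that unfolding noncollinear_def by simp
    then show ?thesis using orient_upd[of i j k p "p i"] that(2) by simp
  qed
  have fM: "finite (M x) \<and> p i \<notin> M x" if x: "x \<in> K" for x
  proof -
    obtain j k l m where x': "x = (j, k, l, m)" by (cases x)
    note K = K[OF x[unfolded x']]
    have "X = Y" if "X \<in> M x" "Y \<in> M x" for X Y
    proof (rule lines_meet_once[OF p])
      show "{i, j, k, l, m} \<subseteq> {1..n}" using K(1) i by simp
      show "p j \<noteq> p k" "p l \<noteq> p m" using K by (intro ne; simp)+
      show "X \<in> line (p j) (p k) \<inter> line (p l) (p m)" "Y \<in> line (p j) (p k) \<inter> line (p l) (p m)"
        using that unfolding M_def x' by simp_all
    qed (use K in simp_all)
    then have "finite (M x)" by (metis finite.simps finite_subset insertCI subsetI)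
    then show ?thesis using pi[of j k] K x' by (simp add: M_def)
  qed
  let ?N = "(\<Union>e\<in>J. line (p (fst e)) (p (snd e))) \<union> (\<Union>x\<in>K. \<Union>X\<in>M x. line (p i) X)"
  have "negligible ?N"
  proof (intro negligible_Un negligible_Union)
    show "finite ((\<lambda>e. line (p (fst e)) (p (snd e))) ` J)" using fJ by simp
    show "negligible t" if tJ: "t \<in> (\<lambda>e. line (p (fst e)) (p (snd e))) ` J" for t
    proof -
      obtain e where "e \<in> J" "t = line (p (fst e)) (p (snd e))" using tJ by blast
      then obtain j k where jk: "(j, k) \<in> J" "t = line (p j) (p k)" by (cases e) simp
      then show ?thesis using ne[OF J[OF jk(1)]] negligible_line by simp
    qed
    show "finite ((\<lambda>x. \<Union>X\<in>M x. line (p i) X) ` K)" using fK by simp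
    fix t assume "t \<in> (\<lambda>x. \<Union>X\<in>M x. line (p i) X) ` K"
    then obtain x where x: "x \<in> K" "t = (\<Union>X\<in>M x. line (p i) X)" by blast
    have "negligible (\<Union>X\<in>M x. line (p i) X)"
    proof (rule negligible_Union)
      show "finite ((\<lambda>X. line (p i) X) ` M x)" using fM[OF x(1)] by simp
      show "negligible t" if "t \<in> (\<lambda>X. line (p i) X) ` M x" for t
        using that fM[OF x(1)] negligible_line by (metis imageE)
    qed
    then show "negligible t" using x(2) by simp
  qed
  moreover have "{w. \<not> good_move n p (p(i := w))} \<subseteq> ?N"
  proof
    fix w assume w: "w \<in> {w. \<not> good_move n p (p(i := w))}"
    show "w \<in> ?N"
    proof (rule ccontr)
      assume wN: "w \<notin> ?N"
      let ?q = "p(i := w)"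
      have other: "\<forall>l. l \<noteq> i \<longrightarrow> p l = ?q l" by simp
      have contains: "i \<in> {a, b, c}" if "orient (glide p ?q \<tau>) a b c = 0" "{a, b, c} \<subseteq> {1..n}" "distinct [a, b, c]" for a b c \<tau>
      proof (rule ccontr)
        assume "i \<notin> {a, b, c}"
        then have "glide p ?q \<tau> a = p a" "glide p ?q \<tau> b = p b" "glide p ?q \<tau> c = p c"
          by (auto simp: glide_def simp flip: scaleR_left_distrib)
        then show False using that p unfolding noncollinear_def orient_def by auto
      qed
      have form: "\<exists>j k. T = {i, j, k} \<and> {j, k} \<subseteq> {1..n} \<and> distinct [i, j, k] \<and> glide p ?q \<tau> i \<in> line (p j) (p k)"
        if T: "collinear_triple n (glide p ?q \<tau>) T" for T \<tau>
      proof -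
        obtain a b c where abc: "T = {a, b, c}" "{a, b, c} \<subseteq> {1..n}" "distinct [a, b, c]" "orient (glide p ?q \<tau>) a b c = 0"
          using T unfolding collinear_triple_iff by blast
        have "i = a \<or> i = b \<or> i = c" using contains[OF abc(4,2,3)] by simp
        then obtain j k where jk: "T = {i, j, k}" "distinct [i, j, k]" "orient (glide p ?q \<tau>) i j k = 0"
        proof (elim disjE)
          assume "i = a" then show ?thesis using abc that[of b c] by simp
        next
          assume i: "i = b" then show ?thesis using abc that[of c a] orient_rot[of _ b c a] by (auto simp: insert_commute)
        next
          assume i: "i = c" then show ?thesis using abc that[of a b] orient_rot[of _ a b c] by (auto simp: insert_commute)
        qed
        have "glide p ?q \<tau> = p(i := glide p ?q \<tau> i)"
          by (auto simp: glide_def simp flip: scaleR_left_distrib)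
        then have "orient (p(i := glide p ?q \<tau> i)) i j k = 0" using jk(3) by simp
        then have "glide p ?q \<tau> i \<in> line (p j) (p k)" using jk(2) by (subst (asm) orient_upd) auto
        moreover have "{j, k} \<subseteq> {1..n}" using jk(1) abc(1,2) by auto
        ultimately show ?thesis using jk by blast
      qed
      have "noncollinear n ?q"
      proof (rule ccontr)
        assume "\<not> ?thesis"
        then obtain T where "collinear_triple n (glide p ?q 1) T" by (auto simp: noncollinear_iff)
        from form[OF this] obtain j k where jk: "{j, k} \<subseteq> {1..n}" "distinct [i, j, k]"
          "glide p ?q 1 i \<in> line (p j) (p k)" by blast
        then have "(j, k) \<in> J" "w \<in> line (p j) (p k)" unfolding J_def by simp_all
        then show False using wN by force
      qed
      moreover have "T = T'" if col: "collinear_triple n (glide p ?q \<tau>) T" "collinear_triple n (glide p ?q \<tau>) T'" for T T' \<tau>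
      proof (rule ccontr)
        assume TT: "T \<noteq> T'"
        let ?X = "glide p ?q \<tau> i"
        obtain j k where jk: "T = {i, j, k}" "{j, k} \<subseteq> {1..n}" "distinct [i, j, k]" "?X \<in> line (p j) (p k)"
          using form[OF col(1)] by blast
        obtain l m where lm: "T' = {i, l, m}" "{l, m} \<subseteq> {1..n}" "distinct [i, l, m]" "?X \<in> line (p l) (p m)"
          using form[OF col(2)] by blast
        have "(j, k, l, m) \<in> K" "?X \<in> M (j, k, l, m)"
          using jk lm TT unfolding M_def K_def by auto
        moreover have "w \<in> line (p i) ?X"
        proof -
          have "?X - p i = of_real \<tau> * (w - p i)" by (simp add: glide_def scaleR_conv_of_real algebra_simps)
          moreover have "Im (cnj (of_real \<tau> * v) * v) = 0" for v by (simp add: algebra_simps)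
          ultimately show ?thesis unfolding line_def mem_Collect_eq by (simp only:)
        qed
        ultimately show False using wN by blast
      qed
      ultimately have "good_move n p ?q" using p other unfolding good_move_def by blast
      then show False using w by simp
    qed
  qed
  ultimately show ?thesis using negligible_subset by blast
qed

text \<open>A neighbourhood in the product of \<open>n\<close> planes; the other coordinates are kept at \<open>0\<close>. It is
  convex.\<close>

definition conf_box :: "nat \<Rightarrow> (nat \<Rightarrow> complex) \<Rightarrow> real \<Rightarrow> (nat \<Rightarrow> complex) set" where
  "conf_box n c \<epsilon> = {z. (\<forall>i\<in>{1..n}. dist (z i) (c i) < \<epsilon>) \<and> (\<forall>i. i \<notin> {1..n} \<longrightarrow> z i = 0)}"

lemma glide_in_box:
  assumes "p \<in> conf_box n c \<epsilon>" "q \<in> conf_box n c \<epsilon>" "\<tau> \<in> {0..1}"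
  shows "glide p q \<tau> \<in> conf_box n c \<epsilon>"
proof -
  have "glide p q \<tau> i \<in> ball (c i) \<epsilon>" if "i \<in> {1..n}" for i
    using convexD_alt[OF convex_ball, of "p i" "c i" \<epsilon> "q i" \<tau>] assms that
    by (auto simp: conf_box_def glide_def dist_commute)
  then show ?thesis using assms by (auto simp: conf_box_def glide_def dist_commute)
qed

lemma exists_good_move2:
  assumes "noncollinear n p" "noncollinear n q" "i \<in> {1..n}" "0 < \<epsilon>"
  shows "\<exists>w. dist w x < \<epsilon> \<and> good_move n p (p(i := w)) \<and> good_move n q (q(i := w))"
proof (rule ccontr)
  assume no: "\<not> ?thesis"
  then have "ball x \<epsilon> \<subseteq> {w. \<not> good_move n p (p(i := w))} \<union> {w. \<not> good_move n q (q(i := w))}"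
    by (auto simp: dist_commute)
  then have "negligible (ball x \<epsilon>)"
    using negligible_bad_moves assms by (meson negligible_Un negligible_subset)
  moreover have "\<not> negligible (ball x \<epsilon>)" using assms(4) by (intro open_not_negligible) auto
  ultimately show False by simp
qed

lemma noncollinear_dense:
  assumes "noncollinear n z0" "\<forall>i. i \<notin> {1..n} \<longrightarrow> z0 i = 0" "0 < \<epsilon>"
  shows "\<exists>z\<in>conf_box n c \<epsilon>. noncollinear n z"
proof -
  have "\<exists>z. noncollinear n z \<and> (\<forall>i\<in>{1..m}. dist (z i) (c i) < \<epsilon>) \<and> (\<forall>i. i \<notin> {1..n} \<longrightarrow> z i = 0)" if "m \<le> n" for m
    using that
  proof (induction m)
    case 0 then show ?case using assms by auto
  next
    case (Suc m)
    then obtain z where z: "noncollinear n z" "\<forall>i\<in>{1..m}. dist (z i) (c i) < \<epsilon>" "\<forall>i. i \<notin> {1..n} \<longrightarrow> z i = 0" by auto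
    obtain w where w: "dist w (c (Suc m)) < \<epsilon>" "good_move n z (z(Suc m := w))"
      using exists_good_move2[OF z(1) z(1), of "Suc m" \<epsilon> "c (Suc m)"] Suc.prems assms(3) by auto
    have "noncollinear n (z(Suc m := w))" using w(2) by (simp only: good_move_def)
    moreover have "\<forall>i\<in>{1..Suc m}. dist ((z(Suc m := w)) i) (c i) < \<epsilon>"
      using w(1) z(2) by (auto simp: le_Suc_eq)
    moreover have "\<forall>i. i \<notin> {1..n} \<longrightarrow> (z(Suc m := w)) i = 0" using z(3) Suc.prems by auto
    ultimately show ?case by blast
  qed
  from this[of n] show ?thesis by (auto simp: conf_box_def)
qed

text \<open>The points of \<open>p\<close> and of \<open>q\<close> are moved one after the other to the same intermediate
  configuration \<open>r\<close>. Moving both towards \<open>r\<close>, instead of \<open>p\<close> to \<open>q\<close> directly, leaves the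
  freedom to choose the coordinates of \<open>r\<close> generically. All chains have the same length, which
  keeps the parametrization of the polygons below simple.\<close>

lemma good_chain:
  assumes p: "p \<in> conf_box n c \<epsilon>" "noncollinear n p" and q: "q \<in> conf_box n c \<epsilon>" "noncollinear n q"
  shows "\<exists>C. C 0 = p \<and> C (2 * n) = q \<and> (\<forall>k<2 * n. good_move n (C k) (C (Suc k))) \<and> (\<forall>k\<le>2 * n. C k \<in> conf_box n c \<epsilon>)"
proof (cases "n = 0")
  case True
  then have "p = q" using p q by (auto simp: conf_box_def)
  then show ?thesis using p True by (intro exI[of _ "\<lambda>_. p"]) auto
next
  case False
  then have eps: "0 < \<epsilon>" using p(1) unfolding conf_box_def
    by (auto dest!: bspec[of _ _ 1]) (meson dist_not_less_zero le_less_trans not_less zero_le_dist)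
  have "\<exists>P Q. P 0 = p \<and> Q 0 = q \<and> (\<forall>k<m. good_move n (P k) (P (Suc k)) \<and> good_move n (Q k) (Q (Suc k))) \<and>
      (\<forall>k\<le>m. P k \<in> conf_box n c \<epsilon> \<and> Q k \<in> conf_box n c \<epsilon> \<and> noncollinear n (P k) \<and> noncollinear n (Q k)) \<and> (\<forall>i\<in>{1..m}. P m i = Q m i)"
    if "m \<le> n" for m
    using that
  proof (induction m)
    case 0
    show ?case by (rule exI[of _ "\<lambda>_. p"], rule exI[of _ "\<lambda>_. q"]) (use p q in auto)
  next
    case (Suc m)
    then obtain P Q where PQ: "P 0 = p" "Q 0 = q" "\<forall>k<m. good_move n (P k) (P (Suc k)) \<and> good_move n (Q k) (Q (Suc k))"
      "\<forall>k\<le>m. P k \<in> conf_box n c \<epsilon> \<and> Q k \<in> conf_box n c \<epsilon> \<and> noncollinear n (P k) \<and> noncollinear n (Q k)" "\<forall>i\<in>{1..m}. P m i = Q m i"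
      by auto
    have m: "Suc m \<in> {1..n}" using Suc.prems by auto
    obtain w where w: "dist w (c (Suc m)) < \<epsilon>" "good_move n (P m) ((P m)(Suc m := w))" "good_move n (Q m) ((Q m)(Suc m := w))"
      using exists_good_move2[OF _ _ m eps, of "P m" "Q m" "c (Suc m)"] PQ(4) by auto
    define P' Q' where "P' = P(Suc m := (P m)(Suc m := w))" and "Q' = Q(Suc m := (Q m)(Suc m := w))"
    have "P' k \<in> conf_box n c \<epsilon> \<and> Q' k \<in> conf_box n c \<epsilon> \<and> noncollinear n (P' k) \<and> noncollinear n (Q' k)" if "k \<le> Suc m" for k
    proof (cases "k = Suc m")
      case True
      then show ?thesis using PQ(4)[rule_format, of m] w m by (auto simp: P'_def Q'_def conf_box_def good_move_def)
    next
      case False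
      then show ?thesis using PQ(4)[rule_format, of k] that by (auto simp: P'_def Q'_def)
    qed
    moreover have "good_move n (P' k) (P' (Suc k)) \<and> good_move n (Q' k) (Q' (Suc k))" if "k < Suc m" for k
      using that PQ(3) w by (auto simp: P'_def Q'_def less_Suc_eq)
    ultimately show ?case using PQ(1,2,5)
      by (intro exI[of _ P'] exI[of _ Q']) (auto simp: P'_def Q'_def le_Suc_eq)
  qed
  from this[of n] obtain P Q where PQ: "P 0 = p" "Q 0 = q"
      "\<forall>k<n. good_move n (P k) (P (Suc k)) \<and> good_move n (Q k) (Q (Suc k))"
      "\<forall>k\<le>n. P k \<in> conf_box n c \<epsilon> \<and> Q k \<in> conf_box n c \<epsilon> \<and> noncollinear n (P k) \<and> noncollinear n (Q k)" "\<forall>i\<in>{1..n}. P n i = Q n i"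
    by auto
  have "P n i = Q n i" for i
    using PQ(5) PQ(4)[rule_format, of n] by (cases "i \<in> {1..n}") (auto simp: conf_box_def)
  then have PnQn: "P n = Q n" by auto
  define C where "C = (\<lambda>k. if k \<le> n then P k else Q (2 * n - k))"
  have "good_move n (C k) (C (Suc k))" if k: "k < 2 * n" for k
  proof (cases "k < n")
    case True then show ?thesis using PQ(3) by (simp add: C_def)
  next
    case False
    define l where "l = 2 * n - Suc k"
    have l: "l < n" "Suc l = 2 * n - k" using False k by (auto simp: l_def)
    have "C k = Q (Suc l)" "C (Suc k) = Q l"
      using False l PnQn by (auto simp: C_def l_def le_less)
    then show ?thesis using PQ(3) l(1) good_move_sym by auto
  qed
  then show ?thesis using PQ False
    by (intro exI[of _ C]) (auto simp: C_def)
qed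

lemma words_concat: "(\<And>w. w \<in> set ws \<Longrightarrow> w \<in> words S) \<Longrightarrow> concat ws \<in> words S"
  by (induction ws) auto

lemma potential_words: "potential n z \<in> words (generators n)"
  unfolding potential_def
proof (rule words_concat)
  fix w assume "w \<in> set (map (sweep n z) (sort_key (\<lambda>i. Re (z i)) [1..<Suc n]))"
  then obtain m where m: "m \<in> {1..n}" "w = sweep n z m" by (force simp del: upt_Suc)
  have "map (pair_letter m) l \<in> words (generators n)" if "set l \<subseteq> set (pairs_above n z m)" for l
    using that
  proof (induction l)
    case (Cons e l)
    then have "[pair_letter m e] \<in> words (generators n)"
      by (intro sweep_letter_in[OF m(1)]) (auto simp: set_pairs_above)
    then show ?case using Cons by auto
  qed simp
  then show "w \<in> words (generators n)" using m(2) by (simp add: sweep_def)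
qed

text \<open>One and the same word relates the potentials of \<open>p\<close> and \<open>q\<close> in all charts that contain the
  box: it is the word of a chain of good moves. This is how potentials in different charts are
  compared.\<close>

lemma connecting_word:
  assumes n: "3 \<le> n" and p: "p \<in> conf_box n c \<epsilon>" "noncollinear n p" and q: "q \<in> conf_box n c \<epsilon>" "noncollinear n q"
  shows "\<exists>w\<in>words (generators n). \<forall>u. (\<forall>z\<in>conf_box n c \<epsilon>. in_chart n u z) \<longrightarrow>
    cong3 n (chart_potential n u p @ w) (chart_potential n u q)"
proof -
  obtain C where C: "C 0 = p" "C (2 * n) = q" "\<forall>k<2 * n. good_move n (C k) (C (Suc k))" "\<forall>k\<le>2 * n. C k \<in> conf_box n c \<epsilon>"
    using good_chain[OF p q] by blast
  let ?w = "\<lambda>m. concat (map (\<lambda>k. path_word n (glide (C k) (C (Suc k))) 0 1) [0..<m])"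
  show ?thesis
  proof (cases "\<exists>u. \<forall>z\<in>conf_box n c \<epsilon>. in_chart n u z")
    case True
    have *: "cong3 n (chart_potential n u p @ ?w m) (chart_potential n u (C m))"
      if u: "\<forall>z\<in>conf_box n c \<epsilon>. in_chart n u z" and m: "m \<le> 2 * n" for u m
      using m
    proof (induction m)
      case 0
      show ?case by (simp add: C(1) chart_potential_def potential_words word_cong.refl)
    next
      case (Suc m)
      have "cong3 n (chart_potential n u (glide (C m) (C (Suc m)) 0) @ path_word n (glide (C m) (C (Suc m))) 0 1)
          (chart_potential n u (glide (C m) (C (Suc m)) 1))"
        using Suc.prems C u by (intro chart_potential_path[OF n] regular_glide) (auto intro!: bspec[OF u] glide_in_box)
      then have 1: "cong3 n (chart_potential n u (C m) @ path_word n (glide (C m) (C (Suc m))) 0 1) (chart_potential n u (C (Suc m)))"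
        by simp
      have "cong3 n ((chart_potential n u p @ ?w m) @ path_word n (glide (C m) (C (Suc m))) 0 1)
         (chart_potential n u (C m) @ path_word n (glide (C m) (C (Suc m))) 0 1)"
        using Suc word_cong_words[OF 1] by (intro word_cong_right) auto
      from word_cong.trans[OF this 1] show ?case by simp
    qed
    from True obtain u where u: "\<forall>z\<in>conf_box n c \<epsilon>. in_chart n u z" by blast
    have "?w (2 * n) \<in> words (generators n)"
      using word_cong_words[OF *[OF u order.refl]] by simp
    then show ?thesis
    proof (intro bexI[of _ "?w (2 * n)"] allI impI)
      fix u assume "\<forall>z\<in>conf_box n c \<epsilon>. in_chart n u z"
      from *[OF this order.refl] show "cong3 n (chart_potential n u p @ ?w (2 * n)) (chart_potential n u q)"
        unfolding C(2) .
    qed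
  qed (auto intro!: bexI[of _ "[]"])
qed

section \<open>A smooth step function\<close>

text \<open>The functions \<open>p(x) q(x)\<^sup>-\<^sup>m exp(-1/q(x))\<close> with \<open>q(x) = x (1 - x)\<close>, extended by zero. This
  family is closed under differentiation, which yields all derivatives of \<open>exp(-1/q(x))\<close> at
  once.\<close>

definition pre_bump :: "real poly \<Rightarrow> nat \<Rightarrow> real \<Rightarrow> real" where
  "pre_bump p m x = (if 0 < x \<and> x < 1 then poly p x / (x * (1 - x)) ^ m * exp (- 1 / (x * (1 - x))) else 0)"

definition pre_bump_deriv :: "real poly \<times> nat \<Rightarrow> real poly \<times> nat" where
  "pre_bump_deriv = (\<lambda>(p, m). (pderiv p * [:0, 1, -1:]\<^sup>2 - of_nat m * p * [:0, 1, -1:] * [:1, -2:] + p * [:1, -2:], m + 2))"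

text \<open>From \<open>(1 + y/k)\<^sup>k \<le> exp y\<close> with \<open>k = m + 2\<close> and \<open>y = 1/q\<close> it follows that \<open>exp(-1/q)\<close> is at
  most a constant times \<open>q\<^sup>m\<^sup>+\<^sup>2\<close>.\<close>

lemma pre_bump_bound:
  "\<exists>C\<ge>0. \<forall>x. \<bar>pre_bump p m x\<bar> \<le> C * (x * (1 - x))\<^sup>2"
proof -
  have "bounded (poly p ` {0..1})"
    by (intro compact_imp_bounded compact_continuous_image continuous_intros) auto
  then obtain B where "0 < B" "\<forall>y\<in>poly p ` {0..1}. norm y \<le> B" unfolding bounded_pos by blast
  then have B: "\<And>x. x \<in> {0..1} \<Longrightarrow> \<bar>poly p x\<bar> \<le> B" "0 < B" by auto
  let ?k = "m + 2"
  have "\<bar>pre_bump p m x\<bar> \<le> B * real ?k ^ ?k * (x * (1 - x))\<^sup>2" for x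
  proof (cases "0 < x \<and> x < 1")
    case True
    define q where "q = x * (1 - x)"
    have q: "0 < q" using True by (simp add: q_def)
    have "(1 / (q * real ?k)) ^ ?k \<le> (1 + (1 / q) / real ?k) ^ ?k"
      using q by (intro power_mono) (auto simp: field_simps)
    also have "\<dots> \<le> exp (1 / q)"
    proof (rule exp_ge_one_plus_x_over_n_power_n)
      have "0 < 1 / q" using q by simp
      then show "- real ?k \<le> 1 / q" by linarith
    qed simp
    finally have "1 / (q ^ ?k * real ?k ^ ?k) \<le> exp (1 / q)" by (simp only: power_divide power_mult_distrib power_one)
    then have "1 \<le> exp (1 / q) * (q ^ ?k * real ?k ^ ?k)" using q by (subst (asm) pos_divide_le_eq) auto
    then have "exp (- 1 / q) * 1 \<le> exp (- 1 / q) * (exp (1 / q) * (q ^ ?k * real ?k ^ ?k))"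
      by (intro mult_left_mono) auto
    also have "\<dots> = q ^ ?k * real ?k ^ ?k" by (simp add: mult.assoc[symmetric] exp_add[symmetric])
    finally have e: "exp (- 1 / q) \<le> q ^ ?k * real ?k ^ ?k" by simp
    have "\<bar>pre_bump p m x\<bar> = \<bar>poly p x\<bar> * exp (- 1 / q) / q ^ m"
      using True q by (simp add: pre_bump_def q_def[symmetric] abs_mult)
    also have "\<dots> \<le> B * (q ^ ?k * real ?k ^ ?k) / q ^ m"
      using B(1)[of x] True e q B(2) by (intro divide_right_mono mult_mono) auto
    also have "\<dots> = B * real ?k ^ ?k * q\<^sup>2"
    proof -
      have "B * (q ^ m * q\<^sup>2 * K) / q ^ m = B * K * q\<^sup>2" for K using q by simp
      then show ?thesis by (simp only: power_add)
    qed
    finally show ?thesis by (simp add: q_def)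
  next
    case False
    then have "pre_bump p m x = 0" by (auto simp: pre_bump_def)
    then show ?thesis using B(2) by (auto intro!: mult_nonneg_nonneg)
  qed
  then show ?thesis using B(2) by (intro exI[of _ "B * real ?k ^ ?k"]) auto
qed

lemma derivative_zero_if_quadratic:
  assumes "\<And>x. \<bar>f x\<bar> \<le> C * (x - x0)\<^sup>2" and "0 < r" "\<bar>0::real\<bar> \<le> C"
  shows "(f has_real_derivative 0) (at x0)"
proof -
  have f0: "f x0 = 0" using assms(1)[of x0] by simp
  have "((\<lambda>x. (f x - f x0) / (x - x0)) \<longlongrightarrow> 0) (at x0)"
  proof (rule Lim_null_comparison)
    show "\<forall>\<^sub>F x in at x0. norm ((f x - f x0) / (x - x0)) \<le> C * \<bar>x - x0\<bar>"
      unfolding eventually_at_filter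
    proof (intro always_eventually allI impI)
      fix x assume "x \<noteq> x0"
      then show "norm ((f x - f x0) / (x - x0)) \<le> C * \<bar>x - x0\<bar>"
        using assms(1)[of x] by (simp add: f0 pos_divide_le_eq power2_eq_square abs_mult_self_eq mult.assoc)
    qed
    have "((\<lambda>x. C * \<bar>x - x0\<bar>) \<longlongrightarrow> C * \<bar>x0 - x0\<bar>) (at x0)" by (intro tendsto_intros)
    then show "((\<lambda>x. C * \<bar>x - x0\<bar>) \<longlongrightarrow> 0) (at x0)" by simp
  qed
  then show ?thesis by (simp add: has_field_derivative_iff)
qed

lemma pre_bump_has_derivative:
  "(pre_bump p m has_real_derivative pre_bump (fst (pre_bump_deriv (p, m))) (snd (pre_bump_deriv (p, m))) x) (at x)"
proof -
  consider "0 < x \<and> x < 1" | "x < 0 \<or> 1 < x" | "x = 0 \<or> x = 1" by linarith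
  then show ?thesis
  proof cases
    case 1
    define q where "q = (\<lambda>x::real. x * (1 - x))"
    have q: "0 < q x" using 1 by (simp add: q_def)
    have dq: "(q has_real_derivative 1 - 2 * x) (at x)"
      unfolding q_def by (auto intro!: derivative_eq_intros)
    have "((\<lambda>x. poly p x / q x ^ m * exp (- 1 / q x)) has_real_derivative
       pre_bump (fst (pre_bump_deriv (p, m))) (snd (pre_bump_deriv (p, m))) x) (at x)"
    proof -
      have m: "real m * (1 - 2 * x) * q x ^ (m - Suc 0) * q x = real m * (1 - 2 * x) * q x ^ m"
        by (cases m) auto
      have "((\<lambda>x. poly p x / q x ^ m * exp (- 1 / q x)) has_real_derivative
        (poly (pderiv p) x * q x ^ m - poly p x * (real m * (1 - 2 * x) * q x ^ (m - Suc 0))) / (q x ^ m * q x ^ m) * exp (- 1 / q x)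
         + exp (- 1 / q x) * ((1 - 2 * x) / (q x * q x)) * (poly p x / q x ^ m)) (at x)"
      proof -
        have 1: "((\<lambda>x. poly p x / q x ^ m) has_real_derivative
          (poly (pderiv p) x * q x ^ m - poly p x * (real m * (1 - 2 * x) * q x ^ (m - Suc 0))) / (q x ^ m * q x ^ m)) (at x)"
          using DERIV_divide[OF poly_DERIV DERIV_power[OF dq]] q by (simp add: mult.assoc)
        have "((\<lambda>x. - 1 / q x) has_real_derivative (1 - 2 * x) / (q x * q x)) (at x)"
          using DERIV_divide[OF DERIV_const dq, of "- 1"] q by simp
        then have 2: "((\<lambda>x. exp (- 1 / q x)) has_real_derivative exp (- 1 / q x) * ((1 - 2 * x) / (q x * q x))) (at x)"
          by (rule DERIV_fun_exp)
        show ?thesis by (rule DERIV_mult[OF 1 2])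
      qed
      moreover have "(poly (pderiv p) x * q x ^ m - poly p x * (real m * (1 - 2 * x) * q x ^ (m - Suc 0))) / (q x ^ m * q x ^ m) * exp (- 1 / q x)
         + exp (- 1 / q x) * ((1 - 2 * x) / (q x * q x)) * (poly p x / q x ^ m) =
         pre_bump (fst (pre_bump_deriv (p, m))) (snd (pre_bump_deriv (p, m))) x"
      proof -
        have pq: "poly (fst (pre_bump_deriv (p, m))) x =
            poly (pderiv p) x * (q x)\<^sup>2 - real m * poly p x * q x * (1 - 2 * x) + poly p x * (1 - 2 * x)"
          by (simp add: pre_bump_deriv_def q_def of_nat_poly algebra_simps power2_eq_square)
        have *: "(A * Q - P * M) / (Q * Q) * E + E * (D / (r * r)) * (P / Q) =
           (A * r\<^sup>2 - m * P * r * D + P * D) / (Q * r\<^sup>2) * E"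
          if "M * r = m * D * Q" "Q \<noteq> 0" "r \<noteq> 0" for A Q P M E D r m :: real
        proof -
          have M: "M = m * D * Q / r" using that by (simp add: field_simps)
          show ?thesis unfolding M using that(2,3) by (simp add: field_simps power2_eq_square)
        qed
        have "snd (pre_bump_deriv (p, m)) = m + 2" by (simp add: pre_bump_deriv_def)
        moreover have "pre_bump P (m + 2) x = poly P x / (q x ^ m * (q x)\<^sup>2) * exp (- 1 / q x)" for P
          using 1 by (simp only: pre_bump_def q_def power_add if_True simp_thms)
        ultimately show ?thesis
          using *[OF m, of "poly (pderiv p) x" "poly p x" "exp (- 1 / q x)"] q pq by simp
      qed
      ultimately show ?thesis by simp
    qed
    then show ?thesis
      by (rule has_field_derivative_transform_within_open[where S = "{0<..<1}"])
        (use 1 in \<open>auto simp: pre_bump_def q_def\<close>)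
  next
    case 2
    then have z: "pre_bump (fst (pre_bump_deriv (p, m))) (snd (pre_bump_deriv (p, m))) x = 0"
      by (auto simp: pre_bump_def)
    have "(pre_bump p m has_real_derivative 0) (at x)"
    proof (rule has_field_derivative_transform_within_open[where f = "\<lambda>_. 0" and S = "- {0..1}"])
      show "x \<in> - {0..1}" using 2 by auto
    qed (auto simp: pre_bump_def)
    then show ?thesis using z by simp
  next
    case 3
    then have z: "pre_bump (fst (pre_bump_deriv (p, m))) (snd (pre_bump_deriv (p, m))) x = 0"
      by (auto simp: pre_bump_def)
    obtain C where C: "0 \<le> C" "\<And>y. \<bar>pre_bump p m y\<bar> \<le> C * (y * (1 - y))\<^sup>2"
      using pre_bump_bound[of p m] by blast
    have "\<bar>pre_bump p m y\<bar> \<le> C * (y - x)\<^sup>2" for y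
    proof (cases "0 < y \<and> y < 1")
      case True
      then have "y * (1 - y) \<le> y * 1" "y * (1 - y) \<le> 1 * (1 - y)" by (intro mult_left_mono mult_right_mono; simp)+
      then have "\<bar>y * (1 - y)\<bar> \<le> \<bar>y - x\<bar>" using 3 True by auto
      then have "(y * (1 - y))\<^sup>2 \<le> (y - x)\<^sup>2" by (simp add: abs_le_square_iff)
      then have "C * (y * (1 - y))\<^sup>2 \<le> C * (y - x)\<^sup>2" using C(1) by (rule mult_left_mono)
      then show ?thesis using C(2)[of y] by linarith
    next
      case False
      then have "pre_bump p m y = 0" by (auto simp: pre_bump_def)
      then show ?thesis using C(1) by simp
    qed
    then have "(pre_bump p m has_real_derivative 0) (at x)"
      by (rule derivative_zero_if_quadratic[where C = C and r = 1]) (use C in auto)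
    then show ?thesis using z by simp
  qed
qed

text \<open>A normalized antiderivative of \<open>exp(-1/(x (1 - x)))\<close>. It is constant outside the unit
  interval, so that smooth pieces can be added up without matching derivatives.\<close>

lemma smooth_step_exists:
  "\<exists>F :: nat \<Rightarrow> real \<Rightarrow> real. (\<forall>k x. (F k has_real_derivative F (Suc k) x) (at x)) \<and>
     (\<forall>x\<le>0. F 0 x = 0) \<and> (\<forall>x\<ge>1. F 0 x = 1) \<and> (\<forall>x. 0 < x \<and> x < 1 \<longrightarrow> 0 < F 1 x)"
proof -
  define pm where "pm = (\<lambda>k. (pre_bump_deriv ^^ k) ([:1:], 0))"
  define R where "R = (\<lambda>k. pre_bump (fst (pm k)) (snd (pm k)))"
  have R: "(R k has_real_derivative R (Suc k) x) (at x)" for k x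
    using pre_bump_has_derivative[of "fst (pm k)" "snd (pm k)" x] by (simp add: R_def pm_def)
  have R0: "R 0 x = 0" if "x \<le> 0 \<or> 1 \<le> x" for x using that by (auto simp: R_def pre_bump_def)
  have Rpos: "0 < R 0 x" if "0 < x" "x < 1" for x using that by (simp add: R_def pm_def pre_bump_def)
  have "continuous_on {-1..2} (R 0)" using R by (meson DERIV_continuous continuous_at_imp_continuous_on)
  then obtain G where G: "\<And>x. x \<in> {-1..2} \<Longrightarrow> (G has_vector_derivative R 0 x) (at x within {-1..2})"
    using antiderivative_continuous by blast
  have G': "(G has_real_derivative R 0 x) (at x)" if "-1 < x" "x < 2" for x
    using G[of x] that at_within_Icc_at[of "-1" x 2] by (simp add: has_real_derivative_iff_has_vector_derivative)
  have contG: "continuous_on {x..y} G" if "-1 < x" "y < 2" for x y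
  proof (rule continuous_at_imp_continuous_on, rule ballI)
    fix t assume "t \<in> {x..y}"
    then show "isCont G t" using that by (intro DERIV_isCont[OF G']) auto
  qed
  have inc: "G x < G y" if "0 \<le> x" "x < y" "y \<le> 1" for x y
  proof (rule DERIV_pos_imp_increasing_open[OF that(2)])
    show "\<exists>z. (G has_real_derivative z) (at t) \<and> 0 < z" if "x < t" "t < y" for t
      using G'[of t] Rpos[of t] that \<open>0 \<le> x\<close> \<open>y \<le> 1\<close> by auto
    show "continuous_on {x..y} G" by (rule contG) (use that in auto)
  qed
  have const: "G x = G y" if "-1 < x" "x \<le> y" "y < 2" "y \<le> 0 \<or> 1 \<le> x" for x y
  proof (cases "x = y")
    case False
    then have "x < y" using that by simp
    have "\<exists>l z. x < z \<and> z < y \<and> (G has_real_derivative l) (at z) \<and> G y - G x = (y - x) * l"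
    proof (rule MVT[OF \<open>x < y\<close>])
      show "continuous_on {x..y} G" by (rule contG) (use that in auto)
      show "G differentiable at t" if "x < t" "t < y" for t
        using G'[of t] that \<open>- 1 < x\<close> \<open>y < 2\<close> by (meson less_trans order.strict_trans real_differentiable_def)
    qed
    then obtain l z where z: "x < z" "z < y" "(G has_real_derivative l) (at z)" "G y - G x = (y - x) * l" by blast
    have "l = R 0 z" using DERIV_unique[OF z(3) G'[of z]] z that by auto
    also have "R 0 z = 0" using R0[of z] z that by auto
    finally show ?thesis using z(4) by simp
  qed simp
  define c where "c = G 1 - G 0"
  have c: "0 < c" using inc[of 0 1] by (simp add: c_def)
  define S where "S = (\<lambda>x. if x \<le> 0 then 0 else if 1 \<le> x then 1 else (G x - G 0) / c)"
  have S_eq: "S x = (G x - G 0) / c" if "-1 < x" "x < 2" for x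
    using const[of x 0] const[of 1 x] that c by (auto simp: S_def c_def)
  define F where "F = (\<lambda>k. case k of 0 \<Rightarrow> S | Suc k \<Rightarrow> (\<lambda>x. R k x / c))"
  have "(F k has_real_derivative F (Suc k) x) (at x)" for k x
  proof (cases k)
    case (Suc l) then show ?thesis using R[of l x] c by (auto simp: F_def intro!: derivative_eq_intros)
  next
    case 0
    consider "-1 < x \<and> x < 2" | "x < 0" | "1 < x" by linarith
    then have "(S has_real_derivative R 0 x / c) (at x)"
    proof cases
      case 1
      have "((\<lambda>x. (G x - G 0) / c) has_real_derivative R 0 x / c) (at x)"
        using G'[of x] 1 c by (auto intro!: derivative_eq_intros)
      then show ?thesis
        by (rule has_field_derivative_transform_within_open[where S = "{-1<..<2}"]) (use 1 S_eq in auto)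
    next
      case 2
      have "(S has_real_derivative 0) (at x)"
        by (rule has_field_derivative_transform_within_open[where f = "\<lambda>_. 0" and S = "{..<0}"]) (use 2 in \<open>auto simp: S_def\<close>)
      then show ?thesis using R0[of x] 2 by simp
    next
      case 3
      have "(S has_real_derivative 0) (at x)"
        by (rule has_field_derivative_transform_within_open[where f = "\<lambda>_. 1" and S = "{1<..}"]) (use 3 in \<open>auto simp: S_def\<close>)
      then show ?thesis using R0[of x] 3 by simp
    qed
    then show ?thesis using 0 by (simp add: F_def)
  qed
  moreover have "F 0 x = 0" if "x \<le> 0" for x using that by (simp add: F_def S_def)
  moreover have "F 0 x = 1" if "1 \<le> x" for x using that by (simp add: F_def S_def)
  moreover have "0 < F 1 x" if "0 < x \<and> x < 1" for x using that c Rpos by (simp add: F_def)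
  ultimately show ?thesis by blast
qed

definition step_derivs :: "nat \<Rightarrow> real \<Rightarrow> real" where
  "step_derivs = (SOME F. (\<forall>k x. (F k has_real_derivative F (Suc k) x) (at x)) \<and>
     (\<forall>x\<le>0. F 0 x = 0) \<and> (\<forall>x\<ge>1. F 0 x = 1) \<and> (\<forall>x. 0 < x \<and> x < 1 \<longrightarrow> 0 < F 1 x))"

abbreviation smooth_step :: "real \<Rightarrow> real" where "smooth_step \<equiv> step_derivs 0"

lemma step_derivs: "(step_derivs k has_real_derivative step_derivs (Suc k) x) (at x)"
  and smooth_step_0 [simp]: "x \<le> 0 \<Longrightarrow> smooth_step x = 0"
  and smooth_step_1 [simp]: "1 \<le> x \<Longrightarrow> smooth_step x = 1"
  and smooth_step_deriv_pos: "0 < x \<Longrightarrow> x < 1 \<Longrightarrow> 0 < step_derivs 1 x"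
  using someI_ex[OF smooth_step_exists, folded step_derivs_def] by blast+

lemma smooth_step_strict_mono:
  assumes "0 \<le> x" "x < y" "y \<le> 1"
  shows "smooth_step x < smooth_step y"
proof (rule DERIV_pos_imp_increasing_open[OF assms(2)])
  show "\<exists>z. (smooth_step has_real_derivative z) (at t) \<and> 0 < z" if "x < t" "t < y" for t
    using step_derivs[of 0 t] smooth_step_deriv_pos[of t] that assms by auto
  show "continuous_on {x..y} smooth_step"
    using step_derivs by (meson DERIV_continuous continuous_at_imp_continuous_on)
qed

lemma smooth_step_range: "smooth_step x \<in> {0..1}"
proof (cases "0 < x \<and> x < 1")
  case True
  then show ?thesis using smooth_step_strict_mono[of 0 x] smooth_step_strict_mono[of x 1] by auto
qed auto

text \<open>Smoothness on the whole line, with the sequence of derivatives as a witness.\<close>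

definition smooth_line :: "(real \<Rightarrow> complex) \<Rightarrow> bool" where
  "smooth_line g \<longleftrightarrow> (\<exists>F. F 0 = g \<and> (\<forall>k x. (F k has_vector_derivative F (Suc k) x) (at x)))"

lemma smooth_line_step: "smooth_line (\<lambda>t. smooth_step (a * t + b) *\<^sub>R c)"
proof -
  define F where "F = (\<lambda>k t. (a ^ k * step_derivs k (a * t + b)) *\<^sub>R c)"
  have "(F k has_vector_derivative F (Suc k) x) (at x)" for k x
  proof -
    have "((\<lambda>t. step_derivs k (a * t + b)) has_real_derivative step_derivs (Suc k) (a * x + b) * a) (at x)"
      by (rule DERIV_chain'[OF _ step_derivs]) (auto intro!: derivative_eq_intros)
    then have "((\<lambda>t. a ^ k * step_derivs k (a * t + b)) has_real_derivative a ^ k * (step_derivs (Suc k) (a * x + b) * a)) (at x)"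
      by (rule DERIV_cmult)
    then have "(F k has_vector_derivative (a ^ k * (step_derivs (Suc k) (a * x + b) * a)) *\<^sub>R c) (at x)"
      unfolding F_def by (intro has_vector_derivative_scaleR[THEN has_vector_derivative_eq_rhs]) (auto intro!: derivative_eq_intros)
    then show ?thesis by (simp add: F_def mult_ac)
  qed
  then show ?thesis unfolding smooth_line_def by (intro exI[of _ F]) (auto simp: F_def)
qed

lemma smooth_line_const: "smooth_line (\<lambda>t. c)"
  unfolding smooth_line_def
  by (rule exI[of _ "\<lambda>k t. if k = 0 then c else 0"]) (auto intro!: derivative_eq_intros)

lemma smooth_line_add: "smooth_line f \<Longrightarrow> smooth_line g \<Longrightarrow> smooth_line (\<lambda>t. f t + g t)"
  unfolding smooth_line_def
proof (elim exE conjE)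
  fix F G assume "F 0 = f" "G 0 = g" "\<forall>k x. (F k has_vector_derivative F (Suc k) x) (at x)"
    "\<forall>k x. (G k has_vector_derivative G (Suc k) x) (at x)"
  then show "\<exists>H. H 0 = (\<lambda>t. f t + g t) \<and> (\<forall>k x. (H k has_vector_derivative H (Suc k) x) (at x))"
    by (intro exI[of _ "\<lambda>k t. F k t + G k t"]) (auto intro!: has_vector_derivative_add)
qed

lemma smooth_line_sum: "(\<And>k. k \<in> A \<Longrightarrow> smooth_line (f k)) \<Longrightarrow> smooth_line (\<lambda>t. \<Sum>k\<in>A. f k t)"
  by (induction A rule: infinite_finite_induct) (auto intro: smooth_line_const smooth_line_add)

lemma smooth_line_affine: "smooth_line g \<Longrightarrow> smooth_line (\<lambda>t. g (a * t + b))"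
  unfolding smooth_line_def
proof (elim exE conjE)
  fix F assume F: "F 0 = g" "\<forall>k x. (F k has_vector_derivative F (Suc k) x) (at x)"
  have "((\<lambda>t. a ^ k *\<^sub>R F k (a * t + b)) has_vector_derivative a ^ Suc k *\<^sub>R F (Suc k) (a * x + b)) (at x)" for k x
  proof -
    have "((\<lambda>t. a * t + b) has_vector_derivative a) (at x)"
      by (auto intro!: derivative_eq_intros)
    from vector_diff_chain_at[OF this F(2)[rule_format]]
    have "((\<lambda>t. F k (a * t + b)) has_vector_derivative a *\<^sub>R F (Suc k) (a * x + b)) (at x)"
      by (simp add: o_def)
    then have "((\<lambda>t. a ^ k *\<^sub>R F k (a * t + b)) has_vector_derivative a ^ k *\<^sub>R (a *\<^sub>R F (Suc k) (a * x + b))) (at x)"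
      by (intro derivative_eq_intros) auto
    then show ?thesis by (simp add: mult_ac)
  qed
  then show "\<exists>H. H 0 = (\<lambda>t. g (a * t + b)) \<and> (\<forall>k x. (H k has_vector_derivative H (Suc k) x) (at x))"
    using F(1) by (intro exI[of _ "\<lambda>k t. a ^ k *\<^sub>R F k (a * t + b)"]) auto
qed

text \<open>The sequence \<open>F\<close> consists of the iterated derivatives of \<open>g\<close> on the unit interval. In this
  form smoothness is compatible with linear combinations.\<close>

definition derivs01 :: "(nat \<Rightarrow> real \<Rightarrow> complex) \<Rightarrow> (real \<Rightarrow> complex) \<Rightarrow> bool" where
  "derivs01 F g \<longleftrightarrow> (\<forall>t\<in>{0..1}. F 0 t = g t) \<and>
     (\<forall>k. \<forall>t\<in>{0..1}. (F k has_vector_derivative F (Suc k) t) (at t within {0..1}))"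

lemma deriv01_eq:
  assumes "derivs01 F g" "t \<in> {0..1}"
  shows "deriv01 k g t = F k t"
  using assms(2)
proof (induction k arbitrary: t)
  case 0 then show ?case using assms(1) by (simp add: deriv01_def derivs01_def)
next
  case (Suc k)
  have "(deriv01 k g has_vector_derivative F (Suc k) t) (at t within {0..1})"
    by (rule has_vector_derivative_transform[OF Suc.prems Suc.IH]) (use assms(1) Suc.prems in \<open>auto simp: derivs01_def\<close>)
  then have "vector_derivative (deriv01 k g) (at t within {0..1}) = F (Suc k) t"
    by (intro vector_derivative_within_closed_interval) (use Suc.prems in auto)
  then show ?case by (simp add: deriv01_def)
qed

lemma smooth01_derivs01: "smooth01 g \<Longrightarrow> derivs01 (\<lambda>k. deriv01 k g) g"
  unfolding derivs01_def
proof (intro conjI ballI allI)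
  fix k t assume s: "smooth01 g" and t: "t \<in> {0..1::real}"
  show "(deriv01 k g has_vector_derivative deriv01 (Suc k) g t) (at t within {0..1})"
    using s t unfolding smooth01_def differentiable_on_def
    by (simp add: deriv01_def vector_derivative_works)
qed (simp add: deriv01_def)

lemma derivs01_smooth01: "derivs01 F g \<Longrightarrow> smooth01 g"
  unfolding smooth01_def differentiable_on_def
proof (intro allI ballI)
  fix k t assume F: "derivs01 F g" and t: "t \<in> {0..1::real}"
  have "(deriv01 k g has_vector_derivative F (Suc k) t) (at t within {0..1})"
    by (rule has_vector_derivative_transform[OF t deriv01_eq[OF F]]) (use F t in \<open>auto simp: derivs01_def\<close>)
  then show "deriv01 k g differentiable at t within {0..1}" by (rule differentiableI_vector)
qed

lemma smooth01_iff: "smooth01 g \<longleftrightarrow> (\<exists>F. derivs01 F g)"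
  using smooth01_derivs01 derivs01_smooth01 by blast

lemma derivs01_lincomb: "derivs01 F f \<Longrightarrow> derivs01 G g \<Longrightarrow> derivs01 (\<lambda>k t. a *\<^sub>R F k t + b *\<^sub>R G k t) (\<lambda>t. a *\<^sub>R f t + b *\<^sub>R g t)"
  unfolding derivs01_def by (auto intro!: has_vector_derivative_add has_vector_derivative_scaleR[THEN has_vector_derivative_eq_rhs] derivative_eq_intros)

lemma smooth01_lincomb: "smooth01 f \<Longrightarrow> smooth01 g \<Longrightarrow> smooth01 (\<lambda>t. a *\<^sub>R f t + b *\<^sub>R g t)"
  using derivs01_lincomb unfolding smooth01_iff by blast

lemma smooth_line_smooth01:
  assumes "smooth_line g" "\<And>t. t \<in> {0..1} \<Longrightarrow> f t = g t"
  shows "smooth01 f"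
proof -
  obtain F where F: "F 0 = g" "\<forall>k x. (F k has_vector_derivative F (Suc k) x) (at x)"
    using assms(1) unfolding smooth_line_def by blast
  have "derivs01 F f"
    using F assms(2) unfolding derivs01_def by (auto intro: has_vector_derivative_at_within)
  then show ?thesis by (rule derivs01_smooth01)
qed

lemma smooth01_continuous: "smooth01 g \<Longrightarrow> continuous_on {0..1} g"
  unfolding smooth01_def by (metis deriv01_def differentiable_imp_continuous_on funpow_0)

section \<open>Smooth polygons\<close>

lemma crosses_if_derivative:
  assumes "(f has_real_derivative D) (at t)" "D \<noteq> 0" "f t = 0"
  shows "crosses f t"
proof -
  have main: "crosses g t" if g: "(g has_real_derivative E) (at t)" "0 < E" "g t = 0" for g E
  proof -
    obtain d1 where d1: "0 < d1" "\<And>h. 0 < h \<Longrightarrow> h < d1 \<Longrightarrow> g t < g (t + h)"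
      using DERIV_pos_inc_right[OF g(1,2)] by blast
    obtain d2 where d2: "0 < d2" "\<And>h. 0 < h \<Longrightarrow> h < d2 \<Longrightarrow> g (t - h) < g t"
      using DERIV_pos_inc_left[OF g(1,2)] by blast
    show ?thesis unfolding crosses_def
    proof (intro exI[of _ "min d1 d2"] conjI allI impI)
      fix s s' assume s: "t - min d1 d2 < s \<and> s < t \<and> t < s' \<and> s' < t + min d1 d2"
      then have "t - d2 < s" "s < t" "t < s'" "s' < t + d1" by auto
      then have "0 < g s'" "g s < 0" using d1(2)[of "s' - t"] d2(2)[of "t - s"] g(3) by auto
      then have "0 < g s'" by simp
      moreover have "g s < 0" by fact
      ultimately show "g s * g s' < 0" by (simp add: mult_neg_pos)
    qed (use d1 d2 in auto)
  qed
  show ?thesis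
  proof (cases "0 < D")
    case True then show ?thesis using main assms by blast
  next
    case False
    then have "crosses (\<lambda>x. - f x) t"
      using assms by (intro main[where E = "- D"] DERIV_minus) auto
    then show ?thesis by (simp add: crosses_def)
  qed
qed

text \<open>At the times in \<open>[k/M, (k+1)/M]\<close> only the \<open>k\<close>-th summand varies, and the configuration
  moves from \<open>P k\<close> to \<open>P (Suc k)\<close>, with all derivatives zero at the ends. As a sum of smooth
  functions on the whole line the polygon is smooth.\<close>

definition smooth_polygon :: "nat \<Rightarrow> (nat \<Rightarrow> nat \<Rightarrow> complex) \<Rightarrow> real \<Rightarrow> nat \<Rightarrow> complex" where
  "smooth_polygon M P t = (\<lambda>i. P 0 i + (\<Sum>k<M. smooth_step (real M * t - real k) *\<^sub>R (P (Suc k) i - P k i)))"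

lemma smooth_polygon_partial:
  assumes "k \<le> M" "real k \<le> real M * t" "real M * t \<le> real k + 1"
  shows "smooth_polygon M P t = (if k < M then glide (P k) (P (Suc k)) (smooth_step (real M * t - real k)) else P M)"
proof
  fix i
  let ?g = "\<lambda>j. smooth_step (real M * t - real j) *\<^sub>R (P (Suc j) i - P j i)"
  have low: "(\<Sum>j<l. ?g j) = P l i - P 0 i" if "l \<le> k" for l
    using that
  proof (induction l)
    case (Suc l)
    then have "smooth_step (real M * t - real l) = 1" using assms(2) by (intro smooth_step_1) linarith
    then show ?case using Suc by simp
  qed simp
  have high: "(\<Sum>j\<in>{Suc k..<M}. ?g j) = 0"
  proof (rule sum.neutral, rule ballI)
    fix j assume "j \<in> {Suc k..<M}"
    then have "real M * t - real j \<le> 0" using assms(3) by auto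
    then show "?g j = 0" by simp
  qed
  show "smooth_polygon M P t i = (if k < M then glide (P k) (P (Suc k)) (smooth_step (real M * t - real k)) else P M) i"
  proof (cases "k < M")
    case True
    then have "{..<M} = {..<k} \<union> ({k} \<union> {Suc k..<M})" by auto
    then have "(\<Sum>j<M. ?g j) = (\<Sum>j\<in>{..<k} \<union> ({k} \<union> {Suc k..<M}). ?g j)" by simp
    also have "\<dots> = (\<Sum>j<k. ?g j) + (?g k + (\<Sum>j\<in>{Suc k..<M}. ?g j))"
      by (subst sum.union_disjoint; (subst sum.union_disjoint)?; auto)
    finally have "(\<Sum>j<M. ?g j) = (P k i - P 0 i) + ?g k" using low[of k] high by simp
    then show ?thesis using True by (simp add: smooth_polygon_def glide_def algebra_simps)
  next
    case False
    then have "k = M" using assms(1) by simp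
    then show ?thesis using low[of M] by (simp add: smooth_polygon_def)
  qed
qed

lemma smooth_polygon_before: "t \<le> 0 \<Longrightarrow> smooth_polygon M P t = P 0"
proof
  fix i assume t: "t \<le> 0"
  have "real M * t - real k \<le> 0" for k using mult_nonneg_nonpos[of "real M" t] t by simp
  then show "smooth_polygon M P t i = P 0 i" by (simp add: smooth_polygon_def)
qed

lemma smooth_polygon_after:
  assumes "1 \<le> t" shows "smooth_polygon M P t = P M"
proof
  fix i
  have "smooth_step (real M * t - real k) = 1" if "k < M" for k
  proof -
    have "real M * 1 \<le> real M * t" using assms by (intro mult_left_mono) auto
    then show ?thesis using that by (intro smooth_step_1) linarith
  qed
  then have "smooth_polygon M P t i = P 0 i + (\<Sum>k<M. P (Suc k) i - P k i)" by (simp add: smooth_polygon_def)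
  also have "\<dots> = P M i" by (subst sum_lessThan_telescope) simp
  finally show "smooth_polygon M P t i = P M i" .
qed

lemma slot_exists:
  assumes "0 < M" "t \<in> {0..1}"
  shows "\<exists>k<M. real k \<le> real M * t \<and> real M * t \<le> real k + 1"
proof (cases "t = 1")
  case True
  then show ?thesis using assms by (intro exI[of _ "M - 1"]) (auto simp: of_nat_diff)
next
  case False
  then have "real M * t < real M * 1" using assms by (intro mult_strict_left_mono) auto
  moreover have "0 \<le> real M * t" using assms by simp
  ultimately have "real (nat \<lfloor>real M * t\<rfloor>) = of_int \<lfloor>real M * t\<rfloor>" by simp
  then have "real (nat \<lfloor>real M * t\<rfloor>) \<le> real M * t" "real M * t \<le> real (nat \<lfloor>real M * t\<rfloor>) + 1"
    using floor_correct[of "real M * t"] by linarith+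
  moreover have "nat \<lfloor>real M * t\<rfloor> < M"
    using calculation(1) \<open>real M * t < real M * 1\<close> by simp
  ultimately show ?thesis by blast
qed

lemma smooth_polygon_smooth: "smooth_line (\<lambda>t. smooth_polygon M P t i)"
  unfolding smooth_polygon_def
proof (intro smooth_line_add smooth_line_const smooth_line_sum)
  fix k show "smooth_line (\<lambda>t. smooth_step (real M * t - real k) *\<^sub>R (P (Suc k) i - P k i))"
    using smooth_line_step[of "real M" "- real k"] by simp
qed

text \<open>The crossings of smooth polygons are of this kind, and the condition survives small
  perturbations.\<close>

definition transversal :: "nat \<Rightarrow> (real \<Rightarrow> nat \<Rightarrow> complex) \<Rightarrow> bool" where
  "transversal n \<gamma> \<longleftrightarrow> (\<forall>t\<in>crit_in n \<gamma> 0 1. (\<exists>!T. collinear_triple n (\<gamma> t) T) \<and>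
     (\<forall>i j k. {i, j, k} \<subseteq> {1..n} \<and> distinct [i, j, k] \<and> orient (\<gamma> t) i j k = 0 \<longrightarrow>
       (\<exists>D. D \<noteq> 0 \<and> ((\<lambda>s. orient (\<gamma> s) i j k) has_real_derivative D) (at t))))"

lemma transversal_regular:
  assumes "transversal n \<gamma>" "\<forall>i\<in>{1..n}. continuous_on {0..1} (\<lambda>t. \<gamma> t i)" "noncollinear n (\<gamma> 0)" "noncollinear n (\<gamma> 1)"
  shows "regular n \<gamma> 0 1"
proof (rule regularI[OF assms(2)])
  fix t assume t: "t \<in> crit_in n \<gamma> 0 1"
  then obtain T where T: "collinear_triple n (\<gamma> t) T" by (auto simp: crit_in_def)
  then obtain i j k where ijk: "T = {i, j, k}" "{i, j, k} \<subseteq> {1..n}" "distinct [i, j, k]" "orient (\<gamma> t) i j k = 0"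
    unfolding collinear_triple_iff by blast
  have uniq: "\<exists>!T. collinear_triple n (\<gamma> t) T"
    and deriv: "\<forall>i j k. {i, j, k} \<subseteq> {1..n} \<and> distinct [i, j, k] \<and> orient (\<gamma> t) i j k = 0 \<longrightarrow>
       (\<exists>D. D \<noteq> 0 \<and> ((\<lambda>s. orient (\<gamma> s) i j k) has_real_derivative D) (at t))"
    using assms(1)[unfolded transversal_def, rule_format, OF t] by blast+
  have "\<forall>T'. collinear_triple n (\<gamma> t) T' \<longrightarrow> T' = {i, j, k}"
    using uniq T ijk(1) by blast
  moreover obtain D where "D \<noteq> 0" "((\<lambda>s. orient (\<gamma> s) i j k) has_real_derivative D) (at t)"
    using deriv ijk(2-4) by meson
  then have "crosses (\<lambda>s. orient (\<gamma> s) i j k) t" using ijk(4) by (intro crosses_if_derivative)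
  ultimately show "\<exists>i j k. {i, j, k} \<subseteq> {1..n} \<and> distinct [i, j, k] \<and>
       (\<forall>T. collinear_triple n (\<gamma> t) T \<longrightarrow> T = {i, j, k}) \<and> crosses (\<lambda>s. orient (\<gamma> s) i j k) t"
    using ijk(2,3) by blast
qed (use assms in auto)

text \<open>In each slot of time the orientations are affine functions of the smooth step, whose
  derivative is positive inside the slot; at the ends of a slot no three points are collinear.\<close>

lemma smooth_polygon_transversal:
  assumes "0 < M" and good: "\<forall>k<M. good_move n (P k) (P (Suc k))"
  shows "transversal n (smooth_polygon M P)"
  unfolding transversal_def
proof
  fix t assume t: "t \<in> crit_in n (smooth_polygon M P) 0 1"
  let ?g = "smooth_polygon M P"
  obtain k where k: "k < M" "real k \<le> real M * t" "real M * t \<le> real k + 1"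
    using slot_exists[OF assms(1), of t] t by (auto simp: crit_in_def)
  let ?\<sigma> = "\<lambda>s. smooth_step (real M * s - real k)"
  have g: "?g s = glide (P k) (P (Suc k)) (?\<sigma> s)" if "real k \<le> real M * s" "real M * s \<le> real k + 1" for s
    using smooth_polygon_partial[of k M s P] k(1) that by simp
  have gm: "good_move n (P k) (P (Suc k))" using good k(1) by blast
  have nc: "\<not> noncollinear n (?g t)" using t by (simp add: crit_in_iff)
  have "real M * t \<noteq> real k" using nc g[OF k(2,3)] gm by (auto simp: good_move_def)
  moreover have "real M * t \<noteq> real k + 1" using nc g[OF k(2,3)] gm by (auto simp: good_move_def)
  ultimately have strict: "real k < real M * t" "real M * t < real k + 1" using k by auto
  have uniq: "T = T'" if "collinear_triple n (?g t) T" "collinear_triple n (?g t) T'" for T T'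
  proof -
    have "?\<sigma> t \<in> {0..1}" by (rule smooth_step_range)
    then show ?thesis using gm that unfolding good_move_def g[OF k(2,3)] by blast
  qed
  have "\<exists>D. D \<noteq> 0 \<and> ((\<lambda>s. orient (?g s) i j l) has_real_derivative D) (at t)"
    if ijl: "{i, j, l} \<subseteq> {1..n}" "distinct [i, j, l]" "orient (?g t) i j l = 0" for i j l
  proof -
    obtain m where m: "\<forall>l. l \<noteq> m \<longrightarrow> P k l = P (Suc k) l" using gm unfolding good_move_def by (elim conjE exE) rule
    let ?A = "orient (P k) i j l" and ?B = "orient (P (Suc k)) i j l"
    have o: "orient (?g s) i j l = (1 - ?\<sigma> s) * ?A + ?\<sigma> s * ?B" if "real k \<le> real M * s" "real M * s \<le> real k + 1" for s
      unfolding g[OF that] by (rule orient_glide[OF m ijl(2)])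
    have "?A \<noteq> 0" using gm ijl(1,2) unfolding good_move_def noncollinear_def by auto
    then have "?B - ?A \<noteq> 0" using o[OF k(2,3)] ijl(3) by (auto simp: algebra_simps)
    let ?D = "(?B - ?A) * (step_derivs 1 (real M * t - real k) * real M)"
    have "((\<lambda>s. real M * s - real k) has_real_derivative real M) (at t)"
      by (auto intro!: derivative_eq_intros)
    from DERIV_chain'[OF this step_derivs[of 0]]
    have "(?\<sigma> has_real_derivative step_derivs 1 (real M * t - real k) * real M) (at t)" by simp
    then have "((\<lambda>s. (1 - ?\<sigma> s) * ?A + ?\<sigma> s * ?B) has_real_derivative ?D) (at t)"
      by (auto intro!: derivative_eq_intros simp: algebra_simps)
    then have "((\<lambda>s. orient (?g s) i j l) has_real_derivative ?D) (at t)"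
    proof (rule has_field_derivative_transform_within_open[where S = "{real k / real M <..< (real k + 1) / real M}"])
      show "t \<in> {real k / real M <..< (real k + 1) / real M}"
        using strict assms(1) by (auto simp: field_simps)
    qed (use assms(1) in \<open>auto simp: o field_simps\<close>)
    moreover have "?D \<noteq> 0"
      using \<open>?B - ?A \<noteq> 0\<close> smooth_step_deriv_pos[of "real M * t - real k"] strict assms(1) by auto
    ultimately show ?thesis by blast
  qed
  moreover have "\<exists>T. collinear_triple n (?g t) T" using nc by (simp add: noncollinear_iff)
  ultimately show "(\<exists>!T. collinear_triple n (?g t) T) \<and>
     (\<forall>i j k. {i, j, k} \<subseteq> {1..n} \<and> distinct [i, j, k] \<and> orient (?g t) i j k = 0 \<longrightarrow>
       (\<exists>D. D \<noteq> 0 \<and> ((\<lambda>s. orient (?g s) i j k) has_real_derivative D) (at t)))"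
    using uniq by blast
qed

lemma base_inj: "inj_on (base n) {1..n}"
proof (rule inj_onI, rule ccontr)
  fix l m assume lm: "l \<in> {1..n}" "m \<in> {1..n}" "base n l = base n m" "l \<noteq> m"
  then have "l mod n = m mod n"
    using complex_root_unity_eq[of n l m] by (simp add: base_def)
  then show False using lm by (metis atLeastAtMost_iff le_neq_implies_less mod_less mod_self not_one_le_zero)
qed

text \<open>A line meets the unit circle in at most two points: \<open>\<bar>a + c v\<bar>\<^sup>2 = 1\<close> is a quadratic
  equation for \<open>c\<close>, with the solutions \<open>0\<close> and \<open>1\<close> if \<open>a\<close> and \<open>a + v\<close> are on the circle.\<close>

lemma base_noncollinear: "noncollinear n (base n)"
  unfolding noncollinear_def
proof (intro ballI impI)
  fix i j k assume ijk: "i \<in> {1..n}" "j \<in> {1..n}" "k \<in> {1..n}" and d: "distinct [i, j, k]"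
  have unit: "norm (base n l) = 1" if "l \<in> {1..n}" for l
    using that norm_exp_i_times[of "2 * pi * real l / real n"] by (simp add: base_def mult_ac)
  have inj: "base n l \<noteq> base n m" if "l \<in> {1..n}" "m \<in> {1..n}" "l \<noteq> m" for l m
    using inj_onD[OF base_inj] that by metis
  show "orient (base n) i j k \<noteq> 0"
  proof
    assume "orient (base n) i j k = 0"
    then have "collinear {base n j, base n i, base n k}" using collinear_iff_orient[of "base n" i j k] by (simp add: insert_commute)
    then have "collinear {0, base n j - base n i, base n k - base n i}" 
      using collinear_3[of "base n j" "base n i" "base n k"] by simp
    moreover have "base n j - base n i \<noteq> 0" using inj ijk d by auto
    ultimately obtain c where c: "base n k - base n i = c *\<^sub>R (base n j - base n i)"
      by (auto simp: collinear_lemma)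
    define a v where "a = base n i" and "v = base n j - base n i"
    have bk: "base n k = a + c *\<^sub>R v" and bj: "base n j = a + v" using c by (auto simp: a_def v_def algebra_simps)
    have sq: "(norm (a + s *\<^sub>R v))\<^sup>2 = (norm a)\<^sup>2 + 2 * s * (a \<bullet> v) + s\<^sup>2 * (norm v)\<^sup>2" for s
      unfolding power2_norm_eq_inner by (simp add: inner_add_left inner_add_right inner_commute power2_eq_square algebra_simps)
    have na: "(norm a)\<^sup>2 = 1" using unit ijk by (simp add: a_def)
    have "(norm (a + 1 *\<^sub>R v))\<^sup>2 = 1" using unit[OF ijk(2)] unfolding bj by simp
    then have 1: "2 * (a \<bullet> v) = - (norm v)\<^sup>2" using sq[of 1] na by simp
    have "(norm (a + c *\<^sub>R v))\<^sup>2 = 1" using unit[OF ijk(3)] unfolding bk by simp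
    then have "c * (2 * (a \<bullet> v)) + c\<^sup>2 * (norm v)\<^sup>2 = 0" using sq[of c] na by simp
    then have "c * (c - 1) * (norm v)\<^sup>2 = 0" unfolding 1 by (simp add: algebra_simps power2_eq_square)
    moreover have "v \<noteq> 0" using inj ijk d by (auto simp: v_def)
    ultimately have "c = 0 \<or> c = 1" by simp
    then have "base n k = base n i \<or> base n k = base n j" using bk bj by (auto simp: a_def)
    then show False using inj ijk d by auto
  qed
qed

lemma base_conf: "base n \<in> conf n"
  using base_inj by (simp add: conf_def base_def)

lemma base_outside: "i \<notin> {1..n} \<Longrightarrow> base n i = 0" by (auto simp: base_def)

section \<open>Regular loops close to a given loop\<close>

text \<open>The continuous loops that occur as stages of a homotopy; they may be arbitrarily
  degenerate.\<close>

definition based_loop :: "nat \<Rightarrow> (real \<Rightarrow> nat \<Rightarrow> complex) \<Rightarrow> bool" where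
  "based_loop n \<gamma> \<longleftrightarrow> (\<forall>i\<in>{1..n}. continuous_on {0..1} (\<lambda>t. \<gamma> t i)) \<and> (\<forall>t\<in>{0..1}. \<gamma> t \<in> conf n) \<and>
    \<gamma> 0 = base n \<and> \<gamma> 1 = base n"

definition close :: "nat \<Rightarrow> real \<Rightarrow> (real \<Rightarrow> nat \<Rightarrow> complex) \<Rightarrow> (real \<Rightarrow> nat \<Rightarrow> complex) \<Rightarrow> bool" where
  "close n \<epsilon> \<gamma> \<eta> \<longleftrightarrow> (\<forall>t\<in>{0..1}. \<eta> t \<in> conf_box n (\<gamma> t) \<epsilon>)"

lemma box_mono: "z \<in> conf_box n c \<epsilon> \<Longrightarrow> \<epsilon> \<le> \<epsilon>' \<Longrightarrow> z \<in> conf_box n c \<epsilon>'"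
  by (force simp: conf_box_def)

lemma close_mono: "close n \<epsilon> \<gamma> \<eta> \<Longrightarrow> \<epsilon> \<le> \<epsilon>' \<Longrightarrow> close n \<epsilon>' \<gamma> \<eta>"
  unfolding close_def using box_mono by blast

lemma box_triangle:
  assumes "x \<in> conf_box n y a" "y \<in> conf_box n z b"
  shows "x \<in> conf_box n z (a + b)"
  unfolding conf_box_def
proof (intro CollectI conjI ballI)
  fix i assume i: "i \<in> {1..n}"
  have "dist (x i) (z i) \<le> dist (x i) (y i) + dist (y i) (z i)" by (rule dist_triangle)
  moreover have "dist (x i) (y i) < a" "dist (y i) (z i) < b" using assms i by (auto simp: conf_box_def)
  ultimately show "dist (x i) (z i) < a + b" by linarith
qed (use assms in \<open>auto simp: conf_box_def\<close>)

lemma box_self: "0 < \<epsilon> \<Longrightarrow> (\<forall>i. i \<notin> {1..n} \<longrightarrow> z i = 0) \<Longrightarrow> z \<in> conf_box n z \<epsilon>"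
  by (simp add: conf_box_def)

lemma conf_outside: "z \<in> conf n \<Longrightarrow> \<forall>i. i \<notin> {1..n} \<longrightarrow> z i = 0" by (simp add: conf_def)

lemma in_chart_conf:
  assumes "in_chart n u z" "\<forall>i. i \<notin> {1..n} \<longrightarrow> z i = 0" shows "z \<in> conf n"
proof -
  have "inj_on z {1..n}"
    using assms(1) unfolding in_chart_def re_inj_def inj_on_def by metis
  then show ?thesis using assms(2) by (simp add: conf_def)
qed

text \<open>For each pair of points, at most one real number \<open>s\<close> gives them the same abscissa in the
  direction of \<open>1 + \<i> s\<close>.\<close>

lemma chart_exists:
  assumes "z \<in> conf n"
  shows "\<exists>u. in_chart n u z"
proof -
  let ?B = "\<lambda>(i, j). {s. z i \<noteq> z j \<and> Re (Complex 1 s * (z i - z j)) = 0}"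
  have "finite (?B x)" for x
  proof -
    obtain i j where x: "x = (i, j)" by fastforce
    let ?v = "z i - z j"
    have "?B x \<subseteq> {Re ?v / Im ?v}"
    proof
      fix s assume s: "s \<in> ?B x"
      then have "Re ?v = s * Im ?v" "?v \<noteq> 0" by (auto simp: x algebra_simps)
      then have "Im ?v \<noteq> 0" by (auto simp: complex_eq_iff)
      then show "s \<in> {Re ?v / Im ?v}" using \<open>Re ?v = s * Im ?v\<close> by simp
    qed
    then show ?thesis using finite_subset by blast
  qed
  then have "finite (\<Union>x\<in>{1..n} \<times> {1..n}. ?B x)" by (intro finite_UN_I) auto
  then obtain s where s: "s \<notin> (\<Union>x\<in>{1..n} \<times> {1..n}. ?B x)" using ex_new_if_finite[OF infinite_UNIV_char_0] by blast
  have "in_chart n (Complex 1 s) z"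
    unfolding in_chart_def re_inj_def
  proof (rule inj_onI)
    fix i j assume ij: "i \<in> {1..n}" "j \<in> {1..n}" and eq: "Re (Complex 1 s * z i) = Re (Complex 1 s * z j)"
    then have "Re (Complex 1 s * (z i - z j)) = 0" by (simp add: algebra_simps)
    then have "z i = z j" using s ij by blast
    then show "i = j" using assms ij by (auto simp: conf_def dest: inj_onD)
  qed
  then show ?thesis by blast
qed

lemma chart_neighbourhood:
  assumes "in_chart n u z"
  shows "\<exists>\<epsilon>>0. \<forall>z'\<in>conf_box n z \<epsilon>. in_chart n u z'"
proof -
  let ?I = "{(i, j). i \<in> {1..n} \<and> j \<in> {1..n} \<and> i \<noteq> j}"
  have fin: "finite ?I" by (rule finite_subset[of _ "{1..n} \<times> {1..n}"]) auto
  have "\<exists>\<epsilon>>0. \<forall>x\<in>?I. \<forall>z'\<in>conf_box n z \<epsilon>. Re (u * z' (fst x)) \<noteq> Re (u * z' (snd x))"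
  proof (rule finite_common_radius[OF fin])
    fix x assume "x \<in> ?I"
    then obtain i j where x: "x = (i, j)" "i \<in> {1..n}" "j \<in> {1..n}" "i \<noteq> j" by auto
    define c where "c = \<bar>Re (u * z i) - Re (u * z j)\<bar>"
    have c: "0 < c" using assms x unfolding in_chart_def re_inj_def inj_on_def c_def by fastforce
    \<comment> \<open>An upper bound of the norm of u that is not zero.\<close>
    define D where "D = norm u + 1"
    have D: "0 < D" unfolding D_def using norm_ge_zero[of u] by linarith
    define \<epsilon> where "\<epsilon> = c / (2 * D)"
    have e: "0 < \<epsilon>" using c D by (simp add: \<epsilon>_def)
    have "Re (u * z' i) \<noteq> Re (u * z' j)" if z': "z' \<in> conf_box n z \<epsilon>" for z'
    proof
      assume eq: "Re (u * z' i) = Re (u * z' j)"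
      have b: "\<bar>Re (u * z' l) - Re (u * z l)\<bar> \<le> norm u * \<epsilon>" if "l \<in> {1..n}" for l
      proof -
        have "\<bar>Re (u * (z' l - z l))\<bar> \<le> norm (u * (z' l - z l))" by (rule abs_Re_le_cmod)
        also have "\<dots> \<le> norm u * \<epsilon>" unfolding norm_mult
          using z' that by (intro mult_left_mono) (auto simp: conf_box_def dist_norm less_imp_le)
        finally show ?thesis by (simp add: algebra_simps)
      qed
      have "c \<le> 2 * (norm u * \<epsilon>)" using b[OF x(2)] b[OF x(3)] eq unfolding c_def by linarith
      also have "\<dots> < 2 * (D * \<epsilon>)" using e by (simp add: D_def algebra_simps)
      also have "\<dots> = c" using D by (simp add: \<epsilon>_def)
      finally show False by simp
    qed
    then show "\<exists>d>0. \<forall>z'\<in>conf_box n z d. Re (u * z' (fst x)) \<noteq> Re (u * z' (snd x))" using e x(1) by auto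
  qed (use box_mono in blast)
  then obtain \<epsilon> where "0 < \<epsilon>" "\<forall>x\<in>?I. \<forall>z'\<in>conf_box n z \<epsilon>. Re (u * z' (fst x)) \<noteq> Re (u * z' (snd x))" by blast
  then show ?thesis unfolding in_chart_def re_inj_def inj_on_def by (intro exI[of _ \<epsilon>]) fastforce
qed

lemma loop_continuous_uniform:
  fixes \<gamma> :: "real \<Rightarrow> nat \<Rightarrow> complex"
  assumes "\<forall>i\<in>{1..n}. continuous_on {0..1::real} (\<lambda>t. \<gamma> t i)" "0 < \<epsilon>"
  shows "\<exists>\<delta>>0. \<forall>i\<in>{1..n}. \<forall>s\<in>{0..1}. \<forall>t\<in>{0..1}. \<bar>s - t\<bar> < \<delta> \<longrightarrow> dist (\<gamma> s i) (\<gamma> t i) < \<epsilon>"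
proof (rule finite_common_radius)
  fix i assume "i \<in> {1..n}"
  then have "uniformly_continuous_on {0..1} (\<lambda>t. \<gamma> t i)" using assms(1) compact_uniformly_continuous by blast
  then show "\<exists>\<delta>>0. \<forall>s\<in>{0..1}. \<forall>t\<in>{0..1}. \<bar>s - t\<bar> < \<delta> \<longrightarrow> dist (\<gamma> s i) (\<gamma> t i) < \<epsilon>"
    using assms(2) unfolding uniformly_continuous_on_def dist_real_def by (metis abs_minus_commute)
qed auto

text \<open>On short time intervals a loop and all loops close to it stay in a common chart; by
  compactness the length and the closeness can be chosen uniformly. The property of intervals
  that such constants exist is additive and holds locally.\<close>

lemma loop_chart_cover:
  assumes "based_loop n \<gamma>"
  shows "\<exists>\<epsilon>>0. \<exists>\<delta>>0. \<forall>t\<in>{0..1}. \<exists>u. \<forall>t'\<in>{0..1}. \<bar>t' - t\<bar> < \<delta> \<longrightarrow> (\<forall>z\<in>conf_box n (\<gamma> t') \<epsilon>. in_chart n u z)"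
proof -
  define Q where "Q = (\<lambda>\<epsilon> \<delta> t. \<exists>u. \<forall>t'\<in>{0..1}. \<bar>t' - t\<bar> < \<delta> \<longrightarrow> (\<forall>z\<in>conf_box n (\<gamma> t') \<epsilon>. in_chart n u z))"
  have Q_mono: "Q \<epsilon>' \<delta>' t" if "Q \<epsilon> \<delta> t" "\<epsilon>' \<le> \<epsilon>" "\<delta>' \<le> \<delta>" for \<epsilon> \<delta> \<epsilon>' \<delta>' t
    using that box_mono unfolding Q_def by (meson less_le_trans)
  define R where "R = (\<lambda>a b. \<exists>\<epsilon>>0. \<exists>\<delta>>0. \<forall>t\<in>{a..b} \<inter> {0..1}. Q \<epsilon> \<delta> t)"
  have "(0::real) \<le> 1" by simp
  then have "R 0 1"
  proof (induction rule: Bolzano)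
    case (trans a b c)
    then obtain \<epsilon> \<delta> \<epsilon>' \<delta>' where *: "0 < \<epsilon>" "0 < \<delta>" "\<forall>t\<in>{a..b} \<inter> {0..1}. Q \<epsilon> \<delta> t"
      "0 < \<epsilon>'" "0 < \<delta>'" "\<forall>t\<in>{b..c} \<inter> {0..1}. Q \<epsilon>' \<delta>' t" unfolding R_def by blast
    have "Q (min \<epsilon> \<epsilon>') (min \<delta> \<delta>') t" if t: "t \<in> {a..c} \<inter> {0..1}" for t
    proof (cases "t \<le> b")
      case True
      then have "Q \<epsilon> \<delta> t" using * t by auto
      then show ?thesis by (rule Q_mono) auto
    next
      case False
      then have "Q \<epsilon>' \<delta>' t" using * t by auto
      then show ?thesis by (rule Q_mono) auto
    qed
    then show ?case unfolding R_def using * by (intro exI[of _ "min \<epsilon> \<epsilon>'"] exI[of _ "min \<delta> \<delta>'"] conjI) auto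
  next
    case (local x)
    then have x: "x \<in> {0..1}" by simp
    then obtain u where u: "in_chart n u (\<gamma> x)" using chart_exists assms unfolding based_loop_def by blast
    obtain \<epsilon> where e: "0 < \<epsilon>" "\<forall>z\<in>conf_box n (\<gamma> x) \<epsilon>. in_chart n u z" using chart_neighbourhood[OF u] by blast
    obtain \<delta> where d: "0 < \<delta>" "\<forall>i\<in>{1..n}. \<forall>s\<in>{0..1}. \<forall>t\<in>{0..1}. \<bar>s - t\<bar> < \<delta> \<longrightarrow> dist (\<gamma> s i) (\<gamma> t i) < \<epsilon> / 2"
      using loop_continuous_uniform[of n \<gamma> "\<epsilon> / 2"] assms e(1) unfolding based_loop_def by auto
    have near: "z \<in> conf_box n (\<gamma> x) \<epsilon>" if "t' \<in> {0..1}" "\<bar>t' - x\<bar> < \<delta>" "z \<in> conf_box n (\<gamma> t') (\<epsilon> / 2)" for t' z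
    proof -
      have "\<gamma> t' \<in> conf n" using assms that(1) unfolding based_loop_def by blast
      then have "\<gamma> t' \<in> conf_box n (\<gamma> x) (\<epsilon> / 2)" using d(2) that(1,2) x conf_outside by (auto simp: conf_box_def)
      from box_triangle[OF that(3) this] show ?thesis by simp
    qed
    have "Q (\<epsilon> / 2) (\<delta> / 2) t" if "a \<le> x \<and> x \<le> b \<and> b - a < \<delta> / 2" "t \<in> {a..b} \<inter> {0..1}" for a b t
      unfolding Q_def
    proof (intro exI[of _ u] ballI impI)
      fix t' z assume t': "t' \<in> {0..1}" "\<bar>t' - t\<bar> < \<delta> / 2" "z \<in> conf_box n (\<gamma> t') (\<epsilon> / 2)"
      have "\<bar>t - x\<bar> < \<delta> / 2" using that unfolding Int_iff atLeastAtMost_iff by linarith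
      then have "\<bar>t' - x\<bar> < \<delta>" using t'(2) by linarith
      then show "in_chart n u z" using near[OF t'(1) _ t'(3)] e(2) by blast
    qed
    then show ?case unfolding R_def using d(1) e(1) by (intro exI[of _ "\<delta> / 2"] conjI allI impI exI[of _ "\<epsilon> / 2"] exI[of _ "\<delta> / 2"]) auto
  qed
  then show ?thesis by (simp add: Q_def R_def)
qed

lemma close_in_conf:
  assumes "based_loop n \<gamma>"
  shows "\<exists>\<epsilon>>0. \<forall>t\<in>{0..1}. conf_box n (\<gamma> t) \<epsilon> \<subseteq> conf n"
proof -
  obtain \<epsilon> \<delta> where *: "0 < \<epsilon>" "0 < \<delta>" 
    "\<forall>t\<in>{0..1}. \<exists>u. \<forall>t'\<in>{0..1}. \<bar>t' - t\<bar> < \<delta> \<longrightarrow> (\<forall>z\<in>conf_box n (\<gamma> t') \<epsilon>. in_chart n u z)"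
    using loop_chart_cover[OF assms] by blast
  have "z \<in> conf n" if t: "t \<in> {0..1}" and z: "z \<in> conf_box n (\<gamma> t) \<epsilon>" for t z
  proof -
    obtain u where "\<forall>t'\<in>{0..1}. \<bar>t' - t\<bar> < \<delta> \<longrightarrow> (\<forall>z\<in>conf_box n (\<gamma> t') \<epsilon>. in_chart n u z)"
      using *(3) t by blast
    then have "in_chart n u z" using t z *(2) by force
    then show ?thesis using z by (intro in_chart_conf) (auto simp: conf_box_def)
  qed
  then show ?thesis using *(1) by blast
qed

text \<open>The unit interval is cut at times \<open>s k\<close>, at which neither of the two paths is critical,
  into pieces on which both stay in a chart. At each cut, \<open>\<eta>'\<close> and \<open>\<eta>\<close> are joined inside a
  small box by a word \<open>h\<close> as in \<open>connecting_word\<close>. In the chart of a piece, potentials show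
  that the square formed by the two pieces of path and the two connecting words commutes. As
  the ends agree, the connecting words at \<open>0\<close> and \<open>1\<close> are trivial.\<close>

lemma close_words_congruent:
  assumes n: "3 \<le> n" and loop: "based_loop n \<gamma>"
  shows "\<exists>\<epsilon>>0. \<forall>\<eta> \<eta>'. regular n \<eta> 0 1 \<and> regular n \<eta>' 0 1 \<and> close n \<epsilon> \<gamma> \<eta> \<and> close n \<epsilon> \<gamma> \<eta>' \<and>
     \<eta> 0 = \<eta>' 0 \<and> \<eta> 1 = \<eta>' 1 \<longrightarrow> cong3 n (path_word n \<eta> 0 1) (path_word n \<eta>' 0 1)"
proof -
  obtain \<epsilon> \<delta> where eps: "0 < \<epsilon>" "0 < \<delta>" 
    and cover: "\<forall>t\<in>{0..1}. \<exists>u. \<forall>t'\<in>{0..1}. \<bar>t' - t\<bar> < \<delta> \<longrightarrow> (\<forall>z\<in>conf_box n (\<gamma> t') \<epsilon>. in_chart n u z)"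
    using loop_chart_cover[OF loop] by blast
  have "cong3 n (path_word n \<eta> 0 1) (path_word n \<eta>' 0 1)"
    if reg: "regular n \<eta> 0 1" "regular n \<eta>' 0 1" and cl: "close n \<epsilon> \<gamma> \<eta>" "close n \<epsilon> \<gamma> \<eta>'"
      and ends: "\<eta> 0 = \<eta>' 0" "\<eta> 1 = \<eta>' 1" for \<eta> \<eta>'
  proof -
    let ?nc = "\<lambda>t. noncollinear n (\<eta> t) \<and> noncollinear n (\<eta>' t)"
    obtain N :: nat where N: "2 / \<delta> < real N" "0 < N"
      by (metis reals_Archimedean2 eps(2) divide_pos_pos less_trans of_nat_0_less_iff zero_less_numeral)
    have N2: "2 / real N < \<delta>" using N eps(2) by (simp add: field_simps)
    have "\<exists>t. real k / real N < t \<and> t < (real k + 1 / 2) / real N \<and> (t \<in> {0..1} \<longrightarrow> ?nc t)" for k :: nat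
    proof -
      have "finite (crit_in n \<eta> 0 1 \<union> crit_in n \<eta>' 0 1)" using reg by (auto simp: regular_def)
      moreover have "infinite {real k / real N<..<(real k + 1 / 2) / real N}"
        using N(2) by (intro infinite_Ioo) (auto simp: field_simps)
      ultimately have "\<not> {real k / real N<..<(real k + 1 / 2) / real N} \<subseteq> crit_in n \<eta> 0 1 \<union> crit_in n \<eta>' 0 1"
        using finite_subset by blast
      then obtain t where "t \<in> {real k / real N<..<(real k + 1 / 2) / real N}" "t \<notin> crit_in n \<eta> 0 1 \<union> crit_in n \<eta>' 0 1"
        by blast
      then show ?thesis by (intro exI[of _ t]) (auto simp: crit_in_iff)
    qed
    then obtain c where c: "\<And>k::nat. real k / real N < c k \<and> c k < (real k + 1 / 2) / real N \<and> (c k \<in> {0..1} \<longrightarrow> ?nc (c k))"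
      by metis
    \<comment> \<open>The critical moments are finite in number, so uncritical times can be chosen in the
      first halves of the intervals of length 1 / N; successive ones are less than 2 / N
      apart.\<close>
    define s where "s = (\<lambda>k. if k = 0 then 0 else if N \<le> k then 1 else c k)"
    have s_low: "real k / real N \<le> s k" if "k \<le> N" for k
      using c[of k] that N(2) by (auto simp: s_def)
    have s_up: "s k < (real k + 1 / 2) / real N" if "k \<le> N" for k
      using c[of k] that N(2) by (auto simp: s_def field_simps)
    have s01: "s k \<in> {0..1}" if "k \<le> N" for k
    proof -
      have "s k \<le> 1"
      proof (cases "k = N")
        case False
        then have "real k + 1 / 2 \<le> real N" using that by linarith
        then have "(real k + 1 / 2) / real N \<le> 1" using N(2) by simp
        then show ?thesis using s_up[OF that] by simp
      qed (use N(2) in \<open>auto simp: s_def\<close>)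
      moreover have "0 \<le> real k / real N" by simp
      ultimately show ?thesis using s_low[OF that] unfolding atLeastAtMost_iff by linarith
    qed
    have s_nc: "?nc (s k)" if "k \<le> N" for k
    proof (cases "k = 0 \<or> k = N")
      case True then show ?thesis using reg N(2) by (auto simp: s_def regular_def)
    next
      case False
      then have "s k = c k" using that by (auto simp: s_def)
      then show ?thesis using c[of k] s01[OF that] by auto
    qed
    have s_step: "s k < s (Suc k)" "s (Suc k) - s k < \<delta>" if "Suc k \<le> N" for k
    proof -
      have "(real k + 1 / 2) / real N \<le> real (Suc k) / real N" by (intro divide_right_mono) auto
      then show "s k < s (Suc k)" using s_up[of k] s_low[of "Suc k"] that by linarith
      have "(real (Suc k) + 1 / 2) / real N - real k / real N \<le> 2 / real N"
        using N(2) by (simp add: field_simps)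
      then show "s (Suc k) - s k < \<delta>" using s_up[of "Suc k"] s_low[of k] that N2 by linarith
    qed
    define conn where "conn = (\<lambda>k h. h \<in> words (generators n) \<and> (\<forall>u. (\<forall>z\<in>conf_box n (\<gamma> (s k)) \<epsilon>. in_chart n u z) \<longrightarrow>
       cong3 n (chart_potential n u (\<eta>' (s k)) @ h) (chart_potential n u (\<eta> (s k)))))"
    have conn_ex: "\<exists>h. conn k h" if "k \<le> N" for k
      unfolding conn_def using connecting_word[OF n, of "\<eta>' (s k)" "\<gamma> (s k)" \<epsilon> "\<eta> (s k)"] s_nc[OF that] cl s01[OF that]
      by (auto simp: close_def)
    have chart_at: "\<exists>u. \<forall>t'\<in>{0..1}. \<bar>t' - s k\<bar> < \<delta> \<longrightarrow> (\<forall>z\<in>conf_box n (\<gamma> t') \<epsilon>. in_chart n u z)" if "k \<le> N" for k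
      using cover s01[OF that] by blast
    have trivial: "cong3 n h []" if tr: "k \<le> N" "conn k h" "\<eta> (s k) = \<eta>' (s k)" for k h
    proof -
      obtain u where u: "\<forall>t'\<in>{0..1}. \<bar>t' - s k\<bar> < \<delta> \<longrightarrow> (\<forall>z\<in>conf_box n (\<gamma> t') \<epsilon>. in_chart n u z)"
        using chart_at[OF tr(1)] by blast
      then have "\<forall>z\<in>conf_box n (\<gamma> (s k)) \<epsilon>. in_chart n u z" using s01[OF tr(1)] eps(2) by simp
      then have "cong3 n (chart_potential n u (\<eta>' (s k)) @ h) (chart_potential n u (\<eta> (s k)))"
        using tr(2) unfolding conn_def by blast
      then have "cong3 n (chart_potential n u (\<eta>' (s k)) @ h) (chart_potential n u (\<eta>' (s k)) @ [])"
        using tr(3) by simp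
      then show ?thesis by (rule word_cong_cancel_left)
    qed
    have main: "\<exists>h. conn k h \<and> cong3 n (path_word n \<eta> 0 (s k)) (path_word n \<eta>' 0 (s k) @ h)" if "k \<le> N" for k
      using that
    proof (induction k)
      case 0
      obtain h where h: "conn 0 h" using conn_ex[of 0] by auto
      have s0: "s 0 = 0" by (simp add: s_def)
      have "crit_in n \<eta> 0 0 = {}" "crit_in n \<eta>' 0 0 = {}" using reg by (auto simp: crit_in_iff regular_def)
      then have "path_word n \<eta> 0 0 = []" "path_word n \<eta>' 0 0 = []" by (auto simp: path_word_Nil)
      moreover have "cong3 n h []" using trivial[OF _ h] s0 ends by simp
      ultimately show ?case using h s0 by (intro exI[of _ h]) (auto intro: word_cong.sym)
    next
      case (Suc k)
      then obtain h where h: "conn k h" "cong3 n (path_word n \<eta> 0 (s k)) (path_word n \<eta>' 0 (s k) @ h)" by auto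
      obtain h' where h': "conn (Suc k) h'" using conn_ex[OF Suc.prems] by blast
      have k: "k \<le> N" using Suc.prems by simp
      obtain u where u: "\<forall>t'\<in>{0..1}. \<bar>t' - s k\<bar> < \<delta> \<longrightarrow> (\<forall>z\<in>conf_box n (\<gamma> t') \<epsilon>. in_chart n u z)"
        using chart_at[OF k] by blast
      note st = s_step[OF Suc.prems] s01[OF k] s01[OF Suc.prems] s_nc[OF k] s_nc[OF Suc.prems]
      have chart: "in_chart n u z" if "t \<in> {s k..s (Suc k)}" "z \<in> conf_box n (\<gamma> t) \<epsilon>" for t z
      proof -
        have "t \<in> {0..1}" "\<bar>t - s k\<bar> < \<delta>"
          using st(1-4) that(1) unfolding atLeastAtMost_iff by linarith+
        then show ?thesis using u that(2) by blast
      qed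
      let ?\<Phi> = "chart_potential n u"
      let ?w = "path_word n \<eta> (s k) (s (Suc k))" and ?w' = "path_word n \<eta>' (s k) (s (Suc k))"
      have w: "cong3 n (?\<Phi> (\<eta> (s k)) @ ?w) (?\<Phi> (\<eta> (s (Suc k))))"
      proof (rule chart_potential_path[OF n])
        show "regular n \<eta> (s k) (s (Suc k))" using reg st by (intro regular_subinterval[OF reg(1)]) auto
        show "in_chart n u (\<eta> t)" if "t \<in> {s k..s (Suc k)}" for t
          using chart[OF that] cl that st by (auto simp: close_def)
      qed (use st in auto)
      have w': "cong3 n (?\<Phi> (\<eta>' (s k)) @ ?w') (?\<Phi> (\<eta>' (s (Suc k))))"
      proof (rule chart_potential_path[OF n])
        show "regular n \<eta>' (s k) (s (Suc k))" using reg st by (intro regular_subinterval[OF reg(2)]) auto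
        show "in_chart n u (\<eta>' t)" if "t \<in> {s k..s (Suc k)}" for t
          using chart[OF that] cl that st by (auto simp: close_def)
      qed (use st in auto)
      have a: "cong3 n (?\<Phi> (\<eta>' (s k)) @ h) (?\<Phi> (\<eta> (s k)))"
        using h(1) chart[of "s k"] st unfolding conn_def by auto
      have b: "cong3 n (?\<Phi> (\<eta>' (s (Suc k))) @ h') (?\<Phi> (\<eta> (s (Suc k))))"
        using h' chart[of "s (Suc k)"] st unfolding conn_def by auto
      have W: "h \<in> words (generators n)" "h' \<in> words (generators n)" "?w \<in> words (generators n)" "?w' \<in> words (generators n)"
        using h(1) h' word_cong_words[OF w] word_cong_words[OF w'] unfolding conn_def by auto
      have "cong3 n ((?\<Phi> (\<eta>' (s k)) @ h) @ ?w) (?\<Phi> (\<eta> (s k)) @ ?w)" by (rule word_cong_right[OF a W(3)])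
      also note w
      also note word_cong.sym[OF b]
      also have "cong3 n (?\<Phi> (\<eta>' (s (Suc k))) @ h') ((?\<Phi> (\<eta>' (s k)) @ ?w') @ h')"
        by (rule word_cong_right[OF word_cong.sym[OF w'] W(2)])
      finally have sq: "cong3 n (h @ ?w) (?w' @ h')"
        by (simp add: word_cong_cancel_left[of "?\<Phi> (\<eta>' (s k))"])
      have split: "path_word n \<zeta> 0 (s (Suc k)) = path_word n \<zeta> 0 (s k) @ path_word n \<zeta> (s k) (s (Suc k))"
        if "regular n \<zeta> 0 1" "noncollinear n (\<zeta> (s k))" for \<zeta>
      proof (rule path_word_append)
        show "finite (crit_in n \<zeta> 0 (s (Suc k)))"
          using that(1) crit_in_subset[of 0 0 "s (Suc k)" 1 n \<zeta>] st finite_subset unfolding regular_def by auto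
      qed (use that st in auto)
      have "cong3 n (path_word n \<eta> 0 (s k) @ ?w) ((path_word n \<eta>' 0 (s k) @ h) @ ?w)"
        by (rule word_cong_right[OF h(2) W(3)])
      also have "cong3 n (path_word n \<eta>' 0 (s k) @ (h @ ?w)) (path_word n \<eta>' 0 (s k) @ (?w' @ h'))"
        using word_cong_words[OF h(2)] by (intro word_cong_left[OF sq]) auto
      then have "cong3 n ((path_word n \<eta>' 0 (s k) @ h) @ ?w) (path_word n \<eta>' 0 (s k) @ (?w' @ h'))" by simp
      finally show ?case using h' split[OF reg(1)] split[OF reg(2)] st by (intro exI[of _ h']) simp
    qed
    obtain h where h: "conn N h" "cong3 n (path_word n \<eta> 0 (s N)) (path_word n \<eta>' 0 (s N) @ h)" using main by blast
    have sN: "s N = 1" using N(2) by (simp add: s_def)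
    have "cong3 n h []" using trivial[OF _ h(1)] sN ends by simp
    then have "cong3 n (path_word n \<eta>' 0 1 @ h) (path_word n \<eta>' 0 1 @ [])"
      using word_cong_words[OF h(2)] sN by (intro word_cong_left) auto
    with h(2) show ?thesis unfolding sN by (auto intro: word_cong.trans)
  qed
  then show ?thesis using eps(1) by blast
qed

definition polygonal :: "nat \<Rightarrow> nat \<Rightarrow> (nat \<Rightarrow> nat \<Rightarrow> complex) \<Rightarrow> bool" where
  "polygonal n M P \<longleftrightarrow> 0 < M \<and> P 0 = base n \<and> P M = base n \<and> (\<forall>k<M. good_move n (P k) (P (Suc k)))"

text \<open>Choose configurations in general position near the loop at equidistant times, beginning and
  ending with the base point, and join successive ones by chains of good moves inside small
  boxes.\<close>

lemma polygon_approximation: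
  assumes n: "3 \<le> n" and loop: "based_loop n \<gamma>" and e: "0 < \<epsilon>"
  shows "\<exists>M P. polygonal n M P \<and> close n \<epsilon> \<gamma> (smooth_polygon M P)"
proof -
  obtain \<delta> where d: "0 < \<delta>" "\<forall>i\<in>{1..n}. \<forall>s\<in>{0..1}. \<forall>t\<in>{0..1}. \<bar>s - t\<bar> < \<delta> \<longrightarrow> dist (\<gamma> s i) (\<gamma> t i) < \<epsilon> / 4"
    using loop_continuous_uniform[of n \<gamma> "\<epsilon> / 4"] loop e unfolding based_loop_def by auto
  obtain N :: nat where N: "2 / \<delta> < real N" "0 < N"
    by (metis reals_Archimedean2 d(1) divide_pos_pos less_trans of_nat_0_less_iff zero_less_numeral)
  have N2: "2 / real N < \<delta>" using N d(1) by (simp add: field_simps)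
  have near: "\<gamma> s \<in> conf_box n (\<gamma> t) (\<epsilon> / 4)" if "s \<in> {0..1}" "t \<in> {0..1}" "\<bar>s - t\<bar> \<le> 1 / real N" for s t
  proof -
    have "1 / real N < \<delta>" using N2 N(2) by (simp add: field_simps)
    moreover have "\<gamma> s \<in> conf n" using loop that(1) unfolding based_loop_def by blast
    ultimately show ?thesis using d(2) that conf_outside[of "\<gamma> s" n] unfolding conf_box_def by auto
  qed
  have "\<exists>q. noncollinear n q \<and> q \<in> conf_box n (\<gamma> (real k / real N)) (\<epsilon> / 4) \<and> (k = 0 \<or> k = N \<longrightarrow> q = base n)" if "k \<le> N" for k
  proof (cases "k = 0 \<or> k = N")
    case True
    then have "\<gamma> (real k / real N) = base n" using loop N(2) by (auto simp: based_loop_def)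
    then show ?thesis using base_noncollinear base_outside e by (intro exI[of _ "base n"]) (auto intro!: box_self)
  next
    case False
    then show ?thesis using noncollinear_dense[OF base_noncollinear, of n "\<epsilon> / 4" "\<gamma> (real k / real N)"] base_outside e by auto
  qed
  then obtain q where q: "\<And>k. k \<le> N \<Longrightarrow> noncollinear n (q k) \<and> q k \<in> conf_box n (\<gamma> (real k / real N)) (\<epsilon> / 4) \<and> (k = 0 \<or> k = N \<longrightarrow> q k = base n)"
    by metis
  have "\<exists>C. C 0 = q k \<and> C (2 * n) = q (Suc k) \<and> (\<forall>j<2 * n. good_move n (C j) (C (Suc j))) \<and>
     (\<forall>j\<le>2 * n. C j \<in> conf_box n (\<gamma> (real k / real N)) (\<epsilon> / 2))" if k: "k < N" for k
  proof (rule good_chain)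
    show "q k \<in> conf_box n (\<gamma> (real k / real N)) (\<epsilon> / 2)" using q[of k] k e by (auto intro: box_mono)
    have "\<gamma> (real (Suc k) / real N) \<in> conf_box n (\<gamma> (real k / real N)) (\<epsilon> / 4)"
      using k N(2) by (intro near) (auto simp: field_simps)
    from box_triangle[OF _ this, of "q (Suc k)" "\<epsilon> / 4"]
    show "q (Suc k) \<in> conf_box n (\<gamma> (real k / real N)) (\<epsilon> / 2)" using q[of "Suc k"] k by simp
  qed (use q k in auto)
  then obtain C where C: "\<And>k. k < N \<Longrightarrow> C k 0 = q k \<and> C k (2 * n) = q (Suc k) \<and> (\<forall>j<2 * n. good_move n (C k j) (C k (Suc j))) \<and>
     (\<forall>j\<le>2 * n. C k j \<in> conf_box n (\<gamma> (real k / real N)) (\<epsilon> / 2))" by metis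
  \<comment> \<open>Each of the N pieces consists of m moves.\<close>
  define m where "m = 2 * n"
  have m: "0 < m" using n by (simp add: m_def)
  define M where "M = N * m"
  have M: "0 < M" using m N(2) by (simp add: M_def)
  define P where "P = (\<lambda>l. if l < M then C (l div m) (l mod m) else base n)"
  have div: "l div m < N" if "l < M" for l using that m by (simp add: M_def less_mult_imp_div_less)
  have P_Suc: "P (Suc l) = C (l div m) (Suc (l mod m))" if l: "l < M" for l
  proof (cases "Suc (l mod m) = m")
    case True
    then have 1: "Suc l mod m = 0" "Suc l div m = Suc (l div m)" by (auto simp: mod_Suc div_Suc)
    have 2: "C (l div m) (Suc (l mod m)) = q (Suc (l div m))" using C[OF div[OF l]] True by (simp add: m_def)
    show ?thesis
    proof (cases "Suc l < M")
      case True then show ?thesis using 1 2 C[OF div[OF True]] by (simp add: P_def)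
    next
      case False
      then have "Suc l = M" using l by simp
      then have "Suc (l div m) = N" using 1 m by (metis M_def nonzero_mult_div_cancel_right not_less_zero)
      then show ?thesis using False 2 q[of N] by (simp add: P_def)
    qed
  next
    case False
    then have 1: "Suc l mod m = Suc (l mod m)" "Suc l div m = l div m" by (auto simp: mod_Suc div_Suc)
    have "Suc l \<noteq> M" using 1(1) unfolding M_def by (metis Zero_not_Suc mod_mult_self2_is_0)
    then show ?thesis using 1 l by (simp add: P_def)
  qed
  have mod: "l mod m < 2 * n" for l using m mod_less_divisor[of m l] by (simp add: m_def)
  have good: "good_move n (P l) (P (Suc l))" if l: "l < M" for l
    using C[OF div[OF l]] mod[of l] l unfolding P_Suc[OF l] by (simp add: P_def)
  have "polygonal n M P"
    unfolding polygonal_def using M good C[OF N(2)] q[of 0] by (auto simp: P_def)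
  moreover have "close n \<epsilon> \<gamma> (smooth_polygon M P)"
    unfolding close_def
  proof
    fix t :: real assume t: "t \<in> {0..1}"
    obtain l where l: "l < M" "real l \<le> real M * t" "real M * t \<le> real l + 1" using slot_exists[OF M t] by blast
    let ?k = "l div m"
    have k: "?k < N" by (rule div[OF l(1)])
    have "smooth_polygon M P t = glide (P l) (P (Suc l)) (smooth_step (real M * t - real l))"
      using smooth_polygon_partial[of l M t P] l by simp
    also have "\<dots> \<in> conf_box n (\<gamma> (real ?k / real N)) (\<epsilon> / 2)"
    proof (rule glide_in_box)
      show "P l \<in> conf_box n (\<gamma> (real ?k / real N)) (\<epsilon> / 2)" using C[OF k] mod[of l] l(1) by (simp add: P_def)
      show "P (Suc l) \<in> conf_box n (\<gamma> (real ?k / real N)) (\<epsilon> / 2)"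
        unfolding P_Suc[OF l(1)] using C[OF k] mod[of l] by (simp add: Suc_le_eq)
    qed (rule smooth_step_range)
    finally have 1: "smooth_polygon M P t \<in> conf_box n (\<gamma> (real ?k / real N)) (\<epsilon> / 2)" .
    have "real ?k * real m \<le> real l" by (metis div_times_less_eq_dividend of_nat_le_iff of_nat_mult)
    then have "real ?k * real m \<le> real N * t * real m" using l(2) by (simp add: M_def mult_ac)
    then have lo: "real ?k \<le> real N * t" using m by simp
    have "l < Suc ?k * m" using m by (metis dividend_less_div_times mult_Suc add.commute)
    then have "real l + 1 \<le> (real ?k + 1) * real m" by (metis Suc_leI of_nat_Suc of_nat_le_iff of_nat_mult add.commute)
    then have "real N * t * real m \<le> (real ?k + 1) * real m" using l(3) by (simp add: M_def mult_ac)
    then have up: "real N * t \<le> real ?k + 1" using m by simp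
    have "real ?k / real N \<in> {0..1}" using k by simp
    moreover have "\<bar>real ?k / real N - t\<bar> \<le> 1 / real N"
    proof -
      have "real ?k / real N \<le> t" "t \<le> real ?k / real N + 1 / real N"
        using lo up N(2) by (simp_all add: field_simps)
      then show ?thesis by simp
    qed
    ultimately have "\<gamma> (real ?k / real N) \<in> conf_box n (\<gamma> t) (\<epsilon> / 4)" using t by (intro near)
    from box_triangle[OF 1 this] show "smooth_polygon M P t \<in> conf_box n (\<gamma> t) \<epsilon>"
      using e by (auto intro: box_mono)
  qed
  ultimately show ?thesis by blast
qed

section \<open>Homotopic loops\<close>

text \<open>A transitive relation \<open>R\<close> between the members of a dense set \<open>S\<close> of loops that holds
  between members close to a common loop holds between homotopic members. For parameters \<open>a\<close>
  and \<open>b\<close> of the homotopy \<open>H\<close>, consider the statement that members sufficiently close to the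
  stages at \<open>a\<close> and \<open>b\<close> are related: density makes it transitive, and it holds locally by
  uniform continuity. The stages themselves need not belong to \<open>S\<close>.\<close>

lemma homotopy_principle:
  assumes cont: "\<forall>i\<in>{1..n}. continuous_on ({0..1} \<times> {0..1}) (\<lambda>x. H x i)"
    and loops: "\<And>s. s \<in> {0..1::real} \<Longrightarrow> based_loop n (\<lambda>t. H (s, t))"
    and dense: "\<And>\<gamma> \<epsilon>. based_loop n \<gamma> \<Longrightarrow> 0 < \<epsilon> \<Longrightarrow> \<exists>\<eta>\<in>S. close n \<epsilon> \<gamma> \<eta>"
    and local: "\<And>\<gamma>. based_loop n \<gamma> \<Longrightarrow> \<exists>\<epsilon>>0. \<forall>\<eta>\<in>S. \<forall>\<eta>'\<in>S. close n \<epsilon> \<gamma> \<eta> \<and> close n \<epsilon> \<gamma> \<eta>' \<longrightarrow> R \<eta> \<eta>'"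
    and R_trans: "\<And>x y z. x \<in> S \<Longrightarrow> y \<in> S \<Longrightarrow> z \<in> S \<Longrightarrow> R x y \<Longrightarrow> R y z \<Longrightarrow> R x z"
    and ends: "\<alpha> \<in> S" "\<beta> \<in> S" "\<And>t. t \<in> {0..1} \<Longrightarrow> H (0, t) = \<alpha> t" "\<And>t. t \<in> {0..1} \<Longrightarrow> H (1, t) = \<beta> t"
  shows "R \<alpha> \<beta>"
proof -
  let ?\<gamma> = "\<lambda>s t. H (s, t)"
  have "\<forall>s\<in>{0..1}. \<exists>\<epsilon>>0. \<forall>\<eta>\<in>S. \<forall>\<eta>'\<in>S. close n \<epsilon> (?\<gamma> s) \<eta> \<and> close n \<epsilon> (?\<gamma> s) \<eta>' \<longrightarrow> R \<eta> \<eta>'"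
    using local loops by blast
  then obtain e where e: "\<And>s. s \<in> {0..1} \<Longrightarrow> 0 < e s"
    "\<And>s \<eta> \<eta>'. s \<in> {0..1} \<Longrightarrow> \<eta> \<in> S \<Longrightarrow> \<eta>' \<in> S \<Longrightarrow> close n (e s) (?\<gamma> s) \<eta> \<Longrightarrow> close n (e s) (?\<gamma> s) \<eta>' \<Longrightarrow> R \<eta> \<eta>'"
    by metis
  define Q where "Q = (\<lambda>a b. a \<in> {0..1} \<and> b \<in> {0..1} \<longrightarrow>
     (\<forall>\<eta>\<in>S. \<forall>\<eta>'\<in>S. close n (e a) (?\<gamma> a) \<eta> \<and> close n (e b) (?\<gamma> b) \<eta>' \<longrightarrow> R \<eta> \<eta>'))"
  have "(0::real) \<le> 1" by simp
  then have "Q 0 1"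
  proof (induction rule: Bolzano)
    case (trans a b c)
    show ?case unfolding Q_def
    proof (intro impI ballI)
      fix \<eta> \<eta>' assume a: "a \<in> {0..1} \<and> c \<in> {0..1}" "\<eta> \<in> S" "\<eta>' \<in> S" "close n (e a) (?\<gamma> a) \<eta> \<and> close n (e c) (?\<gamma> c) \<eta>'"
      then have b: "b \<in> {0..1}" using trans by auto
      obtain \<zeta> where z: "\<zeta> \<in> S" "close n (e b) (?\<gamma> b) \<zeta>" using dense[OF loops[OF b] e(1)[OF b]] by blast
      have "R \<eta> \<zeta>" "R \<zeta> \<eta>'" using trans(1,2) a b z unfolding Q_def by blast+
      then show "R \<eta> \<eta>'" using R_trans a z by blast
    qed
  next
    case (local x)
    then have x: "x \<in> {0..1}" by simp
    have "\<exists>\<delta>>0. \<forall>i\<in>{1..n}. \<forall>y\<in>{0..1}. \<bar>y - x\<bar> < \<delta> \<longrightarrow> (\<forall>t\<in>{0..1}. dist (H (y, t) i) (H (x, t) i) < e x / 2)"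
    proof (rule finite_common_radius)
      fix i assume "i \<in> {1..n}"
      then have "uniformly_continuous_on ({0..1} \<times> {0..1}) (\<lambda>x. H x i)"
        using cont by (intro compact_uniformly_continuous compact_Times) auto
      then obtain d where d: "0 < d" "\<forall>y\<in>{0..1} \<times> {0..1}. \<forall>z\<in>{0..1} \<times> {0..1}. dist z y < d \<longrightarrow> dist (H z i) (H y i) < e x / 2"
        using e(1)[OF x] unfolding uniformly_continuous_on_def by (metis half_gt_zero)
      show "\<exists>\<delta>>0. \<forall>y\<in>{0..1}. \<bar>y - x\<bar> < \<delta> \<longrightarrow> (\<forall>t\<in>{0..1}. dist (H (y, t) i) (H (x, t) i) < e x / 2)"
      proof (intro exI[of _ d] conjI ballI impI)
        fix y t :: real assume "y \<in> {0..1}" "\<bar>y - x\<bar> < d" "t \<in> {0..1}"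
        then show "dist (H (y, t) i) (H (x, t) i) < e x / 2"
          using d(2)[rule_format, of "(x, t)" "(y, t)"] x by (simp add: dist_Pair_Pair dist_real_def)
      qed (rule d(1))
    qed auto
    then obtain \<delta> where d: "0 < \<delta>" "\<forall>i\<in>{1..n}. \<forall>y\<in>{0..1}. \<bar>y - x\<bar> < \<delta> \<longrightarrow> (\<forall>t\<in>{0..1}. dist (H (y, t) i) (H (x, t) i) < e x / 2)"
      by blast
    have near: "close n (e x / 2) (?\<gamma> x) (?\<gamma> y)" if y: "y \<in> {0..1}" "\<bar>y - x\<bar> < \<delta>" for y
      unfolding close_def
    proof
      fix t :: real assume t: "t \<in> {0..1}"
      have "H (y, t) \<in> conf n" using loops[OF y(1)] t unfolding based_loop_def by blast
      then show "H (y, t) \<in> conf_box n (H (x, t)) (e x / 2)"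
        using d(2) y t conf_outside[of "H (y, t)" n] unfolding conf_box_def by auto
    qed
    have mid: "\<exists>\<zeta>\<in>S. (\<forall>\<eta>\<in>S. close n (e y) (?\<gamma> y) \<eta> \<longrightarrow> R \<eta> \<zeta> \<and> R \<zeta> \<eta>) \<and> close n (e x) (?\<gamma> x) \<zeta>"
      if y: "y \<in> {0..1}" "\<bar>y - x\<bar> < \<delta>" for y
    proof -
      obtain \<zeta> where z: "\<zeta> \<in> S" "close n (min (e y) (e x / 2)) (?\<gamma> y) \<zeta>"
        using dense[OF loops[OF y(1)], of "min (e y) (e x / 2)"] e(1)[OF y(1)] e(1)[OF x] by auto
      have "close n (e y) (?\<gamma> y) \<zeta>" using z(2) by (rule close_mono) simp
      moreover have "close n (e x) (?\<gamma> x) \<zeta>"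
        unfolding close_def
      proof
        fix t :: real assume t: "t \<in> {0..1}"
        have "\<zeta> t \<in> conf_box n (H (y, t)) (e x / 2)" using z(2) t close_mono[of n _ _ _ "e x / 2"] unfolding close_def
          by (meson box_mono min.cobounded2)
        from box_triangle[OF this, of "H (x, t)" "e x / 2"] near[OF y] t
        show "\<zeta> t \<in> conf_box n (H (x, t)) (e x)" by (simp add: close_def)
      qed
      ultimately show ?thesis using z(1) e(2)[OF y(1)] by blast
    qed
    show ?case
    proof (intro exI[of _ \<delta>] conjI allI impI)
      fix a b assume ab: "a \<le> x \<and> x \<le> b \<and> b - a < \<delta>"
      show "Q a b" unfolding Q_def
      proof (intro impI ballI)
        fix \<eta> \<eta>' assume h: "a \<in> {0..1} \<and> b \<in> {0..1}" "\<eta> \<in> S" "\<eta>' \<in> S" "close n (e a) (?\<gamma> a) \<eta> \<and> close n (e b) (?\<gamma> b) \<eta>'"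
        have "\<bar>a - x\<bar> < \<delta>" "\<bar>b - x\<bar> < \<delta>" using ab by auto
        then obtain \<zeta> \<zeta>' where z: "\<zeta> \<in> S" "R \<eta> \<zeta>" "close n (e x) (?\<gamma> x) \<zeta>" "\<zeta>' \<in> S" "R \<zeta>' \<eta>'" "close n (e x) (?\<gamma> x) \<zeta>'"
          using mid[of a] mid[of b] h by metis
        have "R \<zeta> \<zeta>'" using e(2)[OF x] z by blast
        then show "R \<eta> \<eta>'" using R_trans z h by blast
      qed
    qed (use d in simp)
  qed
  have in_own: "close n (e s) (?\<gamma> s) \<eta>" if "s \<in> {0..1}" "\<And>t. t \<in> {0..1} \<Longrightarrow> H (s, t) = \<eta> t" for s \<eta>
    unfolding close_def
  proof
    fix t :: real assume t: "t \<in> {0..1}"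
    have "H (s, t) \<in> conf n" using loops[OF that(1)] t unfolding based_loop_def by blast
    then show "\<eta> t \<in> conf_box n (H (s, t)) (e s)" using that(2)[OF t] conf_outside e(1)[OF that(1)] by (auto intro!: box_self)
  qed
  have "close n (e 0) (?\<gamma> 0) \<alpha>" "close n (e 1) (?\<gamma> 1) \<beta>" using in_own ends(3,4) by auto
  then show ?thesis using \<open>Q 0 1\<close> ends(1,2) unfolding Q_def by auto
qed

lemma coordinatewise_continuous:
  fixes f :: "'a::topological_space \<Rightarrow> nat \<Rightarrow> complex"
  assumes "\<forall>i\<in>{1..n}. continuous_on S (\<lambda>t. f t i)" "\<And>t. t \<in> S \<Longrightarrow> f t \<in> conf n"
  shows "continuous_on S f"
proof (rule continuous_on_coordinatewise_then_product)
  fix i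
  show "continuous_on S (\<lambda>t. f t i)"
  proof (cases "i \<in> {1..n}")
    case False
    then have "f t i = 0" if "t \<in> S" for t using assms(2)[OF that] by (auto simp: conf_def)
    then show ?thesis by (simp cong: continuous_on_cong)
  qed (use assms(1) in blast)
qed

lemma homotopic_paths_principle:
  assumes hom: "homotopic_paths (conf n) \<alpha> \<beta>" and base: "pathstart \<alpha> = base n" "pathfinish \<alpha> = base n"
    and S: "\<alpha> \<in> S" "\<beta> \<in> S"
    and dense: "\<And>\<gamma> \<epsilon>. based_loop n \<gamma> \<Longrightarrow> 0 < \<epsilon> \<Longrightarrow> \<exists>\<eta>\<in>S. close n \<epsilon> \<gamma> \<eta>"
    and local: "\<And>\<gamma>. based_loop n \<gamma> \<Longrightarrow> \<exists>\<epsilon>>0. \<forall>\<eta>\<in>S. \<forall>\<eta>'\<in>S. close n \<epsilon> \<gamma> \<eta> \<and> close n \<epsilon> \<gamma> \<eta>' \<longrightarrow> R \<eta> \<eta>'"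
    and R_trans: "\<And>x y z. x \<in> S \<Longrightarrow> y \<in> S \<Longrightarrow> z \<in> S \<Longrightarrow> R x y \<Longrightarrow> R y z \<Longrightarrow> R x z"
  shows "R \<alpha> \<beta>"
proof -
  obtain h where h: "continuous_on ({0..1} \<times> {0..1}) h" "h \<in> ({0..1} \<times> {0..1}) \<rightarrow> conf n"
    "\<forall>x\<in>{0..1}. h (0, x) = \<alpha> x" "\<forall>x\<in>{0..1}. h (1, x) = \<beta> x"
    "\<forall>t\<in>{0..1::real}. pathstart (h \<circ> Pair t) = pathstart \<alpha> \<and> pathfinish (h \<circ> Pair t) = pathfinish \<alpha>"
    using hom unfolding homotopic_paths by blast
  have ch: "continuous_on ({0..1} \<times> {0..1}) (\<lambda>x. h x i)" for i
    using continuous_on_product_then_coordinatewise[OF h(1)] .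
  show ?thesis
  proof (rule homotopy_principle[OF _ _ dense local R_trans S])
    fix s :: real assume s: "s \<in> {0..1}"
    have "continuous_on {0..1} ((\<lambda>x. h x i) \<circ> Pair s)" for i by (rule continuous_on_o_Pair[OF ch s])
    then show "based_loop n (\<lambda>t. h (s, t))"
      using h(2,5) s base unfolding based_loop_def by (auto simp: o_def pathstart_def pathfinish_def)
  qed (use h ch in auto)
qed

lemma pure_braid_based_loop:
  assumes "pure_braid n \<beta>" shows "based_loop n \<beta>"
proof -
  have "continuous_on {0..1} (\<lambda>t. \<beta> t i)" if "i \<in> {1..n}" for i
    using assms that by (intro smooth01_continuous) (simp only: pure_braid_def)
  then show ?thesis using assms unfolding based_loop_def pure_braid_def pathstart_def pathfinish_def by simp
qed

lemma pure_braid_path: "pure_braid n \<beta> \<Longrightarrow> path \<beta> \<and> path_image \<beta> \<subseteq> conf n"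
  using pure_braid_based_loop[of n \<beta>] coordinatewise_continuous[of n "{0..1}" \<beta>]
  unfolding path_def path_image_def based_loop_def by auto

text \<open>A braid that extends smoothly by the constant base point to the whole line. Concatenations
  of such braids are smooth.\<close>

definition flat :: "nat \<Rightarrow> (real \<Rightarrow> nat \<Rightarrow> complex) \<Rightarrow> bool" where
  "flat n \<alpha> \<longleftrightarrow> (\<forall>i. smooth_line (\<lambda>t. \<alpha> t i)) \<and> (\<forall>t. t \<le> 0 \<or> 1 \<le> t \<longrightarrow> \<alpha> t = base n) \<and> (\<forall>t\<in>{0..1}. \<alpha> t \<in> conf n)"

lemma flat_pure_braid:
  assumes "flat n \<alpha>" shows "pure_braid n \<alpha>"
  unfolding pure_braid_def pathstart_def pathfinish_def
proof (intro conjI ballI)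
  show "smooth01 (\<lambda>t. \<alpha> t i)" for i
    by (rule smooth_line_smooth01[where g = "\<lambda>t. \<alpha> t i"]) (use assms in \<open>simp_all add: flat_def\<close>)
qed (use assms in \<open>simp_all add: flat_def\<close>)

lemma polygon_flat:
  assumes "polygonal n M P" "\<And>t. t \<in> {0..1} \<Longrightarrow> smooth_polygon M P t \<in> conf n"
  shows "flat n (smooth_polygon M P)"
  using assms smooth_polygon_smooth smooth_polygon_before smooth_polygon_after
  unfolding flat_def polygonal_def by auto

lemma dense_flat_transversal:
  assumes n: "3 \<le> n" and loop: "based_loop n \<gamma>" and e: "0 < \<epsilon>"
  shows "\<exists>\<eta>. flat n \<eta> \<and> transversal n \<eta> \<and> close n \<epsilon> \<gamma> \<eta>"
proof -
  obtain \<epsilon>' where e': "0 < \<epsilon>'" "\<forall>t\<in>{0..1}. conf_box n (\<gamma> t) \<epsilon>' \<subseteq> conf n" using close_in_conf[OF loop] by blast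
  \<comment> \<open>The approximation also has to stay in the configuration space.\<close>
  obtain M P where P: "polygonal n M P" "close n (min \<epsilon> \<epsilon>') \<gamma> (smooth_polygon M P)"
    using polygon_approximation[OF n loop, of "min \<epsilon> \<epsilon>'"] e e'(1) by auto
  have "close n \<epsilon> \<gamma> (smooth_polygon M P)" "close n \<epsilon>' \<gamma> (smooth_polygon M P)"
    using P(2) close_mono by (meson min.cobounded1 min.cobounded2)+
  moreover have "smooth_polygon M P t \<in> conf n" if "t \<in> {0..1}" for t
    using calculation(2) e'(2) that unfolding close_def by blast
  ultimately show ?thesis using polygon_flat[OF P(1)] smooth_polygon_transversal[of M n P] P(1)
    unfolding polygonal_def by blast
qed

lemma flat_transversal_regular:
  assumes "flat n \<eta>" "transversal n \<eta>"
  shows "regular n \<eta> 0 1"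
proof -
  have "based_loop n \<eta>" using pure_braid_based_loop flat_pure_braid assms(1) by blast
  then show ?thesis
    using assms(2) base_noncollinear unfolding based_loop_def by (intro transversal_regular) auto
qed

lemma isotopy_iff_homotopic_with: "(\<alpha>, \<beta>) \<in> isotopy n \<longleftrightarrow> homotopic_with_canon (pure_braid n) {0..1} (conf n) \<alpha> \<beta>"
  by (simp add: isotopy_def)

text \<open>The straight-line homotopy stays in the configuration space if both braids are sufficiently
  close to the same loop.\<close>

lemma close_isotopic:
  assumes loop: "based_loop n \<gamma>"
  shows "\<exists>\<epsilon>>0. \<forall>\<eta> \<eta>'. pure_braid n \<eta> \<and> pure_braid n \<eta>' \<and> close n \<epsilon> \<gamma> \<eta> \<and> close n \<epsilon> \<gamma> \<eta>' \<longrightarrow> (\<eta>, \<eta>') \<in> isotopy n"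
proof -
  obtain \<epsilon> where e: "0 < \<epsilon>" "\<forall>t\<in>{0..1}. conf_box n (\<gamma> t) \<epsilon> \<subseteq> conf n" using close_in_conf[OF loop] by blast
  have "(\<eta>, \<eta>') \<in> isotopy n"
    if pb: "pure_braid n \<eta>" "pure_braid n \<eta>'" and cl: "close n \<epsilon> \<gamma> \<eta>" "close n \<epsilon> \<gamma> \<eta>'" for \<eta> \<eta>'
  proof -
    define h where "h = (\<lambda>(s, t). glide (\<eta> t) (\<eta>' t) s)"
    have hc: "h (s, t) \<in> conf n" if "s \<in> {0..1}" "t \<in> {0..1}" for s t
      using glide_in_box[of "\<eta> t" n "\<gamma> t" \<epsilon> "\<eta>' t" s] that cl e(2) unfolding h_def close_def by auto
    have ch: "continuous_on ({0..1} \<times> {0..1}) h"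
    proof (rule coordinatewise_continuous)
      show "\<forall>i\<in>{1..n}. continuous_on ({0..1} \<times> {0..1}) (\<lambda>x. h x i)"
      proof
        fix i assume i: "i \<in> {1..n}"
        have c: "continuous_on ({0..1} \<times> {0..1}) (\<lambda>x. \<zeta> (snd x) i)" if "pure_braid n \<zeta>" for \<zeta>
        proof -
          have "continuous_on {0..1} (\<lambda>t. \<zeta> t i)" using that i smooth01_continuous unfolding pure_braid_def by blast
          then show ?thesis by (rule continuous_on_compose2) (auto intro: continuous_intros)
        qed
        have "continuous_on ({0..1} \<times> {0..1}) (\<lambda>x. (1 - fst x) *\<^sub>R \<eta> (snd x) i + fst x *\<^sub>R \<eta>' (snd x) i)"
          by (intro continuous_intros c pb)
        then show "continuous_on ({0..1} \<times> {0..1}) (\<lambda>x. h x i)"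
          by (simp add: h_def glide_def case_prod_unfold)
      qed
    qed (use hc in auto)
    have "pure_braid n (\<lambda>t. h (s, t))" if s: "s \<in> {0..1}" for s
      unfolding pure_braid_def
    proof (intro conjI ballI)
      show "h (s, t) \<in> conf n" if "t \<in> {0..1}" for t using hc s that by blast
      show "pathstart (\<lambda>t. h (s, t)) = base n" "pathfinish (\<lambda>t. h (s, t)) = base n"
        using pb by (auto simp: pure_braid_def pathstart_def pathfinish_def h_def)
      show "smooth01 (\<lambda>t. h (s, t) i)" if "i \<in> {1..n}" for i
        using pb that by (auto simp: h_def glide_def pure_braid_def intro!: smooth01_lincomb)
    qed
    then show ?thesis
      using ch hc unfolding isotopy_iff_homotopic_with homotopic_with_def
      by (intro exI[of _ h]) (auto simp: h_def)
  qed
  then show ?thesis using e(1) by blast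
qed

lemma isotopy_trans: "(\<alpha>, \<beta>) \<in> isotopy n \<Longrightarrow> (\<beta>, \<gamma>) \<in> isotopy n \<Longrightarrow> (\<alpha>, \<gamma>) \<in> isotopy n"
  unfolding isotopy_iff_homotopic_with by (rule homotopic_with_trans)

lemma isotopy_sym: "(\<alpha>, \<beta>) \<in> isotopy n \<Longrightarrow> (\<beta>, \<alpha>) \<in> isotopy n"
  unfolding isotopy_iff_homotopic_with by (subst homotopic_with_sym)

lemma isotopy_pure: "(\<alpha>, \<beta>) \<in> isotopy n \<Longrightarrow> pure_braid n \<alpha> \<and> pure_braid n \<beta>"
  using homotopic_with_imp_property isotopy_iff_homotopic_with by blast

text \<open>Smoothness of the stages is no restriction, by the homotopy principle for the relation of
  isotopy. This makes the homotopy theory of paths available for braids.\<close>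

lemma isotopy_iff_homotopic_paths:
  assumes n: "3 \<le> n"
  shows "(\<alpha>, \<beta>) \<in> isotopy n \<longleftrightarrow> pure_braid n \<alpha> \<and> pure_braid n \<beta> \<and> homotopic_paths (conf n) \<alpha> \<beta>"
proof (intro iffI conjI)
  assume iso: "(\<alpha>, \<beta>) \<in> isotopy n"
  then show "pure_braid n \<alpha>" "pure_braid n \<beta>" using isotopy_pure by blast+
  show "homotopic_paths (conf n) \<alpha> \<beta>"
    unfolding homotopic_paths_def
  proof (rule homotopic_with_mono[OF iso[unfolded isotopy_iff_homotopic_with]])
    fix h assume "pure_braid n h"
    then show "pathstart h = pathstart \<alpha> \<and> pathfinish h = pathfinish \<alpha>"
      using \<open>pure_braid n \<alpha>\<close> by (simp add: pure_braid_def)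
  qed
next
  assume a: "pure_braid n \<alpha> \<and> pure_braid n \<beta> \<and> homotopic_paths (conf n) \<alpha> \<beta>"
  show "(\<alpha>, \<beta>) \<in> isotopy n"
  proof (rule homotopic_paths_principle[where S = "Collect (pure_braid n)" and R = "\<lambda>x y. (x, y) \<in> isotopy n"])
    show "\<exists>\<eta>\<in>Collect (pure_braid n). close n \<epsilon> \<gamma> \<eta>" if "based_loop n \<gamma>" "0 < \<epsilon>" for \<gamma> \<epsilon>
      using dense_flat_transversal[OF n that] flat_pure_braid by blast
    show "\<exists>\<epsilon>>0. \<forall>\<eta>\<in>Collect (pure_braid n). \<forall>\<eta>'\<in>Collect (pure_braid n). close n \<epsilon> \<gamma> \<eta> \<and> close n \<epsilon> \<gamma> \<eta>' \<longrightarrow> (\<eta>, \<eta>') \<in> isotopy n"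
      if "based_loop n \<gamma>" for \<gamma> using close_isotopic[OF that] by auto
    show "(x, z) \<in> isotopy n" if "(x, y) \<in> isotopy n" "(y, z) \<in> isotopy n" for x y z using isotopy_trans that by blast
  qed (use a in \<open>auto simp: pure_braid_def\<close>)
qed

text \<open>The homotopy principle for the congruence of words.\<close>

lemma homotopic_words_congruent:
  assumes n: "3 \<le> n" and "based_loop n \<alpha>" "regular n \<alpha> 0 1" "based_loop n \<beta>" "regular n \<beta> 0 1" "homotopic_paths (conf n) \<alpha> \<beta>"
  shows "cong3 n (path_word n \<alpha> 0 1) (path_word n \<beta> 0 1)"
proof (rule homotopic_paths_principle[where S = "{\<eta>. based_loop n \<eta> \<and> regular n \<eta> 0 1}"
      and R = "\<lambda>x y. cong3 n (path_word n x 0 1) (path_word n y 0 1)"])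
  show "\<exists>\<eta>\<in>{\<eta>. based_loop n \<eta> \<and> regular n \<eta> 0 1}. close n \<epsilon> \<gamma> \<eta>" if "based_loop n \<gamma>" "0 < \<epsilon>" for \<gamma> \<epsilon>
    using dense_flat_transversal[OF n that] flat_pure_braid flat_transversal_regular pure_braid_based_loop by blast
  show "\<exists>\<epsilon>>0. \<forall>\<eta>\<in>{\<eta>. based_loop n \<eta> \<and> regular n \<eta> 0 1}. \<forall>\<eta>'\<in>{\<eta>. based_loop n \<eta> \<and> regular n \<eta> 0 1}.
     close n \<epsilon> \<gamma> \<eta> \<and> close n \<epsilon> \<gamma> \<eta>' \<longrightarrow> cong3 n (path_word n \<eta> 0 1) (path_word n \<eta>' 0 1)"
    if "based_loop n \<gamma>" for \<gamma> using close_words_congruent[OF n that] unfolding based_loop_def by auto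
  show "cong3 n (path_word n x 0 1) (path_word n z 0 1)"
    if "cong3 n (path_word n x 0 1) (path_word n y 0 1)" "cong3 n (path_word n y 0 1) (path_word n z 0 1)" for x y z
    using that word_cong.trans by blast
qed (use assms in \<open>auto simp: based_loop_def pathstart_def pathfinish_def\<close>)

section \<open>Stability of simple zeros\<close>

text \<open>A function with simple zeros, none of them at an end point, is strictly monotone near each
  zero and bounded away from zero elsewhere. A \<open>C\<^sup>1\<close>-small perturbation keeps both properties,
  hence has exactly one zero near each zero of \<open>f\<close> and no others.\<close>

lemma simple_zeros_stable:
  fixes f f' :: "real \<Rightarrow> real"
  assumes df: "\<And>t. t \<in> {0..1} \<Longrightarrow> (f has_real_derivative f' t) (at t within {0..1})"
    and cf': "continuous_on {0..1} f'"
    and ends: "f 0 \<noteq> 0" "f 1 \<noteq> 0" and simple: "\<And>t. t \<in> {0..1} \<Longrightarrow> f t = 0 \<Longrightarrow> f' t \<noteq> 0"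
  shows "\<exists>\<kappa>>0. \<forall>g g'. (\<forall>t\<in>{0..1}. (g has_real_derivative g' t) (at t within {0..1}) \<and> \<bar>g t - f t\<bar> < \<kappa> \<and> \<bar>g' t - f' t\<bar> < \<kappa>) \<longrightarrow>
     finite {t \<in> {0..1}. g t = 0} \<and> card {t \<in> {0..1}. g t = 0} = card {t \<in> {0..1}. f t = 0}"
proof -
  define Z where "Z = {t \<in> {0..1}. f t = 0}"
  have cf: "continuous_on {0..1} f" using df by (meson DERIV_continuous_on)
  have Z01: "0 < z" "z < 1" "f z = 0" "f' z \<noteq> 0" if "z \<in> Z" for z
    using that ends simple unfolding Z_def by (auto simp: order.strict_iff_order)
  have finZ: "finite Z" unfolding Z_def
  proof (rule finite_zeros_if_cross[OF cf])
    fix t assume "t \<in> {0..1}" "f t = 0"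
    then have t: "t \<in> Z" by (simp add: Z_def)
    then have "(f has_real_derivative f' t) (at t)"
      using df[of t] Z01(1,2)[OF t] at_within_Icc_at[of 0 t 1] by simp
    then show "crosses f t" using Z01[OF t] by (intro crosses_if_derivative)
  qed simp
  have "\<exists>r>0. \<forall>z\<in>Z. (0 < z - r \<and> z + r < 1) \<and> (\<forall>y\<in>{0..1}. \<bar>y - z\<bar> \<le> r \<longrightarrow> \<bar>f' y - f' z\<bar> < \<bar>f' z\<bar> / 2) \<and> (\<forall>y\<in>Z. y \<noteq> z \<longrightarrow> 2 * r < \<bar>y - z\<bar>)"
  proof (rule finite_common_radius[OF finZ])
    fix z assume z: "z \<in> Z"
    then have "z \<in> {0..1}" by (simp add: Z_def)
    then obtain d where d: "0 < d" "\<forall>y\<in>{0..1}. dist y z < d \<longrightarrow> dist (f' y) (f' z) < \<bar>f' z\<bar> / 2"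
      using cf' Z01(4)[OF z] unfolding continuous_on_iff by (meson half_gt_zero zero_less_abs_iff)
    have "\<exists>r>0. \<forall>y\<in>Z - {z}. 2 * r < \<bar>y - z\<bar>"
    proof (rule finite_common_radius)
      fix y assume "y \<in> Z - {z}"
      then show "\<exists>r>0. 2 * r < \<bar>y - z\<bar>" by (intro exI[of _ "\<bar>y - z\<bar> / 4"]) auto
    qed (use finZ in auto)
    then obtain r where r: "0 < r" "\<forall>y\<in>Z - {z}. 2 * r < \<bar>y - z\<bar>" by blast
    define \<rho> where "\<rho> = Min {d / 2, r, z / 2, (1 - z) / 2}"
    have \<rho>: "\<rho> \<le> d / 2" "\<rho> \<le> r" "\<rho> \<le> z / 2" "\<rho> \<le> (1 - z) / 2"
      unfolding \<rho>_def by (intro Min_le; simp)+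
    have "0 < \<rho>" using d(1) r(1) Z01[OF z] by (simp add: \<rho>_def)
    then show "\<exists>r>0. (0 < z - r \<and> z + r < 1) \<and> (\<forall>y\<in>{0..1}. \<bar>y - z\<bar> \<le> r \<longrightarrow> \<bar>f' y - f' z\<bar> < \<bar>f' z\<bar> / 2) \<and> (\<forall>y\<in>Z. y \<noteq> z \<longrightarrow> 2 * r < \<bar>y - z\<bar>)"
    proof (intro exI[of _ \<rho>] conjI ballI impI)
      show "\<bar>f' y - f' z\<bar> < \<bar>f' z\<bar> / 2" if "y \<in> {0..1}" "\<bar>y - z\<bar> \<le> \<rho>" for y
        using d that \<rho>(1) by (simp add: dist_real_def)
      show "2 * \<rho> < \<bar>y - z\<bar>" if "y \<in> Z" "y \<noteq> z" for y
      proof -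
        have "2 * r < \<bar>y - z\<bar>" using r(2) that by blast
        then show ?thesis using \<rho>(2) by linarith
      qed
      show "0 < z - \<rho>" using \<rho>(3) Z01(1)[OF z] by linarith
      have "1 - z > 0" using Z01(2)[OF z] by linarith
      then show "z + \<rho> < 1" using \<rho>(4) by (simp add: field_simps)
    qed (use \<open>0 < \<rho>\<close> in simp)
  next
    fix z r r' :: real
    assume a: "(0 < z - r \<and> z + r < 1) \<and> (\<forall>y\<in>{0..1}. \<bar>y - z\<bar> \<le> r \<longrightarrow> \<bar>f' y - f' z\<bar> < \<bar>f' z\<bar> / 2) \<and> (\<forall>y\<in>Z. y \<noteq> z \<longrightarrow> 2 * r < \<bar>y - z\<bar>)"
      "0 < r'" "r' \<le> r"
    show "(0 < z - r' \<and> z + r' < 1) \<and> (\<forall>y\<in>{0..1}. \<bar>y - z\<bar> \<le> r' \<longrightarrow> \<bar>f' y - f' z\<bar> < \<bar>f' z\<bar> / 2) \<and> (\<forall>y\<in>Z. y \<noteq> z \<longrightarrow> 2 * r' < \<bar>y - z\<bar>)"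
    proof (intro conjI ballI impI)
      show "\<bar>f' y - f' z\<bar> < \<bar>f' z\<bar> / 2" if "y \<in> {0..1}" "\<bar>y - z\<bar> \<le> r'" for y
        using a(1) that a(3) by (meson order.trans)
      show "2 * r' < \<bar>y - z\<bar>" if "y \<in> Z" "y \<noteq> z" for y
      proof -
        have "2 * r < \<bar>y - z\<bar>" using a(1) that by blast
        then show ?thesis using a(3) by linarith
      qed
    qed (use a in linarith)+
  qed
  then obtain r where r: "0 < r" and rz: "\<And>z. z \<in> Z \<Longrightarrow> 0 < z - r \<and> z + r < 1"
    "\<And>z y. z \<in> Z \<Longrightarrow> y \<in> {0..1} \<Longrightarrow> \<bar>y - z\<bar> \<le> r \<Longrightarrow> \<bar>f' y - f' z\<bar> < \<bar>f' z\<bar> / 2"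
    "\<And>z y. z \<in> Z \<Longrightarrow> y \<in> Z \<Longrightarrow> y \<noteq> z \<Longrightarrow> 2 * r < \<bar>y - z\<bar>" by blast
  have "\<exists>c>0. \<forall>z\<in>Z. 2 * c < \<bar>f' z\<bar>"
  proof (rule finite_common_radius[OF finZ])
    fix z assume "z \<in> Z"
    then show "\<exists>c>0. 2 * c < \<bar>f' z\<bar>" using Z01(4) by (intro exI[of _ "\<bar>f' z\<bar> / 4"]) auto
  qed auto
  then obtain c where c: "0 < c" "\<And>z. z \<in> Z \<Longrightarrow> 2 * c < \<bar>f' z\<bar>" by blast
  \<comment> \<open>Away from its zeros, f is bounded below by its minimum on a compact set.\<close>
  define K where "K = {0..1} - (\<Union>z\<in>Z. ball z r)"
  have "compact K" unfolding K_def by (intro compact_diff open_UN ballI open_ball compact_Icc)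
  moreover have "continuous_on K (\<lambda>t. \<bar>f t\<bar>)"
    by (intro continuous_intros continuous_on_subset[OF cf]) (auto simp: K_def)
  ultimately have "compact ((\<lambda>t. \<bar>f t\<bar>) ` K)" by (rule compact_continuous_image[rotated])
  moreover have "0 \<in> K"
  proof -
    have "0 \<notin> ball z r" if "z \<in> Z" for z using rz(1)[OF that] r by (simp add: dist_real_def)
    then show ?thesis by (auto simp: K_def)
  qed
  ultimately obtain m0 where m0: "m0 \<in> K" "\<And>t. t \<in> K \<Longrightarrow> \<bar>f m0\<bar> \<le> \<bar>f t\<bar>"
    using compact_attains_inf[of "(\<lambda>t. \<bar>f t\<bar>) ` K"] by auto
  have "f m0 \<noteq> 0"
  proof
    assume "f m0 = 0"
    then have "m0 \<in> Z" using m0(1) by (auto simp: Z_def K_def)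
    then show False using m0(1) r by (auto simp: K_def)
  qed
  define \<kappa> where "\<kappa> = Min {c / 2, c * r / 2, \<bar>f m0\<bar>}"
  have \<kappa>: "\<kappa> \<le> c / 2" "\<kappa> \<le> c * r / 2" "\<kappa> \<le> \<bar>f m0\<bar>" "0 < \<kappa>"
    using c(1) r \<open>f m0 \<noteq> 0\<close> unfolding \<kappa>_def by auto
  have "finite {t \<in> {0..1}. g t = 0} \<and> card {t \<in> {0..1}. g t = 0} = card Z"
    if g: "\<And>t. t \<in> {0..1} \<Longrightarrow> (g has_real_derivative g' t) (at t within {0..1})"
      "\<And>t. t \<in> {0..1} \<Longrightarrow> \<bar>g t - f t\<bar> < \<kappa>" "\<And>t. t \<in> {0..1} \<Longrightarrow> \<bar>g' t - f' t\<bar> < \<kappa>" for g g'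
  proof -
    have cg: "continuous_on {0..1} g" using g(1) by (meson DERIV_continuous_on)
    have at: "(h has_real_derivative h' t) (at t)"
      if "\<And>t. t \<in> {0..1} \<Longrightarrow> (h has_real_derivative h' t) (at t within {0..1})" "0 < t" "t < 1" for h h' t
      using that(1)[of t] that(2,3) at_within_Icc_at[of 0 t 1] by simp
    have one: "\<exists>!w. \<bar>w - z\<bar> < r \<and> g w = 0" if z: "z \<in> Z" for z
    proof -
      define \<sigma> where "\<sigma> = sgn (f' z)"
      have sg: "\<sigma> * f' z = \<bar>f' z\<bar>" "\<bar>\<sigma>\<bar> = 1" using Z01(4)[OF z] by (auto simp: \<sigma>_def sgn_if)
      have rz1: "0 < z - r" "z + r < 1" using rz(1)[OF z] by auto
      have df_pos: "c < \<sigma> * f' y" if "\<bar>y - z\<bar> \<le> r" for y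
      proof -
        have y: "y \<in> {0..1}" using that rz1 unfolding atLeastAtMost_iff by linarith
        have "\<bar>\<sigma> * f' y - \<sigma> * f' z\<bar> = \<bar>f' y - f' z\<bar>"
          using sg(2) by (simp add: abs_mult flip: right_diff_distrib)
        then show ?thesis using rz(2)[OF z y that] c(2)[OF z] sg(1) by linarith
      qed
      have dg_pos: "c / 2 < \<sigma> * g' y" if "\<bar>y - z\<bar> \<le> r" for y
      proof -
        have y: "y \<in> {0..1}" using that rz1 unfolding atLeastAtMost_iff by linarith
        have "\<bar>\<sigma> * g' y - \<sigma> * f' y\<bar> = \<bar>g' y - f' y\<bar>"
          using sg(2) by (simp add: abs_mult flip: right_diff_distrib)
        then show ?thesis using g(3)[OF y] \<kappa>(1) df_pos[OF that] by linarith
      qed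
      have inc: "\<exists>l. h y - h x = (y - x) * l \<and> (\<exists>t. \<bar>t - z\<bar> \<le> r \<and> l = h' t)"
        if h: "\<And>t. t \<in> {0..1} \<Longrightarrow> (h has_real_derivative h' t) (at t within {0..1})" and xy: "z - r \<le> x" "x < y" "y \<le> z + r" for h h' x y
      proof -
        have "\<exists>l t. x < t \<and> t < y \<and> (h has_real_derivative l) (at t) \<and> h y - h x = (y - x) * l"
        proof (rule MVT[OF xy(2)])
          show "continuous_on {x..y} h"
            by (rule continuous_on_subset[OF DERIV_continuous_on[OF h]]) (use xy rz1 in auto)
          show "h differentiable (at t)" if "x < t" "t < y" for t
            using at[OF h, of t] that xy rz1 by (auto simp: real_differentiable_def)
        qed
        then obtain l t where lt: "x < t" "t < y" "(h has_real_derivative l) (at t)" "h y - h x = (y - x) * l" by blast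
        have "l = h' t" using DERIV_unique[OF lt(3) at[OF h]] lt xy rz1 by auto
        moreover have "\<bar>t - z\<bar> \<le> r" using lt xy by linarith
        ultimately show ?thesis using lt(4) by blast
      qed
      have "\<exists>l. f (z + r) - f z = (z + r - z) * l \<and> (\<exists>t. \<bar>t - z\<bar> \<le> r \<and> l = f' t)"
        using r by (intro inc[OF df]) auto
      then obtain t1 where t1: "\<bar>t1 - z\<bar> \<le> r" "f (z + r) = r * f' t1" using Z01(3)[OF z] by auto
      have "\<exists>l. f z - f (z - r) = (z - (z - r)) * l \<and> (\<exists>t. \<bar>t - z\<bar> \<le> r \<and> l = f' t)"
        using r by (intro inc[OF df]) auto
      then obtain t2 where t2: "\<bar>t2 - z\<bar> \<le> r" "f (z - r) = - (r * f' t2)" using Z01(3)[OF z] by auto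
      have "c * r < \<sigma> * f (z + r)" using mult_strict_right_mono[OF df_pos[OF t1(1)] r] t1(2) by (simp add: mult_ac)
      moreover have "\<bar>\<sigma> * g (z + r) - \<sigma> * f (z + r)\<bar> = \<bar>g (z + r) - f (z + r)\<bar>"
        using sg(2) by (simp add: abs_mult flip: right_diff_distrib)
      moreover have "0 < c * r" using c(1) r by simp
      ultimately have gp: "0 < \<sigma> * g (z + r)" using g(2)[of "z + r"] \<kappa>(2) rz1 r by auto
      have "\<sigma> * f (z - r) < - (c * r)" using mult_strict_right_mono[OF df_pos[OF t2(1)] r] t2(2) by (simp add: mult_ac)
      moreover have "\<bar>\<sigma> * g (z - r) - \<sigma> * f (z - r)\<bar> = \<bar>g (z - r) - f (z - r)\<bar>"
        using sg(2) by (simp add: abs_mult flip: right_diff_distrib)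
      ultimately have gm: "\<sigma> * g (z - r) < 0" using g(2)[of "z - r"] \<kappa>(2) rz1 r \<open>0 < c * r\<close> by auto
      have cont: "continuous_on {z - r..z + r} (\<lambda>t. \<sigma> * g t)"
        by (intro continuous_intros continuous_on_subset[OF cg]) (use rz1 in auto)
      obtain w where w: "z - r \<le> w" "w \<le> z + r" "\<sigma> * g w = 0"
        using IVT'[of "\<lambda>t. \<sigma> * g t" "z - r" 0 "z + r", OF _ _ _ cont] gp gm r by auto
      have "g w = 0" using w(3) sg(2) by auto
      moreover have "w \<noteq> z - r" "w \<noteq> z + r" using gp gm w(3) by auto
      ultimately have w': "\<bar>w - z\<bar> < r" "g w = 0" using w by auto
      have less: False if "\<bar>x - z\<bar> < r" "\<bar>y - z\<bar> < r" "g x = 0" "g y = 0" "x < y" for x y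
      proof -
        have "\<exists>l. g y - g x = (y - x) * l \<and> (\<exists>t. \<bar>t - z\<bar> \<le> r \<and> l = g' t)"
          using that by (intro inc[OF g(1)]) auto
        then obtain t where t: "\<bar>t - z\<bar> \<le> r" "g y - g x = (y - x) * g' t" by blast
        have "(y - x) * g' t = 0" using t(2) \<open>g x = 0\<close> \<open>g y = 0\<close> by simp
        with t(1) show False using dg_pos[of t] c(1) that(5) by auto
      qed
      show ?thesis
      proof (rule ex1I[of _ w])
        show "\<bar>w - z\<bar> < r \<and> g w = 0" using w' by simp
        show "y = w" if "\<bar>y - z\<bar> < r \<and> g y = 0" for y
          using less[of y w] less[of w y] that w' by (metis linorder_neqE_linordered_idom)
      qed
    qed
    then obtain w where w: "\<And>z. z \<in> Z \<Longrightarrow> \<bar>w z - z\<bar> < r \<and> g (w z) = 0"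
      "\<And>z y. z \<in> Z \<Longrightarrow> \<bar>y - z\<bar> < r \<Longrightarrow> g y = 0 \<Longrightarrow> y = w z" by metis
    have "inj_on w Z"
    proof (rule inj_onI)
      fix x y assume xy: "x \<in> Z" "y \<in> Z" "w x = w y"
      show "x = y"
      proof (rule ccontr)
        assume "x \<noteq> y"
        then have "2 * r < \<bar>x - y\<bar>" using rz(3)[OF xy(2,1)] by blast
        then show False using w(1)[OF xy(1)] w(1)[OF xy(2)] xy(3) by linarith
      qed
    qed
    moreover have "{t \<in> {0..1}. g t = 0} = w ` Z"
    proof (intro equalityI subsetI)
      fix t assume "t \<in> w ` Z"
      then obtain z where z: "z \<in> Z" "t = w z" by blast
      have "t \<in> {0..1}" using rz(1)[OF z(1)] w(1)[OF z(1)] z(2) unfolding atLeastAtMost_iff by linarith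
      then show "t \<in> {t \<in> {0..1}. g t = 0}" using w(1)[OF z(1)] z(2) by simp
    next
      fix t assume t: "t \<in> {t \<in> {0..1}. g t = 0}"
      have "t \<notin> K"
      proof
        assume "t \<in> K"
        then have "\<kappa> \<le> \<bar>f t\<bar>" using m0(2) \<kappa>(3) by force
        then show False using g(2)[of t] t by auto
      qed
      then obtain z where z: "z \<in> Z" "\<bar>t - z\<bar> < r" using t by (auto simp: K_def dist_real_def abs_minus_commute)
      then show "t \<in> w ` Z" using w(2)[OF z] t by auto
    qed
    ultimately show ?thesis using finZ by (simp add: card_image)
  qed
  then show ?thesis using \<kappa>(4) unfolding Z_def by (intro exI[of _ \<kappa>]) blast
qed

section \<open>Transversal braids are good and stable\<close>

lemma critical_moments_eq: "critical_moments n \<beta> = crit_in n \<beta> 0 1"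
  by (simp add: critical_moments_def crit_in_def)

lemma braid_word_eq: "braid_word n \<beta> = path_word n \<beta> 0 1"
  by (simp add: braid_word_def path_word_def critical_moments_eq)

definition velocity :: "(real \<Rightarrow> nat \<Rightarrow> complex) \<Rightarrow> real \<Rightarrow> nat \<Rightarrow> complex" where
  "velocity \<gamma> t i = deriv01 1 (\<lambda>t. \<gamma> t i) t"

text \<open>The derivative of \<open>orient\<close> at \<open>z\<close> in the direction \<open>v\<close>.\<close>

definition orient_rate :: "(nat \<Rightarrow> complex) \<Rightarrow> (nat \<Rightarrow> complex) \<Rightarrow> nat \<Rightarrow> nat \<Rightarrow> nat \<Rightarrow> real" where
  "orient_rate z v i j k = Im (cnj (v j - v i) * (z k - z i)) + Im (cnj (z j - z i) * (v k - v i))"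

lemma pure_braid_derivative:
  assumes "pure_braid n \<gamma>" "i \<in> {1..n}" "t \<in> {0..1}"
  shows "((\<lambda>t. \<gamma> t i) has_vector_derivative velocity \<gamma> t i) (at t within {0..1})"
    and "continuous_on {0..1} (\<lambda>t. velocity \<gamma> t i)"
proof -
  have s: "smooth01 (\<lambda>t. \<gamma> t i)" using assms by (simp only: pure_braid_def)
  have d: "derivs01 (\<lambda>k. deriv01 k (\<lambda>t. \<gamma> t i)) (\<lambda>t. \<gamma> t i)" by (rule smooth01_derivs01[OF s])
  have "deriv01 0 g = g" for g by (simp add: deriv01_def)
  then show "((\<lambda>t. \<gamma> t i) has_vector_derivative velocity \<gamma> t i) (at t within {0..1})"
    using d assms(3) unfolding derivs01_def velocity_def by (metis One_nat_def)
  have "deriv01 1 (\<lambda>t. \<gamma> t i) differentiable_on {0..1}" using s by (simp only: smooth01_def)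
  then show "continuous_on {0..1} (\<lambda>t. velocity \<gamma> t i)"
    unfolding velocity_def by (rule differentiable_imp_continuous_on)
qed

lemma orient_derivative:
  assumes "pure_braid n \<gamma>" "{i, j, k} \<subseteq> {1..n}" "t \<in> {0..1}"
  shows "((\<lambda>t. orient (\<gamma> t) i j k) has_real_derivative orient_rate (\<gamma> t) (velocity \<gamma> t) i j k) (at t within {0..1})"
proof -
  have d: "((\<lambda>t. \<gamma> t l) has_vector_derivative velocity \<gamma> t l) (at t within {0..1})" if "l \<in> {i, j, k}" for l
    using pure_braid_derivative(1)[OF assms(1) _ assms(3), of l] that assms(2) by blast
  have c: "((\<lambda>t. cnj (\<gamma> t j - \<gamma> t i)) has_vector_derivative cnj (velocity \<gamma> t j - velocity \<gamma> t i)) (at t within {0..1})"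
    by (intro bounded_linear.has_vector_derivative[OF bounded_linear_cnj] has_vector_derivative_diff d) auto
  have e: "((\<lambda>t. \<gamma> t k - \<gamma> t i) has_vector_derivative velocity \<gamma> t k - velocity \<gamma> t i) (at t within {0..1})"
    by (intro has_vector_derivative_diff d) auto
  have "((\<lambda>t. Im (cnj (\<gamma> t j - \<gamma> t i) * (\<gamma> t k - \<gamma> t i))) has_vector_derivative
      Im (cnj (\<gamma> t j - \<gamma> t i) * (velocity \<gamma> t k - velocity \<gamma> t i) + cnj (velocity \<gamma> t j - velocity \<gamma> t i) * (\<gamma> t k - \<gamma> t i))) (at t within {0..1})"
    by (intro bounded_linear.has_vector_derivative[OF bounded_linear_Im] has_vector_derivative_mult c e)
  then show ?thesis
    unfolding has_real_derivative_iff_has_vector_derivative orient_def orient_rate_def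
    by (simp only: plus_complex.sel add.commute)
qed

lemma orient_rate_continuous:
  assumes "pure_braid n \<gamma>" "{i, j, k} \<subseteq> {1..n}"
  shows "continuous_on {0..1} (\<lambda>t. orient_rate (\<gamma> t) (velocity \<gamma> t) i j k)"
proof -
  have "continuous_on {0..1} (\<lambda>t. \<gamma> t l)" "continuous_on {0..1} (\<lambda>t. velocity \<gamma> t l)" if "l \<in> {i, j, k}" for l
  proof -
    have l: "l \<in> {1..n}" using that assms(2) by blast
    then show "continuous_on {0..1} (\<lambda>t. \<gamma> t l)"
      using pure_braid_based_loop[OF assms(1)] unfolding based_loop_def by blast
    show "continuous_on {0..1} (\<lambda>t. velocity \<gamma> t l)"
      using pure_braid_derivative(2)[OF assms(1) l, of 0] by simp
  qed
  then show ?thesis unfolding orient_rate_def by (intro continuous_intros) auto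
qed

lemma bilinear_difference:
  fixes a b a' b' :: complex
  assumes "norm a \<le> K" "norm b \<le> K" "norm (a' - a) \<le> e" "norm (b' - b) \<le> e" "e \<le> 1"
  shows "\<bar>Im (cnj a' * b') - Im (cnj a * b)\<bar> \<le> e * (2 * K + 1)"
proof -
  have e: "0 \<le> e" "0 \<le> K" using assms(1,3) norm_ge_zero[of a] norm_ge_zero[of "a' - a"] by linarith+
  have b': "norm b' \<le> K + 1"
    using norm_triangle_ineq[of "b' - b" b] assms(2,4,5) by simp
  have "cnj a' * b' - cnj a * b = cnj (a' - a) * b' + cnj a * (b' - b)" by (simp add: algebra_simps)
  then have "\<bar>Im (cnj a' * b') - Im (cnj a * b)\<bar> \<le> norm (cnj (a' - a) * b' + cnj a * (b' - b))"
    by (metis abs_Im_le_cmod minus_complex.sel(2))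
  also have "\<dots> \<le> norm (a' - a) * norm b' + norm a * norm (b' - b)"
    by (rule order.trans[OF norm_triangle_ineq]) (simp add: norm_mult flip: complex_cnj_diff)
  also have "\<dots> \<le> e * (K + 1) + K * e"
    using assms b' e by (intro add_mono mult_mono) auto
  finally show ?thesis by (simp add: algebra_simps)
qed

lemma orient_close:
  assumes pb: "pure_braid n \<gamma>" and \<kappa>: "0 < \<kappa>"
  shows "\<exists>\<epsilon>>0. \<forall>t\<in>{0..1}. \<forall>z v. (\<forall>i\<in>{1..n}. norm (z i - \<gamma> t i) < \<epsilon>) \<longrightarrow>
     (\<forall>i j k. {i, j, k} \<subseteq> {1..n} \<longrightarrow> \<bar>orient z i j k - orient (\<gamma> t) i j k\<bar> < \<kappa> \<and>
       ((\<forall>i\<in>{1..n}. norm (v i - velocity \<gamma> t i) < \<epsilon>) \<longrightarrow>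
         \<bar>orient_rate z v i j k - orient_rate (\<gamma> t) (velocity \<gamma> t) i j k\<bar> < \<kappa>))"
proof -
  \<comment> \<open>The reciprocal of a common bound of positions and velocities, so that smaller values are
    admissible too.\<close>
  have "\<exists>B>0. \<forall>i\<in>{1..n}. \<forall>t\<in>{0..1}. norm (\<gamma> t i) \<le> 1 / B \<and> norm (velocity \<gamma> t i) \<le> 1 / B"
  proof (rule finite_common_radius)
    fix i assume i: "i \<in> {1..n}"
    have c: "continuous_on {0..1} (\<lambda>t. \<gamma> t i)" using pure_braid_based_loop[OF pb] i unfolding based_loop_def by blast
    have c': "continuous_on {0..1} (\<lambda>t. velocity \<gamma> t i)" using pure_braid_derivative(2)[OF pb i, of 0] by simp
    obtain a where a: "0 < a" "\<forall>t\<in>{0..1}. norm (\<gamma> t i) \<le> a"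
      using compact_imp_bounded[OF compact_continuous_image[OF c compact_Icc]] unfolding bounded_pos by auto
    obtain b where b: "0 < b" "\<forall>t\<in>{0..1}. norm (velocity \<gamma> t i) \<le> b"
      using compact_imp_bounded[OF compact_continuous_image[OF c' compact_Icc]] unfolding bounded_pos by auto
    have "norm (\<gamma> t i) \<le> 1 / (1 / (a + b)) \<and> norm (velocity \<gamma> t i) \<le> 1 / (1 / (a + b))" if "t \<in> {0..1}" for t
      using a b that by (auto intro: add_increasing add_increasing2 less_imp_le)
    then show "\<exists>B>0. \<forall>t\<in>{0..1}. norm (\<gamma> t i) \<le> 1 / B \<and> norm (velocity \<gamma> t i) \<le> 1 / B"
      using a(1) b(1) by (intro exI[of _ "1 / (a + b)"]) auto
  next
    fix i B B' :: real and i' :: nat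
    assume "\<forall>t\<in>{0..1}. norm (\<gamma> t i') \<le> 1 / B \<and> norm (velocity \<gamma> t i') \<le> 1 / B" "0 < B'" "B' \<le> B"
    moreover have "1 / B \<le> 1 / B'" using calculation by (intro divide_left_mono) auto
    ultimately show "\<forall>t\<in>{0..1}. norm (\<gamma> t i') \<le> 1 / B' \<and> norm (velocity \<gamma> t i') \<le> 1 / B'" by (meson order.trans)
  qed simp
  then obtain B0 where B0: "0 < B0" "\<forall>i\<in>{1..n}. \<forall>t\<in>{0..1}. norm (\<gamma> t i) \<le> 1 / B0 \<and> norm (velocity \<gamma> t i) \<le> 1 / B0" by blast
  define K where "K = 2 / B0"
  have K: "0 < K" using B0 by (simp add: K_def)
  define \<epsilon> where "\<epsilon> = min (1 / 2) (\<kappa> / (8 * (2 * K + 1)))"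
  have e: "0 < \<epsilon>" "2 * \<epsilon> \<le> 1" using K \<kappa> by (auto simp: \<epsilon>_def)
  have "\<epsilon> * (8 * (2 * K + 1)) \<le> \<kappa>"
  proof -
    have "\<epsilon> \<le> \<kappa> / (8 * (2 * K + 1))" by (simp add: \<epsilon>_def)
    then show ?thesis using K by (subst (asm) pos_le_divide_eq) auto
  qed
  then have small: "2 * (2 * \<epsilon> * (2 * K + 1)) < \<kappa>" using \<kappa> by linarith
  have pos: "0 \<le> 2 * \<epsilon> * (2 * K + 1)" using e K by simp
  show ?thesis
  proof (intro exI[of _ \<epsilon>] conjI ballI allI impI)
    fix t z v i j k
    assume t: "t \<in> {0..1::real}" and z: "\<forall>i\<in>{1..n}. norm (z i - \<gamma> t i) < \<epsilon>" and ijk: "{i, j, k} \<subseteq> {1..n}"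
    have near: "norm ((z a - z b) - (\<gamma> t a - \<gamma> t b)) \<le> 2 * \<epsilon>" if "a \<in> {1..n}" "b \<in> {1..n}" for a b
    proof -
      have "norm ((z a - \<gamma> t a) - (z b - \<gamma> t b)) \<le> norm (z a - \<gamma> t a) + norm (z b - \<gamma> t b)" by (rule norm_triangle_ineq4)
      moreover have "norm (z a - \<gamma> t a) < \<epsilon>" "norm (z b - \<gamma> t b) < \<epsilon>" using z that by blast+
      ultimately show ?thesis by (simp add: algebra_simps)
    qed
    have bd: "norm (\<gamma> t a - \<gamma> t b) \<le> K" "norm (velocity \<gamma> t a - velocity \<gamma> t b) \<le> K" if "a \<in> {1..n}" "b \<in> {1..n}" for a b
    proof -
      have "norm (\<gamma> t a) \<le> 1 / B0" "norm (\<gamma> t b) \<le> 1 / B0" "norm (velocity \<gamma> t a) \<le> 1 / B0" "norm (velocity \<gamma> t b) \<le> 1 / B0"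
        using B0(2) t that by blast+
      then show "norm (\<gamma> t a - \<gamma> t b) \<le> K" "norm (velocity \<gamma> t a - velocity \<gamma> t b) \<le> K"
        using norm_triangle_ineq4[of "\<gamma> t a" "\<gamma> t b"] norm_triangle_ineq4[of "velocity \<gamma> t a" "velocity \<gamma> t b"]
        unfolding K_def by linarith+
    qed
    have m: "i \<in> {1..n}" "j \<in> {1..n}" "k \<in> {1..n}" using ijk by auto
    have "\<bar>orient z i j k - orient (\<gamma> t) i j k\<bar> \<le> 2 * \<epsilon> * (2 * K + 1)"
      unfolding orient_def by (rule bilinear_difference) (use bd near m e in auto)
    then show "\<bar>orient z i j k - orient (\<gamma> t) i j k\<bar> < \<kappa>" using small pos by linarith
    assume v: "\<forall>i\<in>{1..n}. norm (v i - velocity \<gamma> t i) < \<epsilon>"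
    have nearv: "norm ((v a - v b) - (velocity \<gamma> t a - velocity \<gamma> t b)) \<le> 2 * \<epsilon>" if "a \<in> {1..n}" "b \<in> {1..n}" for a b
    proof -
      have "norm ((v a - velocity \<gamma> t a) - (v b - velocity \<gamma> t b)) \<le> norm (v a - velocity \<gamma> t a) + norm (v b - velocity \<gamma> t b)" by (rule norm_triangle_ineq4)
      moreover have "norm (v a - velocity \<gamma> t a) < \<epsilon>" "norm (v b - velocity \<gamma> t b) < \<epsilon>" using v that by blast+
      ultimately show ?thesis by (simp add: algebra_simps)
    qed
    have 1: "\<bar>Im (cnj (v j - v i) * (z k - z i)) - Im (cnj (velocity \<gamma> t j - velocity \<gamma> t i) * (\<gamma> t k - \<gamma> t i))\<bar> \<le> 2 * \<epsilon> * (2 * K + 1)"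
      by (rule bilinear_difference) (use bd near nearv m e in auto)
    have 2: "\<bar>Im (cnj (z j - z i) * (v k - v i)) - Im (cnj (\<gamma> t j - \<gamma> t i) * (velocity \<gamma> t k - velocity \<gamma> t i))\<bar> \<le> 2 * \<epsilon> * (2 * K + 1)"
      by (rule bilinear_difference) (use bd near nearv m e in auto)
    show "\<bar>orient_rate z v i j k - orient_rate (\<gamma> t) (velocity \<gamma> t) i j k\<bar> < \<kappa>"
      unfolding orient_rate_def using 1 2 small by linarith
  qed (rule e(1))
qed

text \<open>Each set of three indices occurs exactly once, so critical moments can be counted triple by
  triple.\<close>

definition sorted_triples :: "nat \<Rightarrow> (nat \<times> nat \<times> nat) set" where
  "sorted_triples n = {(i, j, k). {i, j, k} \<subseteq> {1..n} \<and> i < j \<and> j < k}"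

lemma finite_sorted_triples: "finite (sorted_triples n)"
proof (rule finite_subset[OF _ finite_triples[of n]])
  show "sorted_triples n \<subseteq> {(i, j, k). {i, j, k} \<subseteq> {1..n} \<and> distinct [i, j, k]}"
    unfolding sorted_triples_def by auto
qed

abbreviation orient3 :: "(nat \<Rightarrow> complex) \<Rightarrow> nat \<times> nat \<times> nat \<Rightarrow> real" where
  "orient3 z x \<equiv> orient z (fst x) (fst (snd x)) (snd (snd x))"

abbreviation triple_set :: "nat \<times> nat \<times> nat \<Rightarrow> nat set" where
  "triple_set x \<equiv> {fst x, fst (snd x), snd (snd x)}"

lemma collinear_triple_sorted:
  "collinear_triple n z T \<longleftrightarrow> (\<exists>x\<in>sorted_triples n. T = triple_set x \<and> orient3 z x = 0)"
proof
  assume T: "collinear_triple n z T"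
  then obtain i j k where ijk: "T = {i, j, k}" "{i, j, k} \<subseteq> {1..n}" "distinct [i, j, k]" "orient z i j k = 0"
    unfolding collinear_triple_iff by blast
  have in_T: "(a, b, c) \<in> sorted_triples n \<and> T = triple_set (a, b, c) \<and> orient3 z (a, b, c) = 0"
    if "{a, b, c} = {i, j, k}" "a < b" "b < c" for a b c
  proof -
    have "collinear (z ` {a, b, c})" using T ijk(1) that(1) by (simp add: collinear_triple_def)
    then have "orient z a b c = 0" using collinear_iff_orient[of z a b c] by simp
    moreover have "{a, b, c} \<subseteq> {1..n}" "T = {a, b, c}" using that(1) ijk(1,2) by simp_all
    ultimately show ?thesis using that(2,3) by (simp add: sorted_triples_def)
  qed
  have "i \<noteq> j" "i \<noteq> k" "j \<noteq> k" using ijk(3) by auto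
  then consider "i < j" "j < k" | "i < k" "k < j" | "j < i" "i < k" | "j < k" "k < i" | "k < i" "i < j" | "k < j" "j < i"
    by linarith
  then have "\<exists>a b c. {a, b, c} = {i, j, k} \<and> a < b \<and> b < c" by cases (blast intro: insert_commute)+
  then show "\<exists>x\<in>sorted_triples n. T = triple_set x \<and> orient3 z x = 0" using in_T by metis
next
  assume "\<exists>x\<in>sorted_triples n. T = triple_set x \<and> orient3 z x = 0"
  then obtain x where x: "x \<in> sorted_triples n" "T = triple_set x" "orient3 z x = 0" by blast
  then show "collinear_triple n z T"
    by (cases x) (auto simp: sorted_triples_def intro!: collinear_tripleI)
qed

lemma sorted_triples_eqI:
  assumes "x \<in> sorted_triples n" "y \<in> sorted_triples n" "triple_set x = triple_set y"
  shows "x = y"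
proof -
  obtain a b c d e f where [simp]: "x = (a, b, c)" "y = (d, e, f)" by (cases x; cases y) auto
  have o: "a < b" "b < c" "d < e" "e < f" "{a, b, c} = {d, e, f}" using assms by (auto simp: sorted_triples_def)
  have "[a, b, c] = [d, e, f]"
    by (rule sorted_distinct_set_unique) (use o in \<open>simp_all add: order.strict_implies_order\<close>)
  then show ?thesis by simp
qed

text \<open>For a transversal braid the number of critical moments is the sum over all triples of the
  numbers of zeros of the orientations. Under perturbations small in \<open>C\<^sup>1\<close> each of these
  numbers is preserved, and two orientations still do not vanish simultaneously.\<close>

lemma transversal_stable:
  assumes pb: "pure_braid n \<gamma>" and tr: "transversal n \<gamma>"
  shows "stable n \<gamma>"
proof -
  let ?I = "sorted_triples n"
  have sub: "triple_set x \<subseteq> {1..n}" and dis: "distinct [fst x, fst (snd x), snd (snd x)]" if "x \<in> ?I" for x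
    using that by (auto simp: sorted_triples_def)
  let ?Z = "\<lambda>\<eta> x. {t \<in> {0..1}. orient3 (\<eta> t) x = 0}"
  let ?rate = "\<lambda>\<eta> t x. orient_rate (\<eta> t) (velocity \<eta> t) (fst x) (fst (snd x)) (snd (snd x))"
  have ends: "\<gamma> 0 = base n" "\<gamma> 1 = base n" using pb by (auto simp: pure_braid_def pathstart_def pathfinish_def)
  have crit: "crit_in n \<eta> 0 1 = (\<Union>x\<in>?I. ?Z \<eta> x)" for \<eta>
    unfolding crit_in_def collinear_triple_sorted by auto
  have nz_base: "orient3 (base n) x \<noteq> 0" if "x \<in> ?I" for x
    using base_noncollinear[of n] sub[OF that] dis[OF that] unfolding noncollinear_def by auto
  have simple: "\<exists>\<kappa>>0. \<forall>g g'. (\<forall>t\<in>{0..1}. (g has_real_derivative g' t) (at t within {0..1}) \<and> \<bar>g t - orient3 (\<gamma> t) x\<bar> < \<kappa> \<and>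
      \<bar>g' t - ?rate \<gamma> t x\<bar> < \<kappa>) \<longrightarrow> finite {t \<in> {0..1}. g t = 0} \<and> card {t \<in> {0..1}. g t = 0} = card (?Z \<gamma> x)" if x: "x \<in> ?I" for x
  proof (rule simple_zeros_stable[OF orient_derivative[OF pb sub[OF x]] orient_rate_continuous[OF pb sub[OF x]]])
    show "orient3 (\<gamma> 0) x \<noteq> 0" "orient3 (\<gamma> 1) x \<noteq> 0" using nz_base[OF x] ends by auto
    fix t assume t: "t \<in> {0..1::real}" "orient3 (\<gamma> t) x = 0"
    then have tc: "t \<in> crit_in n \<gamma> 0 1" unfolding crit using x by blast
    have "t \<noteq> 0" "t \<noteq> 1" using t(2) nz_base[OF x] ends by auto
    then have "0 < t" "t < 1" using t(1) by auto
    obtain D where D: "D \<noteq> 0" "((\<lambda>s. orient3 (\<gamma> s) x) has_real_derivative D) (at t)"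
      using tr tc sub[OF x] dis[OF x] t(2) unfolding transversal_def by meson
    have "((\<lambda>s. orient3 (\<gamma> s) x) has_real_derivative ?rate \<gamma> t x) (at t)"
      using orient_derivative[OF pb sub[OF x] t(1)] at_within_Icc_at[OF \<open>0 < t\<close> \<open>t < 1\<close>] by simp
    then show "?rate \<gamma> t x \<noteq> 0" using DERIV_unique[OF D(2)] D(1) by blast
  qed
  have "\<exists>\<kappa>>0. \<forall>x\<in>?I. \<forall>g g'. (\<forall>t\<in>{0..1}. (g has_real_derivative g' t) (at t within {0..1}) \<and> \<bar>g t - orient3 (\<gamma> t) x\<bar> < \<kappa> \<and>
      \<bar>g' t - ?rate \<gamma> t x\<bar> < \<kappa>) \<longrightarrow> finite {t \<in> {0..1}. g t = 0} \<and> card {t \<in> {0..1}. g t = 0} = card (?Z \<gamma> x)"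
    using simple by (rule finite_common_radius[OF finite_sorted_triples]) (meson less_le_trans)+
  then obtain \<kappa>1 where k1: "0 < \<kappa>1" "\<forall>x\<in>?I. \<forall>g g'. (\<forall>t\<in>{0..1}. (g has_real_derivative g' t) (at t within {0..1}) \<and> \<bar>g t - orient3 (\<gamma> t) x\<bar> < \<kappa>1 \<and>
      \<bar>g' t - ?rate \<gamma> t x\<bar> < \<kappa>1) \<longrightarrow> finite {t \<in> {0..1}. g t = 0} \<and> card {t \<in> {0..1}. g t = 0} = card (?Z \<gamma> x)"
    by (elim exE conjE) (rule that)
  have "\<exists>\<kappa>>0. \<forall>x\<in>?I \<times> ?I. fst x \<noteq> snd x \<longrightarrow> (\<forall>t\<in>{0..1}. 2 * \<kappa> \<le> \<bar>orient3 (\<gamma> t) (fst x)\<bar> + \<bar>orient3 (\<gamma> t) (snd x)\<bar>)"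
  proof (rule finite_common_radius)
    fix xy assume "xy \<in> ?I \<times> ?I"
    then obtain x y where xy: "xy = (x, y)" "x \<in> ?I" "y \<in> ?I" by auto
    show "\<exists>\<kappa>>0. fst xy \<noteq> snd xy \<longrightarrow> (\<forall>t\<in>{0..1}. 2 * \<kappa> \<le> \<bar>orient3 (\<gamma> t) (fst xy)\<bar> + \<bar>orient3 (\<gamma> t) (snd xy)\<bar>)"
    proof (cases "x = y")
      case False
      let ?f = "\<lambda>t. \<bar>orient3 (\<gamma> t) x\<bar> + \<bar>orient3 (\<gamma> t) y\<bar>"
      have "\<forall>i\<in>{1..n}. continuous_on {0..1} (\<lambda>t. \<gamma> t i)" using pure_braid_based_loop[OF pb] by (simp add: based_loop_def)
      then have "continuous_on {0..1} ?f"
        using sub[OF xy(2)] sub[OF xy(3)] by (intro continuous_intros orient_continuous_on)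
      then obtain t0 where t0: "t0 \<in> {0..1}" "\<And>t. t \<in> {0..1} \<Longrightarrow> ?f t0 \<le> ?f t"
        using continuous_attains_inf[of "{0..1::real}" ?f] by auto
      have "?f t0 \<noteq> 0"
      proof
        assume "?f t0 = 0"
        then have z: "orient3 (\<gamma> t0) x = 0" "orient3 (\<gamma> t0) y = 0" by linarith+
        then have "collinear_triple n (\<gamma> t0) (triple_set x)" "collinear_triple n (\<gamma> t0) (triple_set y)"
          using xy(2,3) unfolding collinear_triple_sorted by blast+
        moreover have "\<exists>!T. collinear_triple n (\<gamma> t0) T"
          using tr t0(1) calculation(1) unfolding transversal_def crit_in_def by blast
        ultimately have "triple_set x = triple_set y" by blast
        then show False using sorted_triples_eqI[OF xy(2,3)] False by blast
      qed
      then have "0 < ?f t0" by linarith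
      moreover have "2 * (?f t0 / 2) \<le> ?f t" if "t \<in> {0..1}" for t
      proof -
        have "2 * (u / 2) = u" for u :: real by simp
        then show ?thesis using t0(2)[OF that] by (simp only:)
      qed
      ultimately show ?thesis unfolding xy(1) fst_conv snd_conv
        by (intro exI[of _ "?f t0 / 2"] conjI impI ballI half_gt_zero)
    qed (auto simp: xy(1) intro: exI[of _ 1])
  next
    fix x :: "(nat \<times> nat \<times> nat) \<times> (nat \<times> nat \<times> nat)" and d d' :: real
    assume a: "fst x \<noteq> snd x \<longrightarrow> (\<forall>t\<in>{0..1}. 2 * d \<le> \<bar>orient3 (\<gamma> t) (fst x)\<bar> + \<bar>orient3 (\<gamma> t) (snd x)\<bar>)" "0 < d'" "d' \<le> d"
    show "fst x \<noteq> snd x \<longrightarrow> (\<forall>t\<in>{0..1}. 2 * d' \<le> \<bar>orient3 (\<gamma> t) (fst x)\<bar> + \<bar>orient3 (\<gamma> t) (snd x)\<bar>)"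
    proof (intro impI ballI)
      fix t :: real assume "fst x \<noteq> snd x" "t \<in> {0..1}"
      then have "2 * d \<le> \<bar>orient3 (\<gamma> t) (fst x)\<bar> + \<bar>orient3 (\<gamma> t) (snd x)\<bar>" using a(1) by blast
      then show "2 * d' \<le> \<bar>orient3 (\<gamma> t) (fst x)\<bar> + \<bar>orient3 (\<gamma> t) (snd x)\<bar>" using a(3) by linarith
    qed
  qed (simp add: finite_sorted_triples)
  then obtain \<kappa>2 where k2': "0 < \<kappa>2"
    "\<forall>x\<in>?I \<times> ?I. fst x \<noteq> snd x \<longrightarrow> (\<forall>t\<in>{0..1}. 2 * \<kappa>2 \<le> \<bar>orient3 (\<gamma> t) (fst x)\<bar> + \<bar>orient3 (\<gamma> t) (snd x)\<bar>)"
    by (elim exE conjE) (rule that)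
  have k2: "0 < \<kappa>2"
    "\<And>x y t. x \<in> ?I \<Longrightarrow> y \<in> ?I \<Longrightarrow> x \<noteq> y \<Longrightarrow> t \<in> {0..1} \<Longrightarrow> 2 * \<kappa>2 \<le> \<bar>orient3 (\<gamma> t) x\<bar> + \<bar>orient3 (\<gamma> t) y\<bar>"
    using k2'(1) k2'(2)[rule_format, of "(_, _)"] by simp_all
  define \<kappa> where "\<kappa> = min \<kappa>1 \<kappa>2"
  have \<kappa>: "0 < \<kappa>" "\<kappa> \<le> \<kappa>1" "\<kappa> \<le> \<kappa>2" using k1(1) k2(1) by (auto simp: \<kappa>_def)
  obtain \<epsilon> where eps: "0 < \<epsilon>" "\<forall>t\<in>{0..1}. \<forall>z v. (\<forall>i\<in>{1..n}. norm (z i - \<gamma> t i) < \<epsilon>) \<longrightarrow>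
     (\<forall>i j k. {i, j, k} \<subseteq> {1..n} \<longrightarrow> \<bar>orient z i j k - orient (\<gamma> t) i j k\<bar> < \<kappa> \<and>
       ((\<forall>i\<in>{1..n}. norm (v i - velocity \<gamma> t i) < \<epsilon>) \<longrightarrow>
         \<bar>orient_rate z v i j k - orient_rate (\<gamma> t) (velocity \<gamma> t) i j k\<bar> < \<kappa>))"
    using orient_close[OF pb \<kappa>(1)] by blast
  have count: "finite (crit_in n \<eta> 0 1) \<and> card (crit_in n \<eta> 0 1) = (\<Sum>x\<in>?I. card (?Z \<gamma> x))"
    if pbe: "pure_braid n \<eta>" and cl: "close_braids n 1 \<epsilon> \<gamma> \<eta>" for \<eta>
  proof -
    have "dist (deriv01 0 (\<lambda>t. \<gamma> t i) t) (deriv01 0 (\<lambda>t. \<eta> t i) t) < \<epsilon>"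
      "dist (deriv01 1 (\<lambda>t. \<gamma> t i) t) (deriv01 1 (\<lambda>t. \<eta> t i) t) < \<epsilon>" if "t \<in> {0..1}" "i \<in> {1..n}" for t i
      using cl that unfolding close_braids_def by auto
    then have n0: "norm (\<eta> t i - \<gamma> t i) < \<epsilon>" and n1: "norm (velocity \<eta> t i - velocity \<gamma> t i) < \<epsilon>"
      if "t \<in> {0..1}" "i \<in> {1..n}" for t i
      using that unfolding velocity_def by (simp_all add: deriv01_def dist_norm norm_minus_commute)
    have near: "\<bar>orient3 (\<eta> t) x - orient3 (\<gamma> t) x\<bar> < \<kappa>" "\<bar>?rate \<eta> t x - ?rate \<gamma> t x\<bar> < \<kappa>"
      if "t \<in> {0..1}" "x \<in> ?I" for t x
      using eps(2) n0 n1 that sub[OF that(2)] by blast+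
    have fc: "finite (?Z \<eta> x) \<and> card (?Z \<eta> x) = card (?Z \<gamma> x)" if x: "x \<in> ?I" for x
    proof (rule k1(2)[rule_format, OF x, where g = "\<lambda>t. orient3 (\<eta> t) x" and g' = "\<lambda>t. ?rate \<eta> t x"])
      fix t :: real assume t: "t \<in> {0..1}"
      show "((\<lambda>t. orient3 (\<eta> t) x) has_real_derivative ?rate \<eta> t x) (at t within {0..1}) \<and>
          \<bar>orient3 (\<eta> t) x - orient3 (\<gamma> t) x\<bar> < \<kappa>1 \<and> \<bar>?rate \<eta> t x - ?rate \<gamma> t x\<bar> < \<kappa>1"
        using orient_derivative[OF pbe sub[OF x] t] near[OF t x] \<kappa>(2) by linarith
    qed
    have disj: "?Z \<eta> x \<inter> ?Z \<eta> y = {}" if xy: "x \<in> ?I" "y \<in> ?I" "x \<noteq> y" for x y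
    proof (rule ccontr)
      assume "?Z \<eta> x \<inter> ?Z \<eta> y \<noteq> {}"
      then obtain t where t: "t \<in> {0..1}" "orient3 (\<eta> t) x = 0" "orient3 (\<eta> t) y = 0" by blast
      then show False using near(1)[OF t(1) xy(1)] near(1)[OF t(1) xy(2)] k2(2)[OF xy t(1)] \<kappa>(3) by linarith
    qed
    have "card (\<Union>x\<in>?I. ?Z \<eta> x) = (\<Sum>x\<in>?I. card (?Z \<eta> x))"
      using fc disj by (intro card_UN_disjoint finite_sorted_triples) blast+
    then show ?thesis using fc finite_sorted_triples unfolding crit by simp
  qed
  have "close_braids n 1 \<epsilon> \<gamma> \<gamma>" using eps(1) by (simp add: close_braids_def)
  then show ?thesis
    unfolding stable_def critical_moments_eq using count[OF pb] count eps(1) by (metis)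
qed

lemma transversal_good_stable:
  assumes "pure_braid n \<gamma>" "transversal n \<gamma>" "finite (critical_moments n \<gamma>)"
  shows "good_stable n \<gamma>"
  using assms transversal_stable[OF assms(1,2)] unfolding good_stable_def transversal_def critical_moments_eq by blast

section \<open>Good and stable braids are regular\<close>

text \<open>A smooth function that is positive exactly at distance less than \<open>d\<close> from \<open>t0\<close>.\<close>

definition bump :: "real \<Rightarrow> real \<Rightarrow> real \<Rightarrow> real" where
  "bump t0 d t = smooth_step (1 / d * t + (1 - t0 / d)) - smooth_step (1 / d * t + - (t0 / d))"

lemma bump_outside: "0 < d \<Longrightarrow> d \<le> \<bar>t - t0\<bar> \<Longrightarrow> bump t0 d t = 0"
proof -
  assume d: "0 < d" "d \<le> \<bar>t - t0\<bar>"
  have e: "1 / d * t + (1 - t0 / d) = (t - t0) / d + 1" "1 / d * t + - (t0 / d) = (t - t0) / d"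
    using d by (simp_all add: field_simps)
  show ?thesis
  proof (cases "0 \<le> t - t0")
    case True
    then have "1 \<le> (t - t0) / d" using d by simp
    then show ?thesis unfolding bump_def e by simp
  next
    case False
    then have "(t - t0) / d \<le> -1" using d by (simp add: pos_divide_le_eq)
    then show ?thesis unfolding bump_def e by simp
  qed
qed

lemma bump_inside: "0 < d \<Longrightarrow> \<bar>t - t0\<bar> < d \<Longrightarrow> 0 < bump t0 d t \<and> bump t0 d t \<le> 1"
proof -
  assume d: "0 < d" "\<bar>t - t0\<bar> < d"
  have e: "1 / d * t + (1 - t0 / d) = (t - t0) / d + 1" "1 / d * t + - (t0 / d) = (t - t0) / d"
    using d by (simp_all add: field_simps)
  have x: "-1 < (t - t0) / d" "(t - t0) / d < 1"
    using d by (simp_all add: pos_less_divide_eq pos_divide_less_eq)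
  have r: "0 \<le> smooth_step y \<and> smooth_step y \<le> 1" for y using smooth_step_range[of y] by simp
  show ?thesis
  proof (cases "(t - t0) / d \<le> 0")
    case True
    then have "smooth_step ((t - t0) / d) = 0" by simp
    moreover have "smooth_step 0 < smooth_step ((t - t0) / d + 1)" using x True by (intro smooth_step_strict_mono) auto
    ultimately show ?thesis using r unfolding bump_def e by simp
  next
    case False
    then have "smooth_step ((t - t0) / d + 1) = 1" by simp
    moreover have "smooth_step ((t - t0) / d) < smooth_step 1" using x False by (intro smooth_step_strict_mono) auto
    ultimately show ?thesis using r unfolding bump_def e by simp
  qed
qed

lemma bump_smooth: "smooth_line (\<lambda>t. bump t0 d t *\<^sub>R c)"
proof -
  have "smooth_line (\<lambda>t. smooth_step (1 / d * t + (1 - t0 / d)) *\<^sub>R c + smooth_step (1 / d * t + - (t0 / d)) *\<^sub>R (- c))"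
    by (intro smooth_line_add smooth_line_step)
  then show ?thesis by (simp add: bump_def scaleR_diff_left)
qed

lemma small_smooth_perturbation:
  assumes "smooth_line b" "0 < \<epsilon>"
  shows "\<exists>a0>0. \<forall>a. \<bar>a\<bar> \<le> a0 \<longrightarrow> (\<forall>k\<le>r. \<forall>g. smooth01 g \<longrightarrow> (\<forall>t\<in>{0..1}. dist (deriv01 k g t) (deriv01 k (\<lambda>t. g t + a *\<^sub>R b t) t) < \<epsilon>))"
proof -
  have sb: "smooth01 b" using assms(1) by (rule smooth_line_smooth01) simp
  note db = smooth01_derivs01[OF sb]
  have "\<exists>a0>0. \<forall>k\<in>{..r}. \<forall>t\<in>{0..1}. a0 * norm (deriv01 k b t) < \<epsilon>"
  proof (rule finite_common_radius)
    fix k assume "k \<in> {..r}"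
    have "continuous_on {0..1} (deriv01 k b)"
      using sb differentiable_imp_continuous_on unfolding smooth01_def by blast
    then have "bounded (deriv01 k b ` {0..1})"
      by (intro compact_imp_bounded compact_continuous_image compact_Icc)
    then obtain C where C: "0 < C" "\<forall>t\<in>{0..1}. norm (deriv01 k b t) \<le> C" unfolding bounded_pos by auto
    have "\<epsilon> / (2 * C) * norm (deriv01 k b t) < \<epsilon>" if "t \<in> {0..1}" for t
    proof -
      have "\<epsilon> / (2 * C) * norm (deriv01 k b t) \<le> \<epsilon> / (2 * C) * C"
        using C that assms(2) by (intro mult_left_mono) auto
      also have "\<dots> < \<epsilon>" using C(1) assms(2) by simp
      finally show ?thesis .
    qed
    then show "\<exists>d>0. \<forall>t\<in>{0..1}. d * norm (deriv01 k b t) < \<epsilon>"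
      using C(1) assms(2) by (intro exI[of _ "\<epsilon> / (2 * C)"]) auto
  next
    fix k and d d' :: real assume a: "\<forall>t\<in>{0..1}. d * norm (deriv01 k b t) < \<epsilon>" "0 < d'" "d' \<le> d"
    show "\<forall>t\<in>{0..1}. d' * norm (deriv01 k b t) < \<epsilon>"
    proof
      fix t :: real assume "t \<in> {0..1}"
      then have "d * norm (deriv01 k b t) < \<epsilon>" using a(1) by blast
      moreover have "d' * norm (deriv01 k b t) \<le> d * norm (deriv01 k b t)" using a(3) by (intro mult_right_mono) auto
      ultimately show "d' * norm (deriv01 k b t) < \<epsilon>" by linarith
    qed
  qed simp
  then obtain a0 where a0: "0 < a0" "\<forall>k\<in>{..r}. \<forall>t\<in>{0..1}. a0 * norm (deriv01 k b t) < \<epsilon>" by blast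
  have "dist (deriv01 k g t) (deriv01 k (\<lambda>t. g t + a *\<^sub>R b t) t) < \<epsilon>"
    if a: "\<bar>a\<bar> \<le> a0" and k: "k \<le> r" and g: "smooth01 g" and t: "t \<in> {0..1}" for a k g t
  proof -
    have "derivs01 (\<lambda>k t. 1 *\<^sub>R deriv01 k g t + a *\<^sub>R deriv01 k b t) (\<lambda>t. 1 *\<^sub>R g t + a *\<^sub>R b t)"
      by (rule derivs01_lincomb[OF smooth01_derivs01[OF g] db])
    from deriv01_eq[OF this t, of k]
    have "deriv01 k (\<lambda>t. g t + a *\<^sub>R b t) t = deriv01 k g t + a *\<^sub>R deriv01 k b t" by simp
    then have "dist (deriv01 k g t) (deriv01 k (\<lambda>t. g t + a *\<^sub>R b t) t) = \<bar>a\<bar> * norm (deriv01 k b t)"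
      by (simp add: dist_norm)
    also have "\<dots> \<le> a0 * norm (deriv01 k b t)" using a by (intro mult_right_mono) auto
    also have "\<dots> < \<epsilon>" using a0(2) k t by auto
    finally show ?thesis .
  qed
  then show ?thesis using a0(1) by blast
qed

text \<open>The point \<open>i\<close> is pushed perpendicularly to \<open>d\<close>; when \<open>d\<close> is close to the direction of the
  line through the points \<open>j\<close> and \<open>k\<close>, this changes the orientation in a definite direction.\<close>

lemma orient_push:
  assumes "distinct [i, j, k]"
  shows "orient (z(i := z i + a *\<^sub>R (\<i> * d))) i j k = orient z i j k + a * Re (cnj (z k - z j) * d)"
proof -
  let ?z = "z(i := z i + a *\<^sub>R (\<i> * d))"
  have 1: "?z j = z j" "?z k = z k" "Re (?z i) = Re (z i) - a * Im d" "Im (?z i) = Im (z i) + a * Re d"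
    using assms by auto
  have 2: "Re (cnj (z k - z j) * d) = (Re (z k) - Re (z j)) * Re d + (Im (z k) - Im (z j)) * Im d"
    by (simp add: algebra_simps)
  show ?thesis unfolding orient_eq 1 2 by algebra
qed

lemma orient_nonzero_bound:
  assumes pb: "pure_braid n \<gamma>" and ab: "0 \<le> a" "a \<le> b" "b \<le> 1"
    and nz: "\<And>t x. t \<in> {a..b} \<Longrightarrow> x \<in> sorted_triples n \<Longrightarrow> triple_set x \<noteq> T \<Longrightarrow> orient3 (\<gamma> t) x \<noteq> 0"
  shows "\<exists>m>0. \<forall>x\<in>sorted_triples n. triple_set x \<noteq> T \<longrightarrow> (\<forall>t\<in>{a..b}. m \<le> \<bar>orient3 (\<gamma> t) x\<bar>)"
proof (rule finite_common_radius[OF finite_sorted_triples])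
  fix x assume x: "x \<in> sorted_triples n"
  show "\<exists>m>0. triple_set x \<noteq> T \<longrightarrow> (\<forall>t\<in>{a..b}. m \<le> \<bar>orient3 (\<gamma> t) x\<bar>)"
  proof (cases "triple_set x = T")
    case False
    have "\<forall>i\<in>{1..n}. continuous_on {0..1} (\<lambda>t. \<gamma> t i)" using pure_braid_based_loop[OF pb] by (simp add: based_loop_def)
    moreover have "triple_set x \<subseteq> {1..n}" using x by (auto simp: sorted_triples_def)
    ultimately have "continuous_on {0..1} (\<lambda>t. \<bar>orient3 (\<gamma> t) x\<bar>)" by (intro continuous_intros orient_continuous_on)
    then have "continuous_on {a..b} (\<lambda>t. \<bar>orient3 (\<gamma> t) x\<bar>)" by (rule continuous_on_subset) (use ab in auto)
    then obtain t0 where "t0 \<in> {a..b}" "\<forall>t\<in>{a..b}. \<bar>orient3 (\<gamma> t0) x\<bar> \<le> \<bar>orient3 (\<gamma> t) x\<bar>"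
      using continuous_attains_inf[of "{a..b}" "\<lambda>t. \<bar>orient3 (\<gamma> t) x\<bar>"] ab by auto
    then show ?thesis using nz[of t0 x] x False by (intro exI[of _ "\<bar>orient3 (\<gamma> t0) x\<bar>"]) auto
  qed (auto intro: exI[of _ 1])
next
  fix x d d' assume a: "triple_set x \<noteq> T \<longrightarrow> (\<forall>t\<in>{a..b}. d \<le> \<bar>orient3 (\<gamma> t) x\<bar>)" "0 < d'" "d' \<le> d"
  show "triple_set x \<noteq> T \<longrightarrow> (\<forall>t\<in>{a..b}. d' \<le> \<bar>orient3 (\<gamma> t) x\<bar>)" using a(1,3) by (meson order.trans)
qed

text \<open>If the orientation of the collinear triple had the same sign before and after \<open>t0\<close>, one
  could push the point \<open>i\<close> away from the line through \<open>j\<close> and \<open>k\<close> to the side on which it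
  already is, for times near \<open>t0\<close> only. If the push is small enough, this removes the critical
  moment \<open>t0\<close> and leaves the others unchanged, contrary to stability.\<close>

lemma stable_crossing:
  assumes gs: "good_stable n \<gamma>" and t0: "t0 \<in> crit_in n \<gamma> 0 1"
    and T: "{i, j, k} \<subseteq> {1..n}" "distinct [i, j, k]" and uniq: "\<And>S. collinear_triple n (\<gamma> t0) S \<Longrightarrow> S = {i, j, k}"
  shows "crosses (\<lambda>s. orient (\<gamma> s) i j k) t0"
proof (rule ccontr)
  assume no: "\<not> crosses (\<lambda>s. orient (\<gamma> s) i j k) t0"
  let ?f = "\<lambda>s. orient (\<gamma> s) i j k"
  let ?C = "crit_in n \<gamma> 0 1"
  have pb: "pure_braid n \<gamma>" and fin: "finite ?C" and st: "stable n \<gamma>"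
    using gs by (simp_all add: good_stable_def critical_moments_eq)
  have loop: "based_loop n \<gamma>" by (rule pure_braid_based_loop[OF pb])
  have cont: "continuous_on {0..1} (\<lambda>t. \<gamma> t l)" if "l \<in> {1..n}" for l using loop that by (simp add: based_loop_def)
  have t01: "0 < t0" "t0 < 1"
  proof -
    have "t0 \<noteq> 0" "t0 \<noteq> 1" using t0 loop base_noncollinear by (auto simp: crit_in_iff based_loop_def)
    then show "0 < t0" "t0 < 1" using t0 by (auto simp: crit_in_iff)
  qed
  have "\<exists>d>0. \<forall>s\<in>?C - {t0}. d < \<bar>s - t0\<bar>"
  proof (rule finite_common_radius)
    fix s assume "s \<in> ?C - {t0}"
    then show "\<exists>d>0. d < \<bar>s - t0\<bar>" by (intro exI[of _ "\<bar>s - t0\<bar> / 2"]) auto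
  qed (use fin in auto)
  then obtain d0 where d0: "0 < d0" "\<forall>s\<in>?C - {t0}. d0 < \<bar>s - t0\<bar>" by blast
  define e where "e = \<gamma> t0 k - \<gamma> t0 j"
  have "e \<noteq> 0"
  proof -
    have "\<gamma> t0 \<in> conf n" using loop t01 by (simp add: based_loop_def)
    then show ?thesis using T unfolding e_def conf_def by (auto dest: inj_onD)
  qed
  let ?L = "\<lambda>t. Re (cnj (\<gamma> t k - \<gamma> t j) * e)"
  have "?L t0 = (norm e)\<^sup>2" unfolding cmod_power2 by (simp add: e_def[symmetric] power2_eq_square)
  then have L0: "0 < ?L t0" using \<open>e \<noteq> 0\<close> by simp
  have "continuous_on {0..1} ?L" by (intro continuous_intros cont) (use T in auto)
  then obtain d1 where d1: "0 < d1" "\<And>t. t \<in> {0..1} \<Longrightarrow> \<bar>t - t0\<bar> < d1 \<Longrightarrow> 0 < ?L t"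
  proof -
    obtain d1 where "0 < d1" "\<forall>t\<in>{0..1}. dist t t0 < d1 \<longrightarrow> dist (?L t) (?L t0) < ?L t0"
      using \<open>continuous_on {0..1} ?L\<close> L0 t01 unfolding continuous_on_iff by (metis atLeastAtMost_iff less_imp_le)
    then show ?thesis using that[of d1] by (force simp: dist_real_def)
  qed
  define d where "d = Min {d0, d1, t0 / 2, (1 - t0) / 2}"
  have d: "0 < d" using d0(1) d1(1) t01 unfolding d_def by simp
  have d: "0 < d" "d \<le> d0" "d \<le> d1" "d \<le> t0 / 2" "d \<le> (1 - t0) / 2"
    unfolding d_def by (fact d[unfolded d_def], (intro Min_le; simp)+)
  have lo: "0 < t0 - d" and hi: "t0 + d < 1"
  proof -
    show "0 < t0 - d" using d(4) t01 by linarith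
    have "0 < 1 - t0" using t01 by simp
    then show "t0 + d < 1" using d(5) by (simp add: field_simps)
  qed
  have nz: "?f s \<noteq> 0" if "s \<in> {t0 - d..t0 + d}" "s \<noteq> t0" for s
  proof
    assume "?f s = 0"
    then have "collinear_triple n (\<gamma> s) {i, j, k}" by (rule collinear_tripleI[OF T])
    then have "s \<in> ?C" using that lo hi unfolding crit_in_def by auto
    then have "d0 < \<bar>s - t0\<bar>" using d0(2) that(2) by blast
    then show False using that(1) d(2) by auto
  qed
  have z0: "?f t0 = 0"
  proof -
    obtain S where S: "collinear_triple n (\<gamma> t0) S" using t0 by (auto simp: crit_in_def)
    then have "collinear (\<gamma> t0 ` {i, j, k})" using uniq by (auto simp: collinear_triple_def)
    then show ?thesis using collinear_iff_orient[of "\<gamma> t0" i j k] by simp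
  qed
  have cf: "continuous_on {a..b} ?f" if "0 \<le> a" "b \<le> 1" for a b
    by (rule continuous_on_subset[of "{0..1}", OF orient_continuous_on[of n]]) (use cont T that in auto)
  have left: "0 < ?f (t0 - d) \<longleftrightarrow> 0 < ?f s" if "t0 - d \<le> s" "s < t0" for s
    by (rule nonvanishing_same_sign[where f = ?f, OF cf]) (use that lo hi nz d(1) in auto)
  have right: "0 < ?f s \<longleftrightarrow> 0 < ?f (t0 + d)" if "t0 < s" "s \<le> t0 + d" for s
    by (rule nonvanishing_same_sign[where f = ?f, OF cf]) (use that lo hi nz d(1) in auto)
  have same: "0 < ?f (t0 - d) \<longleftrightarrow> 0 < ?f (t0 + d)"
  proof (rule ccontr)
    assume ne: "\<not> ?thesis"
    have "?f s * ?f s' < 0" if "t0 - d < s \<and> s < t0 \<and> t0 < s' \<and> s' < t0 + d" for s s'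
      using left[of s] right[of s'] nz[of s] nz[of s'] ne that by (auto simp: mult_less_0_iff)
    then show False using no d(1) unfolding crosses_def by blast
  qed
  \<comment> \<open>The side of the line on which the point i is, before and after t0.\<close>
  define \<sigma> where "\<sigma> = sgn (?f (t0 - d))"
  have "?f (t0 - d) \<noteq> 0" using d(1) by (intro nz) auto
  then have sg: "\<bar>\<sigma>\<bar> = 1" by (auto simp: \<sigma>_def sgn_if)
  have nonneg: "0 \<le> \<sigma> * ?f s" if s: "s \<in> {t0 - d..t0 + d}" for s
  proof (cases "s = t0")
    case True then show ?thesis using z0 by simp
  next
    case False
    then have "0 < ?f s \<longleftrightarrow> 0 < ?f (t0 - d)" using left[of s] right[of s] same s by (cases "s < t0") auto
    then show ?thesis using nz[OF s False] \<open>?f (t0 - d) \<noteq> 0\<close> by (auto simp: \<sigma>_def sgn_if)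
  qed
  define v where "v = \<sigma> *\<^sub>R (\<i> * e)"
  \<comment> \<open>The perturbed braid, depending on the size a of the push.\<close>
  define \<eta> where "\<eta> = (\<lambda>a t. (\<gamma> t)(i := \<gamma> t i + a *\<^sub>R (bump t0 d t *\<^sub>R v)))"
  have "\<exists>m>0. \<forall>x\<in>sorted_triples n. triple_set x \<noteq> {i, j, k} \<longrightarrow> (\<forall>t\<in>{t0 - d..t0 + d}. m \<le> \<bar>orient3 (\<gamma> t) x\<bar>)"
  proof (rule orient_nonzero_bound[OF pb])
    fix t x assume t: "t \<in> {t0 - d..t0 + d}" and x: "x \<in> sorted_triples n" "triple_set x \<noteq> {i, j, k}"
    show "orient3 (\<gamma> t) x \<noteq> 0"
    proof
      assume "orient3 (\<gamma> t) x = 0"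
      then have ct: "collinear_triple n (\<gamma> t) (triple_set x)" using x(1) unfolding collinear_triple_sorted by blast
      then have "t \<in> ?C" using t lo hi unfolding crit_in_def by auto
      moreover have "t \<noteq> t0" using ct uniq x(2) by blast
      ultimately have "d0 < \<bar>t - t0\<bar>" using d0(2) by blast
      then show False using t d(2) by auto
    qed
  qed (use lo hi d(1) in auto)
  then obtain m where m: "0 < m" "\<forall>x\<in>sorted_triples n. triple_set x \<noteq> {i, j, k} \<longrightarrow> (\<forall>t\<in>{t0 - d..t0 + d}. m \<le> \<bar>orient3 (\<gamma> t) x\<bar>)"
    by blast
  obtain e1 where e1: "0 < e1" "\<forall>t\<in>{0..1}. conf_box n (\<gamma> t) e1 \<subseteq> conf n" using close_in_conf[OF loop] by blast
  obtain e2 where e2: "0 < e2" and e2': "\<forall>t\<in>{0..1}. \<forall>z v. (\<forall>i\<in>{1..n}. norm (z i - \<gamma> t i) < e2) \<longrightarrow>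
     (\<forall>i j k. {i, j, k} \<subseteq> {1..n} \<longrightarrow> \<bar>orient z i j k - orient (\<gamma> t) i j k\<bar> < m \<and>
       ((\<forall>i\<in>{1..n}. norm (v i - velocity \<gamma> t i) < e2) \<longrightarrow>
         \<bar>orient_rate z v i j k - orient_rate (\<gamma> t) (velocity \<gamma> t) i j k\<bar> < m))"
    using orient_close[OF pb m(1)] by (elim exE conjE) (rule that)
  obtain r \<epsilon> where st': "0 < \<epsilon>" "\<And>\<eta>. pure_braid n \<eta> \<Longrightarrow> close_braids n r \<epsilon> \<gamma> \<eta> \<Longrightarrow>
       card (crit_in n \<eta> 0 1) = card ?C" using st unfolding stable_def critical_moments_eq by blast
  have sv: "smooth_line (\<lambda>t. bump t0 d t *\<^sub>R v)" by (rule bump_smooth)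
  obtain a0 where a0: "0 < a0" "\<forall>a. \<bar>a\<bar> \<le> a0 \<longrightarrow> (\<forall>k\<le>r. \<forall>g. smooth01 g \<longrightarrow> (\<forall>t\<in>{0..1}.
      dist (deriv01 k g t) (deriv01 k (\<lambda>t. g t + a *\<^sub>R (bump t0 d t *\<^sub>R v)) t) < \<epsilon>))"
    using small_smooth_perturbation[OF sv st'(1)] by blast
  \<comment> \<open>Small enough for the perturbation to be close to the braid, to stay in the configuration
    space, and not to make other triples collinear near t0.\<close>
  define a where "a = Min {a0, e1 / (2 * (norm v + 1)), e2 / (2 * (norm v + 1))}"
  have nv: "0 < 2 * (norm v + 1)" by (simp add: add_nonneg_pos)
  have a: "0 < a" "a \<le> a0" "a \<le> e1 / (2 * (norm v + 1))" "a \<le> e2 / (2 * (norm v + 1))"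
    using a0(1) e1(1) e2 nv unfolding a_def by simp_all
  have a': "a * (2 * (norm v + 1)) \<le> e1" "a * (2 * (norm v + 1)) \<le> e2"
    using a(3,4) pos_le_divide_eq[OF nv] by blast+
  have "x < 2 * (x + 1)" if "0 \<le> x" for x :: real using that by simp
  from this[OF norm_ge_zero] have "a * norm v < a * (2 * (norm v + 1))" using a(1) by (rule mult_strict_left_mono)
  then have av: "a * norm v < e1" "a * norm v < e2" using a' by linarith+
  have i: "i \<in> {1..n}" using T by simp
  have shift: "norm (\<eta> a t l - \<gamma> t l) \<le> a * norm v" for t l
  proof (cases "l = i")
    case True
    have "\<bar>bump t0 d t\<bar> \<le> 1"
      using bump_inside[OF d(1), of t t0] bump_outside[OF d(1), of t t0] by (cases "\<bar>t - t0\<bar> < d") auto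
    then have "\<bar>bump t0 d t\<bar> * norm v \<le> 1 * norm v" by (intro mult_right_mono) auto
    then have "a * (\<bar>bump t0 d t\<bar> * norm v) \<le> a * norm v" using a(1) by simp
    then show ?thesis using True a(1) by (simp add: \<eta>_def abs_mult mult.assoc)
  next
    case False then show ?thesis using a(1) by (simp add: \<eta>_def)
  qed
  have off: "\<eta> a t = \<gamma> t" if "d \<le> \<bar>t - t0\<bar>" for t
    using bump_outside[OF d(1) that] by (simp add: \<eta>_def)
  have pbe: "pure_braid n (\<eta> a)"
    unfolding pure_braid_def
  proof (intro conjI ballI)
    fix t :: real assume t: "t \<in> {0..1}"
    have "\<gamma> t \<in> conf n" using loop t by (simp add: based_loop_def)
    then have "\<forall>l. l \<notin> {1..n} \<longrightarrow> \<eta> a t l = 0" using i conf_outside by (auto simp: \<eta>_def)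
    moreover have "dist (\<eta> a t l) (\<gamma> t l) < e1" for l
      using shift[of t l] av(1) by (simp add: dist_norm)
    ultimately have "\<eta> a t \<in> conf_box n (\<gamma> t) e1" by (simp add: conf_box_def)
    then show "\<eta> a t \<in> conf n" using e1(2) t by blast
  next
    have "\<eta> a 0 = \<gamma> 0" "\<eta> a 1 = \<gamma> 1" using lo hi by (auto intro!: off)
    then show "pathstart (\<eta> a) = base n" "pathfinish (\<eta> a) = base n"
      using pb by (simp_all add: pure_braid_def pathstart_def pathfinish_def)
  next
    fix l assume l: "l \<in> {1..n}"
    have s: "smooth01 (\<lambda>t. \<gamma> t l)" using pb l by (simp add: pure_braid_def)
    show "smooth01 (\<lambda>t. \<eta> a t l)"
    proof (cases "l = i")
      case True
      have "smooth01 (\<lambda>t. bump t0 d t *\<^sub>R v)" using sv by (rule smooth_line_smooth01) simp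
      from smooth01_lincomb[OF s this, of 1 a] show ?thesis using True by (simp add: \<eta>_def)
    qed (use s in \<open>simp add: \<eta>_def\<close>)
  qed
  have "close_braids n r \<epsilon> \<gamma> (\<eta> a)"
    unfolding close_braids_def
  proof (intro allI impI ballI)
    fix q l t assume q: "q \<le> r" "l \<in> {1..n}" "t \<in> {0..1::real}"
    have s: "smooth01 (\<lambda>t. \<gamma> t l)" using pb q(2) by (simp add: pure_braid_def)
    show "dist (deriv01 q (\<lambda>t. \<gamma> t l) t) (deriv01 q (\<lambda>t. \<eta> a t l) t) < \<epsilon>"
    proof (cases "l = i")
      case True
      have "\<bar>a\<bar> \<le> a0" using a by simp
      then show ?thesis using a0(2) q s True by (simp add: \<eta>_def)
    qed (use st'(1) in \<open>simp add: \<eta>_def\<close>)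
  qed
  then have card: "card (crit_in n (\<eta> a) 0 1) = card ?C" using st'(2) pbe by blast
  have pushed: "orient (\<eta> a t) i j k \<noteq> 0" if t: "\<bar>t - t0\<bar> < d" for t
  proof -
    have tt: "t \<in> {t0 - d..t0 + d}" using t by auto
    have t': "t \<in> {0..1}" "\<bar>t - t0\<bar> < d1" using t lo hi d(3) unfolding atLeastAtMost_iff by linarith+
    have "\<eta> a t = (\<gamma> t)(i := \<gamma> t i + (a * bump t0 d t * \<sigma>) *\<^sub>R (\<i> * e))" by (simp add: \<eta>_def v_def mult.assoc)
    then have "orient (\<eta> a t) i j k = ?f t + a * bump t0 d t * \<sigma> * ?L t"
      using orient_push[OF T(2)] by simp
    moreover have "s * (f + a * b * s * x) = s * f + s * s * (a * b * x)" for s f b x :: real by algebra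
    ultimately have "\<sigma> * orient (\<eta> a t) i j k = \<sigma> * ?f t + (\<sigma> * \<sigma>) * (a * bump t0 d t * ?L t)"
      by (simp only:)
    also have "\<sigma> * \<sigma> = 1" using sg by (metis abs_mult_self_eq mult_1)
    finally have "\<sigma> * orient (\<eta> a t) i j k = \<sigma> * ?f t + a * bump t0 d t * ?L t" by simp
    moreover have "0 < a * bump t0 d t * ?L t" using a(1) bump_inside[OF d(1) t] d1(2)[OF t'] by simp
    ultimately have "0 < \<sigma> * orient (\<eta> a t) i j k" using nonneg[OF tt] by linarith
    then show ?thesis by auto
  qed
  have near_clean: "t \<notin> crit_in n (\<eta> a) 0 1" if t: "\<bar>t - t0\<bar> < d" for t
  proof
    assume "t \<in> crit_in n (\<eta> a) 0 1"
    then obtain x where x: "x \<in> sorted_triples n" "orient3 (\<eta> a t) x = 0" and t01': "t \<in> {0..1}"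
      unfolding crit_in_def collinear_triple_sorted by blast
    have sub: "triple_set x \<subseteq> {1..n}" using x(1) by (auto simp: sorted_triples_def)
    show False
    proof (cases "triple_set x = {i, j, k}")
      case True
      have "collinear (\<eta> a t ` triple_set x)" using x(2) collinear_iff_orient[of "\<eta> a t"] by simp
      then have "orient (\<eta> a t) i j k = 0" using True collinear_iff_orient[of "\<eta> a t" i j k] by simp
      then show False using pushed[OF t] by simp
    next
      case False
      have "t \<in> {t0 - d..t0 + d}" using t by auto
      then have "m \<le> \<bar>orient3 (\<gamma> t) x\<bar>" using m(2) x(1) False by blast
      moreover have "\<bar>orient3 (\<eta> a t) x - orient3 (\<gamma> t) x\<bar> < m"
      proof -
        have "\<forall>l\<in>{1..n}. norm (\<eta> a t l - \<gamma> t l) < e2"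
        proof
          fix l show "norm (\<eta> a t l - \<gamma> t l) < e2" using shift[of t l] av(2) by linarith
        qed
        then show ?thesis using e2' t01' sub by blast
      qed
      ultimately show False using x(2) by simp
    qed
  qed
  have "crit_in n (\<eta> a) 0 1 = ?C - {t0}"
  proof (intro equalityI subsetI)
    fix t assume t: "t \<in> crit_in n (\<eta> a) 0 1"
    then have far: "d \<le> \<bar>t - t0\<bar>" using near_clean by force
    then have "t \<in> ?C" using t off[OF far] by (simp add: crit_in_iff)
    then show "t \<in> ?C - {t0}" using far d(1) by auto
  next
    fix t assume t: "t \<in> ?C - {t0}"
    then have "d0 < \<bar>t - t0\<bar>" using d0(2) by blast
    then have far: "d \<le> \<bar>t - t0\<bar>" using d(2) by linarith
    then show "t \<in> crit_in n (\<eta> a) 0 1" using t off[OF far] by (simp add: crit_in_iff)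
  qed
  then have "card (crit_in n (\<eta> a) 0 1) < card ?C" using card_Diff1_less[OF fin t0] by simp
  then show False using card by simp
qed

lemma good_stable_regular:
  assumes gs: "good_stable n \<gamma>"
  shows "regular n \<gamma> 0 1"
proof (rule regularI)
  have "pure_braid n \<gamma>" using gs by (simp add: good_stable_def)
  then have loop: "based_loop n \<gamma>" by (rule pure_braid_based_loop)
  then show "\<forall>i\<in>{1..n}. continuous_on {0..1} (\<lambda>t. \<gamma> t i)" "noncollinear n (\<gamma> 0)" "noncollinear n (\<gamma> 1)"
    using base_noncollinear by (simp_all add: based_loop_def)
  fix t assume t: "t \<in> crit_in n \<gamma> 0 1"
  then obtain T where T: "collinear_triple n (\<gamma> t) T" by (auto simp: crit_in_def)
  then obtain i j k where ijk: "T = {i, j, k}" "{i, j, k} \<subseteq> {1..n}" "distinct [i, j, k]"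
    unfolding collinear_triple_iff by blast
  have "\<exists>!T. collinear_triple n (\<gamma> t) T" using gs t unfolding good_stable_def critical_moments_eq by blast
  then have uniq: "S = {i, j, k}" if "collinear_triple n (\<gamma> t) S" for S using T ijk(1) that by blast
  have "crosses (\<lambda>s. orient (\<gamma> s) i j k) t" by (rule stable_crossing[OF gs t ijk(2,3) uniq])
  then show "\<exists>i j k. {i, j, k} \<subseteq> {1..n} \<and> distinct [i, j, k] \<and>
       (\<forall>T. collinear_triple n (\<gamma> t) T \<longrightarrow> T = {i, j, k}) \<and> crosses (\<lambda>s. orient (\<gamma> s) i j k) t"
    using ijk(2,3) uniq by blast
qed simp

section \<open>The pure braid group and the homomorphism\<close>

lemma G3_group: "group (G3 n)" unfolding G3_def by (rule group_presented_group)

lemma flat_smooth_extension: "flat n \<alpha> \<Longrightarrow> smooth_line (\<lambda>t. \<alpha> t i)" and flat_before: "flat n \<alpha> \<Longrightarrow> t \<le> 0 \<Longrightarrow> \<alpha> t = base n"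
  and flat_after: "flat n \<alpha> \<Longrightarrow> 1 \<le> t \<Longrightarrow> \<alpha> t = base n" and flat_conf: "flat n \<alpha> \<Longrightarrow> t \<in> {0..1} \<Longrightarrow> \<alpha> t \<in> conf n"
  by (simp_all add: flat_def)

lemma flat_const: "flat n (\<lambda>t. base n)"
  unfolding flat_def using base_conf smooth_line_const by blast

text \<open>Outside the first half of the time the first braid is constant, and likewise for the
  second, so the concatenation is a sum of smooth functions.\<close>

lemma flat_join:
  assumes "flat n \<alpha>" "flat n \<beta>"
  shows "flat n (\<alpha> +++ \<beta>)"
  unfolding flat_def
proof (intro conjI allI impI ballI)
  fix i
  have e: "(\<alpha> +++ \<beta>) t i = \<alpha> (2 * t + 0) i + (\<beta> (2 * t + - 1) i + - base n i)" for t
  proof (cases "t \<le> 1 / 2")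
    case True
    then have "\<beta> (2 * t + - 1) = base n" by (intro flat_before[OF assms(2)]) simp
    then show ?thesis using True by (simp add: joinpaths_def)
  next
    case False
    then have "\<alpha> (2 * t + 0) = base n" by (intro flat_after[OF assms(1)]) simp
    then show ?thesis using False by (simp add: joinpaths_def)
  qed
  show "smooth_line (\<lambda>t. (\<alpha> +++ \<beta>) t i)"
    unfolding e by (intro smooth_line_add smooth_line_affine[of "\<lambda>t. \<alpha> t i"] smooth_line_affine[of "\<lambda>t. \<beta> t i"]
        smooth_line_const flat_smooth_extension[OF assms(1)] flat_smooth_extension[OF assms(2)])
next
  fix t :: real assume "t \<le> 0 \<or> 1 \<le> t"
  then show "(\<alpha> +++ \<beta>) t = base n"
    using flat_before[OF assms(1), of "2 * t"] flat_after[OF assms(2), of "2 * t - 1"] by (auto simp: joinpaths_def)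
next
  fix t :: real assume "t \<in> {0..1}"
  then show "(\<alpha> +++ \<beta>) t \<in> conf n"
    using flat_conf[OF assms(1), of "2 * t"] flat_conf[OF assms(2), of "2 * t - 1"] by (auto simp: joinpaths_def)
qed

lemma flat_reverse:
  assumes "flat n \<alpha>"
  shows "flat n (reversepath \<alpha>)"
  unfolding flat_def reversepath_def
proof (intro conjI allI impI ballI)
  fix i
  have "smooth_line (\<lambda>t. \<alpha> (- 1 * t + 1) i)"
    using smooth_line_affine[OF flat_smooth_extension[OF assms], of "-1" 1 i] .
  then show "smooth_line (\<lambda>t. \<alpha> (1 - t) i)" by simp
next
  fix t :: real assume "t \<le> 0 \<or> 1 \<le> t"
  then show "\<alpha> (1 - t) = base n" using flat_before[OF assms, of "1 - t"] flat_after[OF assms, of "1 - t"] by auto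
qed (use flat_conf[OF assms] in auto)

lemma flat_path: "flat n \<alpha> \<Longrightarrow> path \<alpha> \<and> path_image \<alpha> \<subseteq> conf n \<and> pathstart \<alpha> = base n \<and> pathfinish \<alpha> = base n"
  using pure_braid_path[OF flat_pure_braid] flat_before[of n \<alpha> 0] flat_after[of n \<alpha> 1] by (auto simp: pathstart_def pathfinish_def)

lemma homotopic_paths_const_join:
  assumes "path p" "path_image p \<subseteq> S"
  shows "homotopic_paths S ((\<lambda>t. pathstart p) +++ p) p"
proof (rule homotopic_paths_sym, rule homotopic_paths_reparametrize[OF assms, where f = "\<lambda>t. if t \<le> 1 / 2 then 0 else 2 * t - 1"])
  show "continuous_on {0..1} (\<lambda>t::real. if t \<le> 1 / 2 then 0 else 2 * t - 1)"
    unfolding split_01 by (rule continuous_on_cases continuous_intros | force)+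
qed (auto simp: joinpaths_def pathstart_def)

text \<open>The homotopy follows \<open>p\<close> backwards from its end only for the time \<open>1 - s\<close> before it
  returns.\<close>

lemma homotopic_paths_reverse_join:
  assumes "path p" "path_image p \<subseteq> S"
  shows "homotopic_paths S (reversepath p +++ p) (\<lambda>t. pathfinish p)"
  unfolding homotopic_paths
proof (intro exI conjI ballI)
  let ?f = "\<lambda>(s, t). 1 - (1 - s) * (1 - \<bar>2 * t - 1\<bar>) :: real"
  let ?h = "p \<circ> ?f"
  have f01: "?f x \<in> {0..1}" if x: "x \<in> {0..1} \<times> {0..1}" for x
  proof -
    obtain s t where st: "x = (s, t)" "0 \<le> s" "s \<le> 1" "0 \<le> t" "t \<le> 1" using x by auto
    have "0 \<le> 1 - s" "1 - s \<le> 1" "0 \<le> 1 - \<bar>2 * t - 1\<bar>" "1 - \<bar>2 * t - 1\<bar> \<le> 1" using st by auto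
    then have "0 \<le> (1 - s) * (1 - \<bar>2 * t - 1\<bar>)" "(1 - s) * (1 - \<bar>2 * t - 1\<bar>) \<le> 1"
      by (auto intro: mult_le_one)
    then show ?thesis using st(1) by simp
  qed
  have cf: "continuous_on ({0..1} \<times> {0..1}) ?f" unfolding case_prod_unfold by (intro continuous_intros)
  show "continuous_on ({0..1} \<times> {0..1}) ?h"
  proof (rule continuous_on_compose[OF cf])
    show "continuous_on (?f ` ({0..1} \<times> {0..1})) p"
      using assms(1) f01 unfolding path_def by (auto intro: continuous_on_subset)
  qed
  show "?h \<in> {0..1} \<times> {0..1} \<rightarrow> S"
    using f01 assms(2) unfolding path_image_def by auto
  show "?h (0, x) = (reversepath p +++ p) x" if "x \<in> {0..1}" for x
    using that by (auto simp: joinpaths_def reversepath_def)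
  show "?h (1, x) = pathfinish p" if "x \<in> {0..1}" for x by (simp add: pathfinish_def)
  fix t :: real assume "t \<in> {0..1}"
  show "pathstart (?h \<circ> Pair t) = pathstart (reversepath p +++ p)"
    by (simp add: pathstart_def pathfinish_def joinpaths_def reversepath_def)
  show "pathfinish (?h \<circ> Pair t) = pathfinish (reversepath p +++ p)"
    by (simp add: pathstart_def pathfinish_def joinpaths_def reversepath_def)
qed

context
  fixes n :: nat
  assumes n: "3 \<le> n"
begin

lemma equiv_isotopy: "equiv (Collect (pure_braid n)) (isotopy n)"
proof (rule equivI)
  show "isotopy n \<subseteq> Collect (pure_braid n) \<times> Collect (pure_braid n)" using isotopy_pure by fastforce
  show "refl_on (Collect (pure_braid n)) (isotopy n)"
    using pure_braid_path isotopy_iff_homotopic_paths[OF n] by (auto intro!: refl_onI)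
  show "sym (isotopy n)" using isotopy_sym by (auto intro: symI)
  show "trans (isotopy n)" using isotopy_trans by (auto intro: transI)
qed

lemma braid_class_flat_rep:
  assumes "X \<in> carrier (PB n)"
  shows "\<exists>\<eta>. flat n \<eta> \<and> transversal n \<eta> \<and> X = isotopy n `` {\<eta>}"
proof -
  obtain \<beta> where b: "pure_braid n \<beta>" "X = isotopy n `` {\<beta>}" using assms by (auto simp: PB_def quotient_def)
  have loop: "based_loop n \<beta>" by (rule pure_braid_based_loop[OF b(1)])
  obtain \<epsilon> where e: "0 < \<epsilon>" "\<forall>\<eta> \<eta>'. pure_braid n \<eta> \<and> pure_braid n \<eta>' \<and> close n \<epsilon> \<beta> \<eta> \<and> close n \<epsilon> \<beta> \<eta>' \<longrightarrow> (\<eta>, \<eta>') \<in> isotopy n"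
    using close_isotopic[OF loop] by blast
  obtain \<eta> where h: "flat n \<eta>" "transversal n \<eta>" "close n \<epsilon> \<beta> \<eta>" using dense_flat_transversal[OF n loop e(1)] by blast
  have "close n \<epsilon> \<beta> \<beta>" using loop e(1) conf_outside unfolding close_def based_loop_def by (auto intro!: box_self)
  then have "(\<beta>, \<eta>) \<in> isotopy n" using e(2) b(1) h flat_pure_braid by blast
  then have "X = isotopy n `` {\<eta>}" unfolding b(2) by (rule equiv_class_eq[OF equiv_isotopy])
  then show ?thesis using h by blast
qed

lemma flat_class: "flat n \<eta> \<Longrightarrow> isotopy n `` {\<eta>} \<in> carrier (PB n)"
  using flat_pure_braid by (auto simp: PB_def quotient_def)

lemma flat_isotopy: "flat n \<alpha> \<Longrightarrow> flat n \<beta> \<Longrightarrow> (\<alpha>, \<beta>) \<in> isotopy n \<longleftrightarrow> homotopic_paths (conf n) \<alpha> \<beta>"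
  using isotopy_iff_homotopic_paths[OF n] flat_pure_braid by blast

lemma class_eqI: "(\<alpha>, \<beta>) \<in> isotopy n \<Longrightarrow> isotopy n `` {\<alpha>} = isotopy n `` {\<beta>}"
  by (rule equiv_class_eq[OF equiv_isotopy])

text \<open>The product in \<open>PB n\<close> admits all representatives whose concatenation happens to be smooth;
  by \<open>isotopy_iff_homotopic_paths\<close> they all give the same class.\<close>

lemma PB_mult:
  assumes "flat n \<alpha>" "flat n \<beta>"
  shows "isotopy n `` {\<alpha>} \<otimes>\<^bsub>PB n\<^esub> isotopy n `` {\<beta>} = isotopy n `` {\<alpha> +++ \<beta>}"
proof -
  have pure: "pure_braid n \<alpha>" "pure_braid n \<beta>" "pure_braid n (\<alpha> +++ \<beta>)"
    using assms flat_join flat_pure_braid by blast+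
  have self: "(\<zeta>, \<zeta>) \<in> isotopy n" if "pure_braid n \<zeta>" for \<zeta>
    using equiv_isotopy that by (auto simp: equiv_def refl_on_def)
  have "(\<alpha> +++ \<beta>, \<gamma>) \<in> isotopy n"
    if "(\<alpha>, \<alpha>') \<in> isotopy n" "(\<beta>, \<beta>') \<in> isotopy n" "pure_braid n (\<alpha>' +++ \<beta>')" "(\<alpha>' +++ \<beta>', \<gamma>) \<in> isotopy n" for \<alpha>' \<beta>' \<gamma>
  proof -
    have "homotopic_paths (conf n) \<alpha> \<alpha>'" "homotopic_paths (conf n) \<beta> \<beta>'"
      using that(1,2) isotopy_iff_homotopic_paths[OF n] by blast+
    then have "homotopic_paths (conf n) (\<alpha> +++ \<beta>) (\<alpha>' +++ \<beta>')"
      using flat_path assms by (intro homotopic_paths_join) auto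
    then have "(\<alpha> +++ \<beta>, \<alpha>' +++ \<beta>') \<in> isotopy n" using isotopy_iff_homotopic_paths[OF n] pure(3) that(3) by blast
    then show ?thesis using that(4) isotopy_trans by blast
  qed
  then have "isotopy n `` {\<alpha>} \<otimes>\<^bsub>PB n\<^esub> isotopy n `` {\<beta>} \<subseteq> isotopy n `` {\<alpha> +++ \<beta>}"
    unfolding PB_def by auto
  moreover have "\<alpha> \<in> isotopy n `` {\<alpha>}" "\<beta> \<in> isotopy n `` {\<beta>}" using self pure by auto
  then have "isotopy n `` {\<alpha> +++ \<beta>} \<subseteq> isotopy n `` {\<alpha>} \<otimes>\<^bsub>PB n\<^esub> isotopy n `` {\<beta>}"
    using pure(3) unfolding PB_def by fastforce
  ultimately show ?thesis by blast
qed

lemma PB_group: "group (PB n)"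
proof (rule groupI)
  have one: "\<one>\<^bsub>PB n\<^esub> = isotopy n `` {\<lambda>t. base n}" by (simp add: PB_def)
  show "\<one>\<^bsub>PB n\<^esub> \<in> carrier (PB n)" unfolding one by (rule flat_class[OF flat_const])
  show "x \<otimes>\<^bsub>PB n\<^esub> y \<in> carrier (PB n)" if xy: "x \<in> carrier (PB n)" "y \<in> carrier (PB n)" for x y
  proof -
    obtain a b where ab: "flat n a" "x = isotopy n `` {a}" "flat n b" "y = isotopy n `` {b}"
      using xy[THEN braid_class_flat_rep] by blast
    show ?thesis unfolding ab(2,4) PB_mult[OF ab(1,3)] by (rule flat_class[OF flat_join[OF ab(1,3)]])
  qed
  show "x \<otimes>\<^bsub>PB n\<^esub> y \<otimes>\<^bsub>PB n\<^esub> z = x \<otimes>\<^bsub>PB n\<^esub> (y \<otimes>\<^bsub>PB n\<^esub> z)"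
    if xyz: "x \<in> carrier (PB n)" "y \<in> carrier (PB n)" "z \<in> carrier (PB n)" for x y z
  proof -
    obtain a b c where abc: "flat n a" "x = isotopy n `` {a}" "flat n b" "y = isotopy n `` {b}" "flat n c" "z = isotopy n `` {c}"
      using xyz[THEN braid_class_flat_rep] by blast
    have "homotopic_paths (conf n) (a +++ (b +++ c)) ((a +++ b) +++ c)"
      using abc(1,3,5)[THEN flat_path] by (intro homotopic_paths_assoc) auto
    then have "(a +++ (b +++ c), (a +++ b) +++ c) \<in> isotopy n"
      using abc flat_join by (subst flat_isotopy) auto
    from class_eqI[OF this] show ?thesis using abc flat_join by (simp add: PB_mult)
  qed
  show "\<one>\<^bsub>PB n\<^esub> \<otimes>\<^bsub>PB n\<^esub> x = x" if x: "x \<in> carrier (PB n)" for x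
  proof -
    obtain a where a: "flat n a" "x = isotopy n `` {a}" using braid_class_flat_rep[OF x] by blast
    have "homotopic_paths (conf n) ((\<lambda>t. base n) +++ a) a"
      using homotopic_paths_const_join[of a "conf n"] flat_path[OF a(1)] by simp
    then have "((\<lambda>t. base n) +++ a, a) \<in> isotopy n" using a(1) flat_join flat_const by (subst flat_isotopy) auto
    from class_eqI[OF this] show ?thesis using a flat_const by (simp add: one PB_mult)
  qed
  show "\<exists>y\<in>carrier (PB n). y \<otimes>\<^bsub>PB n\<^esub> x = \<one>\<^bsub>PB n\<^esub>" if x: "x \<in> carrier (PB n)" for x
  proof -
    obtain a where a: "flat n a" "x = isotopy n `` {a}" using braid_class_flat_rep[OF x] by blast
    have "homotopic_paths (conf n) (reversepath a +++ a) (\<lambda>t. base n)"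
      using homotopic_paths_reverse_join[of a "conf n"] flat_path[OF a(1)] by simp
    then have "(reversepath a +++ a, \<lambda>t. base n) \<in> isotopy n"
      using a(1) flat_join flat_const flat_reverse by (subst flat_isotopy) auto
    from class_eqI[OF this] show ?thesis
      using a flat_reverse flat_class by (intro bexI[of _ "isotopy n `` {reversepath a}"]) (auto simp: one PB_mult)
  qed
qed

lemma path_word_words:
  assumes "based_loop n \<eta>" "regular n \<eta> 0 1"
  shows "path_word n \<eta> 0 1 \<in> words (generators n)"
proof -
  have "homotopic_paths (conf n) \<eta> \<eta>"
    using coordinatewise_continuous[of n "{0..1}" \<eta>] assms(1) unfolding based_loop_def by (auto simp: path_def path_image_def)
  then show ?thesis using word_cong_words[OF homotopic_words_congruent[OF n assms assms]] by blast
qed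

lemma f_braid_isotopic:
  assumes "(\<alpha>, \<beta>) \<in> isotopy n" "regular n \<alpha> 0 1" "regular n \<beta> 0 1"
  shows "f_braid n \<alpha> = f_braid n \<beta>"
proof -
  have pure: "pure_braid n \<alpha>" "pure_braid n \<beta>" and hom: "homotopic_paths (conf n) \<alpha> \<beta>"
    using assms(1) isotopy_iff_homotopic_paths[OF n] by blast+
  note loops = pure_braid_based_loop[OF pure(1)] pure_braid_based_loop[OF pure(2)]
  have "cong3 n (path_word n \<alpha> 0 1) (path_word n \<beta> 0 1)"
    using homotopic_words_congruent[OF n] loops assms hom by blast
  then show ?thesis unfolding f_braid_def braid_word_eq by (rule equiv_class_eq[OF equiv_word_cong])
qed

lemma good_stable_rep:
  assumes "X \<in> carrier (PB n)"
  shows "\<exists>\<eta>\<in>X. flat n \<eta> \<and> regular n \<eta> 0 1 \<and> good_stable n \<eta>"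
proof -
  obtain \<eta> where h: "flat n \<eta>" "transversal n \<eta>" "X = isotopy n `` {\<eta>}" using braid_class_flat_rep[OF assms] by blast
  have reg: "regular n \<eta> 0 1" by (rule flat_transversal_regular[OF h(1,2)])
  have "good_stable n \<eta>"
    using reg by (intro transversal_good_stable flat_pure_braid h) (simp add: critical_moments_eq regular_def)
  moreover have "\<eta> \<in> X" using equiv_class_self[OF equiv_isotopy] flat_pure_braid[OF h(1)] h(3) by simp
  ultimately show ?thesis using h reg by blast
qed

lemma same_class_isotopic: "X \<in> carrier (PB n) \<Longrightarrow> \<alpha> \<in> X \<Longrightarrow> \<beta> \<in> X \<Longrightarrow> (\<alpha>, \<beta>) \<in> isotopy n"
  using quotient_eq_iff[OF equiv_isotopy, of X X \<alpha> \<beta>] by (simp add: PB_def)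

lemma braid_map_well_defined:
  assumes X: "X \<in> carrier (PB n)"
  shows "\<exists>!g. \<exists>\<beta>\<in>X. good_stable n \<beta> \<and> g = f_braid n \<beta>"
proof -
  obtain \<eta> where h: "\<eta> \<in> X" "regular n \<eta> 0 1" "good_stable n \<eta>" using good_stable_rep[OF X] by blast
  have "f_braid n \<beta> = f_braid n \<eta>" if "\<beta> \<in> X" "good_stable n \<beta>" for \<beta>
    using f_braid_isotopic same_class_isotopic[OF X that(1) h(1)] good_stable_regular[OF that(2)] h(2) by blast
  then show ?thesis using h by blast
qed

text \<open>The value of the map can be read off from any regular representative, also from one that is
  not known to be stable. This matters for concatenations.\<close>

lemma braid_map_eq:
  assumes X: "X \<in> carrier (PB n)" and h: "\<eta> \<in> X" "regular n \<eta> 0 1"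
  shows "braid_map n X = f_braid n \<eta>"
proof -
  have "\<exists>\<beta>\<in>X. good_stable n \<beta> \<and> braid_map n X = f_braid n \<beta>"
    unfolding braid_map_def by (rule theI'[OF braid_map_well_defined[OF X]])
  then obtain \<beta> where "\<beta> \<in> X" "good_stable n \<beta>" "braid_map n X = f_braid n \<beta>" by blast
  then show ?thesis using f_braid_isotopic same_class_isotopic[OF X _ h(1)] good_stable_regular h(2) by metis
qed

end

lemma path_word_affine:
  assumes c: "0 < c" and eq: "\<And>t. t \<in> {a..b} \<Longrightarrow> \<gamma>' (c * t + e) = \<gamma> t" and fin: "finite (crit_in n \<gamma> a b)"
  shows "path_word n \<gamma>' (c * a + e) (c * b + e) = path_word n \<gamma> a b"
proof -
  let ?f = "\<lambda>t. c * t + e"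
  let ?C = "crit_in n \<gamma> a b"
  have "crit_in n \<gamma>' (?f a) (?f b) = ?f ` ?C"
  proof (intro equalityI subsetI)
    fix s assume s: "s \<in> crit_in n \<gamma>' (?f a) (?f b)"
    define t where "t = (s - e) / c"
    have st: "s = ?f t" using c by (simp add: t_def)
    then have "t \<in> {a..b}" using s c by (auto simp: crit_in_iff)
    then show "s \<in> ?f ` ?C" using s st eq by (auto simp: crit_in_iff)
  next
    fix s assume "s \<in> ?f ` ?C"
    then show "s \<in> crit_in n \<gamma>' (?f a) (?f b)" using c eq by (auto simp: crit_in_iff)
  qed
  moreover have "sorted_list_of_set (?f ` ?C) = map ?f (sorted_list_of_set ?C)"
  proof (rule sorted_distinct_set_unique)
    show "sorted (map ?f (sorted_list_of_set ?C))"
      using c sorted_sorted_list_of_set[of ?C] by (auto simp: sorted_wrt_map intro: sorted_wrt_mono_rel[rotated])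
    show "distinct (map ?f (sorted_list_of_set ?C))" using c by (auto simp: distinct_map inj_on_def)
  qed (use fin in auto)
  moreover have "critical_gen n (\<gamma>' (?f t)) = critical_gen n (\<gamma> t)" if "t \<in> set (sorted_list_of_set ?C)" for t
    using that fin eq by (auto simp: crit_in_iff)
  ultimately show ?thesis by (simp add: path_word_def)
qed

lemma crosses_affine_reparametrization:
  assumes cr: "crosses f (c * t + e)" and c: "0 < c" and r: "0 < r"
    and g: "\<And>s. \<bar>s - t\<bar> < r \<Longrightarrow> g s = f (c * s + e)"
  shows "crosses g t"
proof -
  obtain d where d: "0 < d" "\<And>s s'. c * t + e - d < s \<and> s < c * t + e \<and> c * t + e < s' \<and> s' < c * t + e + d \<Longrightarrow> f s * f s' < 0"
    using cr unfolding crosses_def by blast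
  define q where "q = min (d / c) r"
  have "c * q \<le> c * (d / c)" using c by (intro mult_left_mono) (auto simp: q_def)
  then have q: "0 < q" "c * q \<le> d" "q \<le> r" using c d(1) r by (auto simp: q_def)
  have "g s * g s' < 0" if s: "t - q < s \<and> s < t \<and> t < s' \<and> s' < t + q" for s s'
  proof -
    have "c * (t - s) < c * q" "c * (s' - t) < c * q" "c * s < c * t" "c * t < c * s'"
      using s c by (intro mult_strict_left_mono; linarith)+
    then have "f (c * s + e) * f (c * s' + e) < 0" using q(2) by (intro d(2)) (simp add: algebra_simps)
    then show ?thesis using g[of s] g[of s'] s q(3) by simp
  qed
  then show ?thesis using q(1) unfolding crosses_def by blast
qed

lemma join_regular:
  assumes fl: "flat n \<alpha>" "flat n \<beta>" and reg: "regular n \<alpha> 0 1" "regular n \<beta> 0 1"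
  shows "regular n (\<alpha> +++ \<beta>) 0 1"
    and "path_word n (\<alpha> +++ \<beta>) 0 1 = path_word n \<alpha> 0 1 @ path_word n \<beta> 0 1"
proof -
  let ?j = "\<alpha> +++ \<beta>"
  have fj: "flat n ?j" by (rule flat_join[OF fl])
  have loop: "based_loop n ?j" by (rule pure_braid_based_loop[OF flat_pure_braid[OF fj]])
  have left: "?j s = \<alpha> (2 * s)" if "s \<le> 1 / 2" for s using that by (simp add: joinpaths_def)
  have right: "?j s = \<beta> (2 * s - 1)" if "1 / 2 \<le> s" for s
  proof (cases "s = 1 / 2")
    case True
    show ?thesis unfolding True using flat_before[OF fl(2), of 0] flat_after[OF fl(1), of 1] by (simp add: joinpaths_def)
  qed (use that in \<open>simp add: joinpaths_def\<close>)
  have mid: "noncollinear n (?j (1 / 2))"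
    using left[of "1 / 2"] flat_after[OF fl(1), of 1] base_noncollinear by simp
  show regj: "regular n ?j 0 1"
  proof (rule regularI)
    show "\<forall>i\<in>{1..n}. continuous_on {0..1} (\<lambda>t. ?j t i)" "noncollinear n (?j 0)" "noncollinear n (?j 1)"
      using loop base_noncollinear by (simp_all add: based_loop_def)
    fix t assume t: "t \<in> crit_in n ?j 0 1"
    then have "\<not> noncollinear n (?j t)" unfolding crit_in_iff by blast
    then have "t \<noteq> 1 / 2" using mid by metis
    then consider "t < 1 / 2" | "1 / 2 < t" by linarith
    then show "\<exists>i j k. {i, j, k} \<subseteq> {1..n} \<and> distinct [i, j, k] \<and>
       (\<forall>T. collinear_triple n (?j t) T \<longrightarrow> T = {i, j, k}) \<and> crosses (\<lambda>s. orient (?j s) i j k) t"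
    proof cases
      case 1
      then have "2 * t \<in> crit_in n \<alpha> 0 1" using t left[of t] by (auto simp: crit_in_iff)
      then obtain i j k where ijk: "{i, j, k} \<subseteq> {1..n}" "distinct [i, j, k]"
        "\<forall>T. collinear_triple n (\<alpha> (2 * t)) T \<longrightarrow> T = {i, j, k}" "crosses (\<lambda>s. orient (\<alpha> s) i j k) (2 * t)"
        using reg(1) unfolding regular_def by meson
      have "crosses (\<lambda>s. orient (?j s) i j k) t"
        by (rule crosses_affine_reparametrization[where c = 2 and e = 0 and r = "1 / 2 - t" and f = "\<lambda>s. orient (\<alpha> s) i j k"])
          (use ijk(4) 1 left in auto)
      then show ?thesis using ijk left[of t] 1 by auto
    next
      case 2
      then have "2 * t - 1 \<in> crit_in n \<beta> 0 1" using t right[of t] by (auto simp: crit_in_iff)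
      then obtain i j k where ijk: "{i, j, k} \<subseteq> {1..n}" "distinct [i, j, k]"
        "\<forall>T. collinear_triple n (\<beta> (2 * t - 1)) T \<longrightarrow> T = {i, j, k}" "crosses (\<lambda>s. orient (\<beta> s) i j k) (2 * t - 1)"
        using reg(2) unfolding regular_def by meson
      have "crosses (\<lambda>s. orient (?j s) i j k) t"
        by (rule crosses_affine_reparametrization[where c = 2 and e = "- 1" and r = "t - 1 / 2" and f = "\<lambda>s. orient (\<beta> s) i j k"])
          (use ijk(4) 2 right in auto)
      then show ?thesis using ijk right[of t] 2 by auto
    qed
  qed simp
  have "path_word n ?j 0 1 = path_word n ?j 0 (1 / 2) @ path_word n ?j (1 / 2) 1"
    using regj mid by (intro path_word_append) (auto simp: regular_def)
  moreover have "path_word n ?j (1 / 2 * 0 + 0) (1 / 2 * 1 + 0) = path_word n \<alpha> 0 1"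
    using reg(1) left by (intro path_word_affine) (auto simp: regular_def)
  moreover have "path_word n ?j (1 / 2 * 0 + 1 / 2) (1 / 2 * 1 + 1 / 2) = path_word n \<beta> 0 1"
  proof (rule path_word_affine)
    show "?j (1 / 2 * t + 1 / 2) = \<beta> t" if "t \<in> {0..1}" for t
      using right[of "1 / 2 * t + 1 / 2"] that by (simp add: field_simps)
  qed (use reg(2) in \<open>auto simp: regular_def\<close>)
  ultimately show "path_word n ?j 0 1 = path_word n \<alpha> 0 1 @ path_word n \<beta> 0 1" by simp
qed

theorem theorem1:
  fixes n :: nat
  assumes "3 \<le> n"
  shows "(\<forall>X\<in>carrier (PB n). \<exists>!g. \<exists>\<beta>\<in>X. good_stable n \<beta> \<and> g = f_braid n \<beta>) \<and>
         group_hom (PB n) (G3 n) (braid_map n)"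
proof (intro conjI ballI)
  fix X assume "X \<in> carrier (PB n)"
  then show "\<exists>!g. \<exists>\<beta>\<in>X. good_stable n \<beta> \<and> g = f_braid n \<beta>" by (rule braid_map_well_defined[OF assms])
next
  have words: "path_word n \<eta> 0 1 \<in> words (generators n)" if "flat n \<eta>" "regular n \<eta> 0 1" for \<eta>
    using path_word_words[OF assms pure_braid_based_loop[OF flat_pure_braid[OF that(1)]] that(2)] .
  have "braid_map n \<in> hom (PB n) (G3 n)"
  proof (rule homI)
    fix X assume X: "X \<in> carrier (PB n)"
    obtain \<alpha> where a: "\<alpha> \<in> X" "flat n \<alpha>" "regular n \<alpha> 0 1" using good_stable_rep[OF assms X] by blast
    then show "braid_map n X \<in> carrier (G3 n)"
      unfolding braid_map_eq[OF assms X a(1,3)] f_braid_def braid_word_eq G3_def presented_group_carrier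
      using words by blast
    fix Y assume Y: "Y \<in> carrier (PB n)"
    obtain \<beta> where b: "\<beta> \<in> Y" "flat n \<beta>" "regular n \<beta> 0 1" using good_stable_rep[OF assms Y] by blast
    have cls: "Z = isotopy n `` {\<eta>}" if Z: "Z \<in> carrier (PB n)" "\<eta> \<in> Z" for Z \<eta>
    proof -
      obtain \<zeta> where "Z = isotopy n `` {\<zeta>}" using Z(1) by (auto simp: PB_def quotient_def)
      then show ?thesis using Z(2) class_eqI[OF assms, of \<zeta> \<eta>] by simp
    qed
    have XY: "X \<otimes>\<^bsub>PB n\<^esub> Y = isotopy n `` {\<alpha> +++ \<beta>}"
      using PB_mult[OF assms a(2) b(2)] cls[OF X a(1)] cls[OF Y b(1)] by simp
    have mem: "\<alpha> +++ \<beta> \<in> X \<otimes>\<^bsub>PB n\<^esub> Y"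
      unfolding XY using equiv_class_self[OF equiv_isotopy[OF assms]] flat_pure_braid[OF flat_join[OF a(2) b(2)]] by simp
    have XYc: "X \<otimes>\<^bsub>PB n\<^esub> Y \<in> carrier (PB n)"
      unfolding XY by (rule flat_class[OF assms flat_join[OF a(2) b(2)]])
    note j = join_regular[OF a(2) b(2) a(3) b(3)]
    have "braid_map n (X \<otimes>\<^bsub>PB n\<^esub> Y) = word_cong (generators n) (relations n) `` {path_word n \<alpha> 0 1 @ path_word n \<beta> 0 1}"
      unfolding braid_map_eq[OF assms XYc mem j(1)] f_braid_def braid_word_eq j(2) ..
    also have "\<dots> = braid_map n X \<otimes>\<^bsub>G3 n\<^esub> braid_map n Y"
      unfolding braid_map_eq[OF assms X a(1,3)] braid_map_eq[OF assms Y b(1,3)] f_braid_def braid_word_eq G3_def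
      by (rule presented_group_mult[symmetric]) (use words a b in auto)
    finally show "braid_map n (X \<otimes>\<^bsub>PB n\<^esub> Y) = braid_map n X \<otimes>\<^bsub>G3 n\<^esub> braid_map n Y" .
  qed
  then show "group_hom (PB n) (G3 n) (braid_map n)"
    using PB_group[OF assms] G3_group by (simp add: group_hom_def group_hom_axioms_def)
qed

end
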